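(* Let $S=K[x,y,z]$ and let $J_0=I_0S\subset S$, where $I_0$ is a lex-segment ideal of $R=K[x,y]$ with $\dim_K(R/I_0)<\infty$. Then the map $$\overline{\psi}:\mathscr{A}_{I_0}\longrightarrow V_{hom}(J_0),\qquad \overline{\psi}(A)=I_t(X+A^{\underline{hom}}),$$ is well defined (that is, $I_t(X+A^{\underline{hom}})\in V_{hom}(J_0)$ for every $A\in\mathscr{A}_{I_0}$) and a bijection.
   Context: $K$ is a field of any characteristic, $R=K[x,y]$, $S=K[x,y,z]$. Initial terms and initial ideals $\operatorname{in}(\cdot)$ are taken with respect to the degree reverse lexicographic term order induced by $x>y$ on $R$ and by $x>y>z$ on $S$. A monomial ideal $I_0\subset R$ is a lex-segment ideal if for every monomial $u\in I_0$ of degree $d$, all monomials $v$ of degree $d$ with $v>_{\mathrm{Lex}}u$ (where $x>y$) also lie in $I_0$. For a monomial ideal $I_0\subset R$ with $\dim_K(R/I_0)<\infty$ put $t=\min\{j: x^j\in I_0\}$, $m_0=0$, $m_i=\min\{j: x^{t-i}y^j\in I_0\}$ for $1\le i\le t$, and $d_i=m_i-m_{i-1}$. $X$ is the $(t+1)\times t$ matrix with $X_{i,i}=y^{d_i}$, $X_{i+1,i}=-x$ for $1\le i\le t$, and all other entries $0$. Let $u_{i,j}=i-j+m_j-m_{i-1}$ for $1\le i\le t+1$, $1\le j\le t$. $\mathscr{A}_{I_0}$ is the set of all $(t+1)\times t$ matrices $A=(a_{i,j})$ with entries in $K[y]$ such that $$\deg(a_{i,j})\le\begin{cases}\min\{u_{i,j}-1,\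 d_i-1\}&\text{if } i\le j,\\ \min\{u_{i,j},\ d_j-1\}&\text{if } i>j,\end{cases}$$ with the convention that $a_{i,j}=0$ when the bound is negative (and the zero polynomial satisfies every bound). For a nonzero $f\in R$, $f=\sum_i c_iT_i$ with $c_i\in K\setminus\{0\}$ and distinct monomials $T_i$, the standard homogenization is $f^{hom}=\sum_i c_iT_iz^{\mu-\deg T_i}$ with $\mu=\deg f$. For $A\in\mathscr{A}_{I_0}$, $A^{\underline{hom}}$ is the matrix with entries $a_{i,j}^{\underline{hom}}=z^{u_{i,j}-\deg(a_{i,j})}a_{i,j}^{hom}$ (and $0$ if $a_{i,j}=0$). $I_t(M)$ denotes the ideal generated by the $t\times t$ minors of $M$. $V_{hom}(J_0)=\{J\subset S: J \text{ is a homogeneous ideal with } \operatorname{in}(J)=J_0\}$. *)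

theory Defs
  imports
    "HOL-Library.Poly_Mapping"
    "HOL-Library.Product_Plus"
    "Jordan_Normal_Form.Matrix"
    "Jordan_Normal_Form.Determinant"
    "Jordan_Normal_Form.DL_Submatrix"
begin

section \<open>The polynomial rings\<close>

text \<open>
  Polynomial rings are the monoid algebras of the exponent monoids:
  the exponent vector \<open>(a, b)\<close> stands for \<open>x^a y^b\<close> in \<open>R = K[x,y]\<close>, and
  \<open>(a, b, c)\<close> stands for \<open>x^a y^b z^c\<close> in \<open>S = K[x,y,z]\<close>.
\<close>

type_synonym 'k polyR = "(nat \<times> nat) \<Rightarrow>\<^sub>0 'k"
type_synonym 'k polyS = "(nat \<times> nat \<times> nat) \<Rightarrow>\<^sub>0 'k"

definition monR :: "nat \<times> nat \<Rightarrow> 'k::field polyR" where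
  "monR e = Poly_Mapping.single e 1"

definition monS :: "nat \<times> nat \<times> nat \<Rightarrow> 'k::field polyS" where
  "monS e = Poly_Mapping.single e 1"

fun tdegR :: "nat \<times> nat \<Rightarrow> nat" where
  "tdegR (a, b) = a + b"

fun tdegS :: "nat \<times> nat \<times> nat \<Rightarrow> nat" where
  "tdegS (a, b, c) = a + b + c"

text \<open>The degree of a polynomial; only used for nonzero polynomials.\<close>

definition degR :: "'k::field polyR \<Rightarrow> nat" where
  "degR f = Max (tdegR ` Poly_Mapping.keys f)"

definition embS :: "'k::field polyR \<Rightarrow> 'k polyS" where
  "embS f = (\<Sum>(a, b)\<in>Poly_Mapping.keys f.
               Poly_Mapping.single (a, b, 0) (Poly_Mapping.lookup f (a, b)))"

section \<open>Ideals\<close>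

lemma module_times: "Modules.module ((*) :: 'a::comm_ring_1 \<Rightarrow> 'a \<Rightarrow> 'a)"
  by standard (auto simp: algebra_simps)

text \<open>Ideals of a commutative ring are the submodules of the ring over itself.\<close>

definition is_ideal :: "'a::comm_ring_1 set \<Rightarrow> bool" where
  "is_ideal I \<longleftrightarrow> Modules.module.subspace (*) I"

definition ideal_gen :: "'a::comm_ring_1 set \<Rightarrow> 'a set" where
  "ideal_gen B = Modules.module.span (*) B"

lemma is_ideal_iff:
  "is_ideal I \<longleftrightarrow> 0 \<in> I \<and> (\<forall>f\<in>I. \<forall>g\<in>I. f + g \<in> I) \<and> (\<forall>c. \<forall>f\<in>I. c * f \<in> I)"
  unfolding is_ideal_def Modules.module.subspace_def[OF module_times] ..

lemma ideal_gen_eq: "ideal_gen B = \<Inter>{I. is_ideal I \<and> B \<subseteq> I}"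
  unfolding ideal_gen_def is_ideal_def Modules.module.span_def[OF module_times] hull_def ..

definition monomial_ideal :: "'k::field polyR set \<Rightarrow> bool" where
  "monomial_ideal I \<longleftrightarrow> (\<exists>E. I = ideal_gen (monR ` E))"

definition scaleR_K :: "'k::field \<Rightarrow> 'k polyR \<Rightarrow> 'k polyR" where
  "scaleR_K c f = Poly_Mapping.single 0 c * f"

lemma vector_space_scaleR_K: "vector_space scaleR_K"
  by standard
    (auto simp: scaleR_K_def algebra_simps single_add mult_single simp flip: mult.assoc)

text \<open>The \<open>K\<close>-vector space \<open>R/I\<close> is spanned by the residue classes of finitely many elements.\<close>

definition finite_dim_quotient :: "'k::field polyR set \<Rightarrow> bool" where
  "finite_dim_quotient I \<longleftrightarrow>
     (\<exists>B. finite B \<and> (\<forall>f. \<exists>g\<in>Modules.module.span scaleR_K B. f - g \<in> I))"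

fun lex_less :: "nat \<times> nat \<Rightarrow> nat \<times> nat \<Rightarrow> bool" where
  "lex_less (a, b) (a', b') \<longleftrightarrow> a < a' \<or> (a = a' \<and> b < b')"

definition lex_segment_ideal :: "'k::field polyR set \<Rightarrow> bool" where
  "lex_segment_ideal I \<longleftrightarrow> monomial_ideal I \<and>
     (\<forall>u v. monR u \<in> I \<and> tdegR v = tdegR u \<and> lex_less u v \<longrightarrow> monR v \<in> I)"

definition extS :: "'k::field polyR set \<Rightarrow> 'k polyS set" where
  "extS I = ideal_gen (embS ` I)"

section \<open>Initial ideals and homogeneous ideals of \<open>S\<close>\<close>

text \<open>Degree reverse lexicographic order with \<open>x > y > z\<close>: in equal degree, the monomial with the
  larger exponent at the last position where the two differ is the smaller one.\<close>

fun degrevlex_less :: "nat \<times> nat \<times> nat \<Rightarrow> nat \<times> nat \<times> nat \<Rightarrow> bool" where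
  "degrevlex_less (a, b, c) (a', b', c') \<longleftrightarrow>
     a + b + c < a' + b' + c' \<or>
     (a + b + c = a' + b' + c' \<and> (c > c' \<or> (c = c' \<and> (b > b' \<or> (b = b' \<and> a > a')))))"

definition lead_exp :: "'k::field polyS \<Rightarrow> nat \<times> nat \<times> nat" where
  "lead_exp f = (THE e. e \<in> Poly_Mapping.keys f \<and>
                   (\<forall>e'\<in>Poly_Mapping.keys f. e' \<noteq> e \<longrightarrow> degrevlex_less e' e))"

definition initial_ideal :: "'k::field polyS set \<Rightarrow> 'k polyS set" where
  "initial_ideal J = ideal_gen {monS (lead_exp f) | f. f \<in> J \<and> f \<noteq> 0}"

definition homogeneous :: "'k::field polyS \<Rightarrow> bool" where
  "homogeneous f \<longleftrightarrow> (\<exists>n. \<forall>e\<in>Poly_Mapping.keys f. tdegS e = n)"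

definition homogeneous_ideal :: "'k::field polyS set \<Rightarrow> bool" where
  "homogeneous_ideal J \<longleftrightarrow> (\<exists>B. (\<forall>f\<in>B. homogeneous f) \<and> J = ideal_gen B)"

definition V_hom :: "'k::field polyS set \<Rightarrow> 'k polyS set set" where
  "V_hom J0 = {J. homogeneous_ideal J \<and> initial_ideal J = J0}"

section \<open>The numerical data of \<open>I\<^sub>0\<close>\<close>

definition t_of :: "'k::field polyR set \<Rightarrow> nat" where
  "t_of I0 = (LEAST j. monR (j, 0) \<in> I0)"

definition m_of :: "'k::field polyR set \<Rightarrow> nat \<Rightarrow> nat" where
  "m_of I0 i = (if i = 0 then 0 else LEAST j. monR (t_of I0 - i, j) \<in> I0)"

definition d_of :: "'k::field polyR set \<Rightarrow> nat \<Rightarrow> int" where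
  "d_of I0 i = int (m_of I0 i) - int (m_of I0 (i - 1))"

definition u_of :: "'k::field polyR set \<Rightarrow> nat \<Rightarrow> nat \<Rightarrow> int" where
  "u_of I0 i j = int i - int j + int (m_of I0 j) - int (m_of I0 (i - 1))"

section \<open>The matrices\<close>

text \<open>Library matrices are indexed from 0. The functions giving their entries below take
  indices counted from 1, whence the successors. The exponent \<open>d\<^sub>i\<close> is nonnegative because
  \<open>m\<^sub>i\<close> is weakly increasing for a monomial ideal of finite codimension.\<close>

definition X_mat :: "'k::field polyR set \<Rightarrow> 'k polyR mat" where
  "X_mat I0 = mat (t_of I0 + 1) (t_of I0)
     (\<lambda>(i, j). if i = j then monR (0, nat (d_of I0 (Suc i)))
               else if i = Suc j then - monR (1, 0)
               else 0)"

text \<open>\<open>K[y]\<close> as a subring of \<open>R\<close>\<close>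

definition Ky :: "'k::field polyR set" where
  "Ky = {f. \<forall>(a, b)\<in>Poly_Mapping.keys f. a = 0}"

definition deg_bound :: "'k::field polyR set \<Rightarrow> nat \<Rightarrow> nat \<Rightarrow> int" where
  "deg_bound I0 i j =
     (if i \<le> j then min (u_of I0 i j - 1) (d_of I0 i - 1)
      else min (u_of I0 i j) (d_of I0 j - 1))"

definition A_set :: "'k::field polyR set \<Rightarrow> 'k polyR mat set" where
  "A_set I0 = {A \<in> carrier_mat (t_of I0 + 1) (t_of I0).
     \<forall>i < t_of I0 + 1. \<forall>j < t_of I0.
       A $$ (i, j) \<in> Ky \<and>
       (A $$ (i, j) = 0 \<or> int (degR (A $$ (i, j))) \<le> deg_bound I0 (Suc i) (Suc j))}"

definition std_hom :: "'k::field polyR \<Rightarrow> 'k polyS" where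
  "std_hom f = (\<Sum>(a, b)\<in>Poly_Mapping.keys f.
     Poly_Mapping.single (a, b, degR f - tdegR (a, b)) (Poly_Mapping.lookup f (a, b)))"

text \<open>For matrices in \<open>A_set I0\<close> the exponent of \<open>z\<close> is nonnegative by the degree bounds on the entries.\<close>

definition hom_mat :: "'k::field polyR set \<Rightarrow> 'k polyR mat \<Rightarrow> 'k polyS mat" where
  "hom_mat I0 A = mat (t_of I0 + 1) (t_of I0)
     (\<lambda>(i, j). if A $$ (i, j) = 0 then 0
               else monS (0, 0, nat (u_of I0 (Suc i) (Suc j) - int (degR (A $$ (i, j)))))
                    * std_hom (A $$ (i, j)))"

definition minors_ideal :: "nat \<Rightarrow> 'a::comm_ring_1 mat \<Rightarrow> 'a set" where
  "minors_ideal k M = ideal_gen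
     {det (submatrix M I J) | I J.
        I \<subseteq> {..<dim_row M} \<and> J \<subseteq> {..<dim_col M} \<and> card I = k \<and> card J = k}"

definition psi_bar :: "'k::field polyR set \<Rightarrow> 'k polyR mat \<Rightarrow> 'k polyS set" where
  "psi_bar I0 A = minors_ideal (t_of I0) (map_mat embS (X_mat I0) + hom_mat I0 A)"

end

theory Submission
  imports Defs
begin

text \<open>
  Write \<open>T = K[y,z]\<close> and let \<open>J\<close> be a homogeneous ideal of \<open>S\<close> with initial ideal \<open>J\<^sub>0\<close>. The monomials
  of \<open>J\<^sub>0\<close> are those lying over a staircase in the \<open>x\<close>- and \<open>y\<close>-exponents, with corners
  \<open>x^(t-i) y^(m i)\<close> for \<open>i = 0, ..., t\<close>. Forms \<open>f i\<close> in \<open>J\<close> whose leading monomials are the corners have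
  leading monomials with pairwise distinct \<open>x\<close>-exponents, so no cancellation of leading terms
  occurs in a \<open>T\<close>-linear combination of them. If the \<open>x\<close>-degrees of \<open>f 1, ..., f t\<close> are kept below
  \<open>t\<close>, the elements of \<open>J\<close> of \<open>x\<close>-degree at most \<open>t\<close> are the free \<open>T\<close>-module on \<open>f 0, ..., f t\<close>. The
  multiplication by \<open>x\<close> from the span of \<open>f 1, ..., f t\<close> to this module is then described by a unique
  matrix over \<open>T\<close>, and this yields relations \<open>x f (j+1) = y^(d j) f j + \<Sum>i. \<beta> i j * f i\<close>. The
  theorem says that the basis can be chosen in exactly one way such that the entries \<open>\<beta> i j\<close> satisfy
  the degree bounds, and that the \<open>f i\<close> are then the signed maximal minors of the relation matrix.

  The map is well defined because the signed minors of the homogenized matrix satisfy these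
  relations, by Laplace expansion with a repeated column. Modulo \<open>z\<close> the first \<open>t\<close> rows form a lower
  triangular matrix, so the last minor is \<open>y^(m t)\<close> modulo \<open>z\<close>, and the relations carry the leading
  terms over to the other minors (\<open>shaped_hb_basis\<close>). The relations also show that the minors
  generate their ideal in the form \<open>S f 0 + T f 1 + ... + T f t\<close>, and the distinctness of leading
  exponents gives the initial ideal (\<open>lead_exps_of_rel\<close>).

  For the bijection, note that two such bases of the same ideal differ by a matrix \<open>1 + \<nu>\<close> over
  \<open>T\<close>. A weight in which \<open>z\<close> is heavy and positions further below the diagonal are heavier
  gives \<open>\<nu>\<close> and \<open>\<beta>\<close> positive weight, and the base change equation (\<open>change_basis\<close>) becomes, up to terms of
  larger weight, the linear equation
  \<open>\<beta>' i j - \<beta> i j = y^(d i) * \<nu> (i+1) (j+1) - y^(d j) * \<nu> i j\<close>. It decouples along the diagonals of the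
  matrix and is solved uniquely there by division with remainder by powers of \<open>y\<close>; the remainders
  are exactly the matrices with the prescribed degree bounds. Induction on the weight
  gives uniqueness (\<open>normal_rel_unique\<close>) and existence (\<open>ex_normal_rel\<close>) of a normal relation
  matrix. That the basis is the family of minors of this matrix follows because two bases with the
  same relation matrix coincide (\<open>rel_unique\<close>). The entries of a normal matrix are the
  homogenizations of the entries of a unique matrix in the parameter space.
\<close>

section \<open>Supports and leading exponents\<close>

abbreviation "keys \<equiv> Poly_Mapping.keys"
abbreviation "lookup \<equiv> Poly_Mapping.lookup"

lemma keys_multE:
  fixes f g :: "'a::cancel_comm_monoid_add \<Rightarrow>\<^sub>0 'k::field"
  assumes "e \<in> keys (f * g)"
  obtains a b where "a \<in> keys f" "b \<in> keys g" "e = a + b"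
  using keys_mult[of f g] assms by blast

lemma keys_addE:
  assumes "e \<in> keys (f + g)"
  obtains "e \<in> keys f" | "e \<in> keys g"
  using keys_add[of f g] assms by blast

lemma keys_minusE:
  fixes f g :: "'a \<Rightarrow>\<^sub>0 'k::field"
  assumes "e \<in> keys (f - g)"
  obtains "e \<in> keys f" | "e \<in> keys g"
proof -
  have "lookup f e \<noteq> 0 \<or> lookup g e \<noteq> 0"
    using assms by (auto simp: in_keys_iff lookup_minus)
  then show ?thesis using that by (auto simp: in_keys_iff)
qed

lemma keys_uminus_field [simp]: "keys (- (f :: 'a \<Rightarrow>\<^sub>0 'k::field)) = keys f"
  by (auto simp: in_keys_iff)

lemma keys_sumE:
  assumes "e \<in> keys (\<Sum>i\<in>I. f i)"
  obtains i where "i \<in> I" "e \<in> keys (f i)"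
  using keys_sum[of f I] assms by blast

text \<open>Leading coefficients of products are read off from this: the sum of two leading exponents splits
  in only one way.\<close>

lemma lookup_mult_unique_split:
  fixes f g :: "'a::cancel_comm_monoid_add \<Rightarrow>\<^sub>0 'k::field"
  assumes "\<And>a b. a \<in> keys f \<Longrightarrow> b \<in> keys g \<Longrightarrow> a + b = e1 + e2 \<Longrightarrow> a = e1 \<and> b = e2"
  shows "lookup (f * g) (e1 + e2) = lookup f e1 * lookup g e2"
proof -
  define f' where "f' = f - Poly_Mapping.single e1 (lookup f e1)"
  define g' where "g' = g - Poly_Mapping.single e2 (lookup g e2)"
  have kf: "keys f' \<subseteq> keys f - {e1}" and kg: "keys g' \<subseteq> keys g - {e2}"
    by (auto simp: f'_def g'_def in_keys_iff lookup_minus lookup_single when_def split: if_splits)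
  have "f * g = Poly_Mapping.single (e1 + e2) (lookup f e1 * lookup g e2)
      + Poly_Mapping.single e1 (lookup f e1) * g' + f' * g"
    by (simp add: f'_def g'_def algebra_simps mult_single)
  moreover have "e1 + e2 \<notin> keys (Poly_Mapping.single e1 (lookup f e1) * g')"
    using kg by (auto elim!: keys_multE split: if_splits)
  moreover have "e1 + e2 \<notin> keys (f' * g)"
    using kf assms by (fastforce elim!: keys_multE)
  ultimately show ?thesis
    by (simp add: lookup_add not_in_keys_iff_lookup_eq_zero)
qed

lemma lookup_single_mult:
  fixes g :: "'a::cancel_comm_monoid_add \<Rightarrow>\<^sub>0 'k::field"
  shows "lookup (Poly_Mapping.single e1 c * g) (e1 + e2) = c * lookup g e2"
  by (subst lookup_mult_unique_split) (auto split: if_splits)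

lemma keys_single_mult:
  fixes g :: "'a::cancel_comm_monoid_add \<Rightarrow>\<^sub>0 'k::field"
  assumes "c \<noteq> 0"
  shows "keys (Poly_Mapping.single e1 c * g) = (+) e1 ` keys g"
proof (intro equalityI subsetI)
  fix e assume "e \<in> (+) e1 ` keys g"
  then show "e \<in> keys (Poly_Mapping.single e1 c * g)"
    using assms by (auto simp: in_keys_iff lookup_single_mult)
qed (auto elim!: keys_multE split: if_splits)

notation degrevlex_less (infix "\<prec>" 50)

declare degrevlex_less.simps [simp del]

lemma degrevlex_irrefl [simp]: "\<not> e \<prec> e"
  by (cases e) (auto simp: degrevlex_less.simps)

lemma degrevlex_trans: "e \<prec> e' \<Longrightarrow> e' \<prec> e'' \<Longrightarrow> e \<prec> e''"
  by (cases e; cases e'; cases e'') (auto simp: degrevlex_less.simps)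

lemma degrevlex_total: "e = e' \<or> e \<prec> e' \<or> e' \<prec> e"
  by (cases e; cases e') (auto simp: degrevlex_less.simps)

lemma degrevlex_add: "e \<prec> e' \<Longrightarrow> e + g \<prec> e' + g"
  by (cases e; cases e'; cases g) (auto simp: degrevlex_less.simps)

lemma degrevlex_add_mono:
  assumes "e = e1 \<or> e \<prec> e1" "g = g1 \<or> g \<prec> g1"
  shows "e + g = e1 + g1 \<and> e = e1 \<and> g = g1 \<or> e + g \<prec> e1 + g1"
proof (cases "e = e1")
  case True
  then show ?thesis using assms(2) degrevlex_add[of g g1 e1] by (auto simp: add.commute)
next
  case False
  then have "e + g \<prec> e1 + g" using assms(1) degrevlex_add by blast
  moreover have "e1 + g = e1 + g1 \<or> e1 + g \<prec> e1 + g1"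
    using assms(2) degrevlex_add[of g g1 e1] by (auto simp: add.commute)
  ultimately show ?thesis using degrevlex_trans by metis
qed

lemma tdegS_add [simp]: "tdegS (e + e') = tdegS e + tdegS e'"
  by (cases e; cases e') auto

lemma finite_degrevlex_below: "finite {e'. e' \<prec> e}"
proof (rule finite_subset)
  let ?n = "tdegS e"
  show "{e'. e' \<prec> e} \<subseteq> {..?n} \<times> {..?n} \<times> {..?n}"
    by (cases e) (auto simp: degrevlex_less.simps)
qed auto

text \<open>Every exponent has finitely many predecessors because the order refines the total degree. Their
  number serves as the induction measure of all division arguments below.\<close>

definition degrevlex_rank :: "nat \<times> nat \<times> nat \<Rightarrow> nat" where
  "degrevlex_rank e = card {e'. e' \<prec> e}"

lemma degrevlex_rank_mono: "e \<prec> e' \<Longrightarrow> degrevlex_rank e < degrevlex_rank e'"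
  unfolding degrevlex_rank_def
  by (rule psubset_card_mono[OF finite_degrevlex_below])
    (use degrevlex_trans degrevlex_irrefl in blast)

lemma ex_degrevlex_max:
  assumes "finite K" "K \<noteq> {}"
  shows "\<exists>e\<in>K. \<forall>e'\<in>K. e' \<noteq> e \<longrightarrow> e' \<prec> e"
  using assms
proof (induction K rule: finite_ne_induct)
  case (insert x F)
  then obtain e where "e \<in> F" "\<forall>e'\<in>F. e' \<noteq> e \<longrightarrow> e' \<prec> e" by auto
  then show ?case
    using degrevlex_total[of x e] by (cases "x \<prec> e") (auto intro: degrevlex_trans)
qed auto

lemma lead_exp_eqI:
  assumes "e \<in> keys f" "\<And>e'. e' \<in> keys f \<Longrightarrow> e' = e \<or> e' \<prec> e"
  shows "lead_exp f = e"
  unfolding lead_exp_def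
proof (rule the_equality)
  show "e \<in> keys f \<and> (\<forall>e'\<in>keys f. e' \<noteq> e \<longrightarrow> e' \<prec> e)"
    using assms by auto
next
  fix e2 assume "e2 \<in> keys f \<and> (\<forall>e'\<in>keys f. e' \<noteq> e2 \<longrightarrow> e' \<prec> e2)"
  then show "e2 = e" using assms degrevlex_trans degrevlex_irrefl by metis
qed

lemma
  assumes "f \<noteq> 0"
  shows lead_exp_in_keys: "lead_exp f \<in> keys f"
    and lead_exp_max: "e \<in> keys f \<Longrightarrow> e = lead_exp f \<or> e \<prec> lead_exp f"
proof -
  obtain m where m: "m \<in> keys f" "\<forall>e'\<in>keys f. e' \<noteq> m \<longrightarrow> e' \<prec> m"
    using ex_degrevlex_max[of "keys f"] assms by auto
  then have "lead_exp f = m" by (intro lead_exp_eqI) auto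
  with m show "lead_exp f \<in> keys f" "e \<in> keys f \<Longrightarrow> e = lead_exp f \<or> e \<prec> lead_exp f"
    by auto
qed

lemma lead_exp_below:
  assumes "f \<noteq> 0" "\<And>e. e \<in> keys f \<Longrightarrow> e = b \<or> e \<prec> b" "lookup f b = 0"
  shows "lead_exp f \<prec> b"
proof -
  have "lead_exp f \<in> keys f" by (rule lead_exp_in_keys[OF assms(1)])
  moreover from this have "lead_exp f \<noteq> b" using assms(3) by (auto simp: in_keys_iff)
  ultimately show ?thesis using assms(2) by blast
qed

lemma
  fixes f g :: "'k::field polyS"
  assumes "f \<noteq> 0" "g \<noteq> 0"
  shows lead_exp_mult: "lead_exp (f * g) = lead_exp f + lead_exp g"
    and polyS_mult_nonzero: "f * g \<noteq> 0"
proof -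
  have bound: "e + e' = lead_exp f + lead_exp g \<and> e = lead_exp f \<and> e' = lead_exp g
      \<or> e + e' \<prec> lead_exp f + lead_exp g" if "e \<in> keys f" "e' \<in> keys g" for e e'
    by (rule degrevlex_add_mono) (use that assms lead_exp_max in blast)+
  have "lookup (f * g) (lead_exp f + lead_exp g)
      = lookup f (lead_exp f) * lookup g (lead_exp g)"
    by (rule lookup_mult_unique_split) (use bound degrevlex_irrefl in metis)
  then have *: "lead_exp f + lead_exp g \<in> keys (f * g)"
    using lead_exp_in_keys[OF assms(1)] lead_exp_in_keys[OF assms(2)]
    by (simp add: in_keys_iff)
  then show "f * g \<noteq> 0" by auto
  show "lead_exp (f * g) = lead_exp f + lead_exp g"
    by (rule lead_exp_eqI[OF *]) (elim keys_multE, use bound in blast)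
qed

lemma lead_exp_subtract:
  fixes g p :: "'k::field polyS"
  assumes "g \<noteq> 0" "\<And>a b c. (a, b, c) \<in> keys p \<Longrightarrow> (a, b, c) = lead_exp g \<or> (a, b, c) \<prec> lead_exp g"
    and "lookup p (lead_exp g) = lookup g (lead_exp g)" "g - p \<noteq> 0"
  shows "lead_exp (g - p) \<prec> lead_exp g"
proof (rule lead_exp_below[OF assms(4)])
  fix e assume "e \<in> keys (g - p)"
  then show "e = lead_exp g \<or> e \<prec> lead_exp g"
  proof (rule keys_minusE)
    assume "e \<in> keys p"
    then show ?thesis using assms(2)[of "fst e" "fst (snd e)" "snd (snd e)"] by simp
  qed (rule lead_exp_max[OF assms(1)])
qed (use assms(3) in \<open>simp add: lookup_minus\<close>)

text \<open>
  Leading terms with distinct exponents cannot cancel. Through this lemma the initial ideal of the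
  ideal of minors is computed from a module basis, and no S-polynomials are needed.
\<close>

lemma lead_exp_sum_distinct:
  fixes h :: "'i \<Rightarrow> 'k::field polyS"
  assumes "finite I" and ex: "\<exists>i\<in>I. h i \<noteq> 0"
    and inj: "inj_on (\<lambda>i. lead_exp (h i)) {i\<in>I. h i \<noteq> 0}"
  shows "(\<Sum>i\<in>I. h i) \<noteq> 0 \<and>
    (\<exists>k\<in>I. h k \<noteq> 0 \<and> lead_exp (\<Sum>i\<in>I. h i) = lead_exp (h k))"
proof -
  let ?I = "{i\<in>I. h i \<noteq> 0}"
  obtain k where k: "k \<in> ?I"
      "\<forall>e'\<in>(\<lambda>i. lead_exp (h i)) ` ?I. e' \<noteq> lead_exp (h k) \<longrightarrow> e' \<prec> lead_exp (h k)"
    using ex_degrevlex_max[of "(\<lambda>i. lead_exp (h i)) ` ?I"] assms by auto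
  have below: "lead_exp (h i) \<prec> lead_exp (h k)" if "i \<in> ?I" "i \<noteq> k" for i
  proof -
    have "lead_exp (h i) \<noteq> lead_exp (h k)"
      using inj_onD[OF inj, of i k] that k(1) by blast
    then show ?thesis using k(2) that by blast
  qed
  have zero: "lookup (h i) (lead_exp (h k)) = 0" if "i \<in> I - {k}" for i
  proof (cases "h i = 0")
    case False
    then show ?thesis
      using that below[of i] lead_exp_max[of "h i" "lead_exp (h k)"]
      by (metis (mono_tags, lifting) DiffD1 DiffD2 degrevlex_irrefl degrevlex_trans insertI1
          mem_Collect_eq not_in_keys_iff_lookup_eq_zero)
  qed auto
  have "lookup (\<Sum>i\<in>I. h i) (lead_exp (h k)) = lookup (h k) (lead_exp (h k))"
    unfolding lookup_sum
    using assms k(1) zero by (subst sum.remove[of _ k]) (auto simp del: lookup_eq_zero_in_keys_contradict)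
  then have in_keys: "lead_exp (h k) \<in> keys (\<Sum>i\<in>I. h i)"
    using k(1) lead_exp_in_keys[of "h k"] by (simp add: in_keys_iff)
  moreover have "lead_exp (\<Sum>i\<in>I. h i) = lead_exp (h k)"
  proof (rule lead_exp_eqI[OF in_keys])
    fix e assume "e \<in> keys (\<Sum>i\<in>I. h i)"
    then obtain i where i: "i \<in> I" "e \<in> keys (h i)" by (rule keys_sumE)
    then have "h i \<noteq> 0" by auto
    with i have "e = lead_exp (h i) \<or> e \<prec> lead_exp (h i)" using lead_exp_max by blast
    then show "e = lead_exp (h k) \<or> e \<prec> lead_exp (h k)"
      using below[of i] i \<open>h i \<noteq> 0\<close> by (cases "i = k") (auto intro: degrevlex_trans)
  qed
  ultimately show ?thesis using k(1) by auto
qed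

section \<open>Ideals and monomial ideals\<close>

lemma ideal_gen_is_ideal: "is_ideal (ideal_gen B)"
  unfolding ideal_gen_def is_ideal_def
  by (rule module.subspace_span[OF module_times])

lemma ideal_gen_superset: "B \<subseteq> ideal_gen B"
  unfolding ideal_gen_def by (rule module.span_superset[OF module_times])

lemma ideal_gen_minimal: "B \<subseteq> I \<Longrightarrow> is_ideal I \<Longrightarrow> ideal_gen B \<subseteq> I"
  unfolding ideal_gen_eq by auto

lemma
  assumes "is_ideal I"
  shows ideal_zero: "0 \<in> I"
    and ideal_add: "f \<in> I \<Longrightarrow> g \<in> I \<Longrightarrow> f + g \<in> I"
    and ideal_mult: "f \<in> I \<Longrightarrow> c * f \<in> I"
    and ideal_minus: "f \<in> I \<Longrightarrow> g \<in> I \<Longrightarrow> f - g \<in> I"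
    and ideal_sum: "(\<And>i. i \<in> S \<Longrightarrow> h i \<in> I) \<Longrightarrow> (\<Sum>i\<in>S. h i) \<in> I"
proof -
  have *: "0 \<in> I" "\<And>f g. f \<in> I \<Longrightarrow> g \<in> I \<Longrightarrow> f + g \<in> I" "\<And>f c. f \<in> I \<Longrightarrow> c * f \<in> I"
    using assms unfolding is_ideal_iff by auto
  then show "0 \<in> I" "f \<in> I \<Longrightarrow> g \<in> I \<Longrightarrow> f + g \<in> I" "f \<in> I \<Longrightarrow> c * f \<in> I" by auto
  show "f - g \<in> I" if "f \<in> I" "g \<in> I"
    using *(2)[OF that(1) *(3)[OF that(2), of "-1"]] by simp
  show "(\<Sum>i\<in>S. h i) \<in> I" if "\<And>i. i \<in> S \<Longrightarrow> h i \<in> I"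
    using that by (induction S rule: infinite_finite_induct) (auto intro: *)
qed

lemma sum_single_keys: "(\<Sum>e\<in>keys f. Poly_Mapping.single e (lookup f e)) = f"
  by (rule poly_mapping_eqI)
    (auto simp: lookup_sum lookup_single when_def not_in_keys_iff_lookup_eq_zero)

lemma ideal_gen_monomials:
  fixes E :: "'a::cancel_comm_monoid_add set"
  shows "ideal_gen ((\<lambda>e. Poly_Mapping.single e (1::'k::field)) ` E)
    = {f. \<forall>e\<in>keys f. \<exists>e1\<in>E. \<exists>e2. e = e1 + e2}" (is "?I = ?M")
proof
  have "is_ideal ?M"
    unfolding is_ideal_iff
    by (auto elim!: keys_addE keys_multE) (metis add.assoc add.commute)
  moreover have "(\<lambda>e. Poly_Mapping.single e (1::'k)) ` E \<subseteq> ?M"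
    by (auto simp: when_def split: if_splits) (metis add.right_neutral)
  ultimately show "?I \<subseteq> ?M" by (intro ideal_gen_minimal)
next
  show "?M \<subseteq> ?I"
  proof
    fix f :: "'a \<Rightarrow>\<^sub>0 'k" assume f: "f \<in> ?M"
    have "Poly_Mapping.single e (lookup f e) \<in> ?I" if e: "e \<in> keys f" for e
    proof -
      obtain e1 e2 where "e1 \<in> E" "e = e1 + e2" using f e by auto
      then have "Poly_Mapping.single e (lookup f e)
          = Poly_Mapping.single e2 (lookup f e) * Poly_Mapping.single e1 1"
        by (simp add: mult_single add.commute)
      then show ?thesis
        using \<open>e1 \<in> E\<close> ideal_gen_superset[of "(\<lambda>e. Poly_Mapping.single e (1::'k)) ` E"]
        by (auto intro!: ideal_mult ideal_gen_is_ideal)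
    qed
    then have "(\<Sum>e\<in>keys f. Poly_Mapping.single e (lookup f e)) \<in> ?I"
      by (intro ideal_sum ideal_gen_is_ideal)
    then show "f \<in> ?I" by (simp add: sum_single_keys)
  qed
qed

text \<open>For an ideal the leading exponents already form an upward closed set, so the initial ideal
  and this set determine each other.\<close>

definition lead_exps :: "'k::field polyS set \<Rightarrow> (nat \<times> nat \<times> nat) set" where
  "lead_exps J = {lead_exp f | f. f \<in> J \<and> f \<noteq> 0}"

lemma lead_exps_add:
  assumes "is_ideal J" "e \<in> lead_exps J"
  shows "e + e' \<in> lead_exps (J :: 'k::field polyS set)"
proof -
  obtain f where f: "f \<in> J" "f \<noteq> 0" "e = lead_exp f" using assms(2) by (auto simp: lead_exps_def)
  let ?m = "Poly_Mapping.single e' (1::'k)"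
  have "keys ?m = {e'}" by simp
  then have m: "?m \<noteq> 0" "lead_exp ?m = e'"
    by fastforce (rule lead_exp_eqI, auto)
  have "e + e' = lead_exp (?m * f)" "?m * f \<noteq> 0"
    using f m by (auto simp: lead_exp_mult polyS_mult_nonzero add.commute)
  then show ?thesis using f ideal_mult[OF assms(1)] by (auto simp: lead_exps_def)
qed

lemma initial_ideal_eq:
  assumes "is_ideal J"
  shows "initial_ideal J = {f :: 'k::field polyS. keys f \<subseteq> lead_exps J}"
proof -
  have "{monS (lead_exp f) | f. f \<in> J \<and> f \<noteq> 0} = (\<lambda>e. Poly_Mapping.single e (1::'k)) ` lead_exps J"
    by (auto simp: lead_exps_def monS_def)
  moreover have "(\<exists>e1\<in>lead_exps J. \<exists>e2. e = e1 + e2) \<longleftrightarrow> e \<in> lead_exps J" for e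
    using lead_exps_add[OF assms] by (metis add.right_neutral)
  ultimately show ?thesis
    unfolding initial_ideal_def by (auto simp: ideal_gen_monomials)
qed

text \<open>Among the elements of \<open>J\<close> outside \<open>J'\<close>, one of smallest leading exponent could be lowered by a
  multiple of an element of \<open>J'\<close> with the same leading exponent.\<close>

lemma ideal_eq_of_lead_exps:
  fixes J :: "'k::field polyS set"
  assumes "is_ideal J'" "is_ideal J" "J' \<subseteq> J" "lead_exps J \<subseteq> lead_exps J'"
  shows "J' = J"
proof -
  have "g \<in> J'" if "g \<in> J" for g
    using that
  proof (induction "degrevlex_rank (lead_exp g)" arbitrary: g rule: less_induct)
    case less
    show ?case
    proof (cases "g = 0")
      case False
      then have "lead_exp g \<in> lead_exps J" using less.prems by (auto simp: lead_exps_def)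
      then obtain h where h: "h \<in> J'" "h \<noteq> 0" "lead_exp h = lead_exp g"
        using assms(4) by (auto simp: lead_exps_def)
      define k where "k = lookup g (lead_exp g) / lookup h (lead_exp g)"
      define p where "p = Poly_Mapping.single 0 k * h"
      have look: "lookup p e = k * lookup h e" for e
        using lookup_single_mult[of 0 k h e] by (simp add: p_def)
      have hl: "lookup h (lead_exp g) \<noteq> 0"
        using lead_exp_in_keys[OF h(2)] h(3) by (simp add: in_keys_iff)
      have pJ': "p \<in> J'" unfolding p_def using assms(1) h(1) by (rule ideal_mult)
      have "g - p \<in> J'"
      proof (cases "g - p = 0")
        case ne: False
        have "lead_exp (g - p) \<prec> lead_exp g"
        proof (rule lead_exp_subtract[OF False _ _ ne])
          fix a b c assume "(a, b, c) \<in> keys p"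
          then have "(a, b, c) \<in> keys h" by (auto simp: in_keys_iff look)
          then show "(a, b, c) = lead_exp g \<or> (a, b, c) \<prec> lead_exp g" using lead_exp_max[OF h(2)] h(3) by auto
        qed (use hl in \<open>simp add: look k_def\<close>)
        then have "degrevlex_rank (lead_exp (g - p)) < degrevlex_rank (lead_exp g)"
          by (rule degrevlex_rank_mono)
        moreover have "g - p \<in> J" using less.prems pJ' assms(2,3) by (blast intro: ideal_minus)
        ultimately show ?thesis by (rule less.hyps)
      qed (use ideal_zero[OF assms(1)] in simp)
      then show ?thesis using ideal_add[OF assms(1) _ pJ', of "g - p"] by simp
    qed (use ideal_zero[OF assms(1)] in simp)
  qed
  then show ?thesis using assms(3) by auto
qed

lemma support_set_inject:
  fixes E E' :: "'a set"
  assumes "{f :: 'a \<Rightarrow>\<^sub>0 'k::field. keys f \<subseteq> E} = {f. keys f \<subseteq> E'}"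
  shows "E = E'"
proof -
  have "e \<in> E \<longleftrightarrow> e \<in> E'" for e
    using assms[unfolded set_eq_iff, rule_format, of "Poly_Mapping.single e 1"] by simp
  then show ?thesis by auto
qed

section \<open>Homogeneous components\<close>

definition part :: "('a \<Rightarrow> bool) \<Rightarrow> ('a \<Rightarrow>\<^sub>0 'k::field) \<Rightarrow> ('a \<Rightarrow>\<^sub>0 'k)" where
  "part P f = (\<Sum>e | e \<in> keys f \<and> P e. Poly_Mapping.single e (lookup f e))"

lemma lookup_part: "lookup (part P f) e = (if P e then lookup f e else 0)"
  by (auto simp: part_def lookup_sum lookup_single when_def not_in_keys_iff_lookup_eq_zero)

lemma keys_part: "keys (part P f) = {e \<in> keys f. P e}"
  by (auto simp: in_keys_iff lookup_part split: if_splits)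

lemma part_add: "part P (f + g) = part P f + part P g"
  by (rule poly_mapping_eqI) (simp add: lookup_part lookup_add)

lemma part_sum: "part P (\<Sum>i\<in>I. f i) = (\<Sum>i\<in>I. part P (f i))"
  by (rule poly_mapping_eqI) (simp add: lookup_part lookup_sum)

lemma part_degree_single_mult:
  "part (\<lambda>e. tdegS e = n) (Poly_Mapping.single e k * f)
    = (if tdegS e \<le> n then Poly_Mapping.single e k * part (\<lambda>e'. tdegS e' = n - tdegS e) f else 0)"
proof (rule poly_mapping_eqI)
  fix e'
  let ?s = "Poly_Mapping.single e k"
  show "lookup (part (\<lambda>e. tdegS e = n) (?s * f)) e'
    = lookup (if tdegS e \<le> n then ?s * part (\<lambda>e'. tdegS e' = n - tdegS e) f else 0) e'"
  proof (cases "\<exists>r. e' = e + r")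
    case True
    then obtain r where "e' = e + r" ..
    then show ?thesis by (auto simp: lookup_part lookup_single_mult)
  next
    case False
    then have "e' \<notin> keys (?s * g)" for g
      by (auto elim!: keys_multE split: if_splits)
    then show ?thesis by (auto simp: lookup_part in_keys_iff)
  qed
qed

lemma homogeneous_ideal_is_ideal: "homogeneous_ideal J \<Longrightarrow> is_ideal J"
  unfolding homogeneous_ideal_def using ideal_gen_is_ideal by auto

text \<open>The elements whose homogeneous components all lie in \<open>J\<close> form an ideal, and this ideal contains
  the homogeneous generators.\<close>

lemma homogeneous_ideal_part:
  assumes "homogeneous_ideal J" "f \<in> J"
  shows "part (\<lambda>e. tdegS e = n) f \<in> J"
proof -
  obtain B where B: "\<And>b. b \<in> B \<Longrightarrow> homogeneous b" "J = ideal_gen B"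
    using assms(1) unfolding homogeneous_ideal_def by blast
  have J: "is_ideal J" using B ideal_gen_is_ideal by auto
  let ?M = "{f. \<forall>n. part (\<lambda>e. tdegS e = n) f \<in> J}"
  have "c * f \<in> ?M" if f: "f \<in> ?M" for c f
  proof -
    have "part (\<lambda>e. tdegS e = n) (Poly_Mapping.single e k * f) \<in> J" for n e k
      using f ideal_mult[OF J] ideal_zero[OF J] by (simp add: part_degree_single_mult)
    moreover have "c * f = (\<Sum>e\<in>keys c. Poly_Mapping.single e (lookup c e) * f)"
      by (simp add: sum_single_keys flip: sum_distrib_right)
    ultimately show ?thesis by (auto simp: part_sum intro!: ideal_sum[OF J])
  qed
  moreover have "0 \<in> ?M" using ideal_zero[OF J] by (simp add: part_def)
  ultimately have "is_ideal ?M"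
    unfolding is_ideal_iff using ideal_add[OF J] by (simp add: part_add)
  moreover have "B \<subseteq> ?M"
  proof
    fix b assume b: "b \<in> B"
    then obtain n where n: "\<forall>e\<in>keys b. tdegS e = n" using B(1) unfolding homogeneous_def by blast
    have "part (\<lambda>e. tdegS e = k) b = (if k = n then b else 0)" for k
      by (rule poly_mapping_eqI) (use n in \<open>auto simp: lookup_part in_keys_iff\<close>)
    then show "b \<in> ?M"
      using b B(2) ideal_gen_superset[of B] ideal_zero[OF J] by auto
  qed
  ultimately show ?thesis using ideal_gen_minimal assms(2) B(2) by blast
qed

section \<open>Multiplication by the variables\<close>

lemma sum_delta_mult:
  fixes f g :: "'i \<Rightarrow> 'a::comm_ring_1"
  assumes "finite I" "j \<in> I"
  shows "(\<Sum>i\<in>I. ((if i = j then p else 0) + g i) * f i) = p * f j + (\<Sum>i\<in>I. g i * f i)"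
proof -
  have "(\<Sum>i\<in>I. (if i = j then p else 0) * f i) = (\<Sum>i\<in>I. if i = j then p * f j else 0)"
    by (rule sum.cong) auto
  then show ?thesis using assms by (simp add: distrib_right sum.distrib)
qed

definition X :: "'k::field polyS" where "X = monS (1, 0, 0)"
definition Y :: "nat \<Rightarrow> 'k::field polyS" where "Y k = monS (0, k, 0)"

lemma keys_X_mult: "keys (X * f) = (\<lambda>(a, b, c). (Suc a, b, c)) ` keys f"
proof -
  have "(+) (1, 0, 0) = (\<lambda>(a, b, c). (Suc a, b :: nat, c :: nat))" by auto
  then show ?thesis by (simp add: X_def monS_def keys_single_mult)
qed

lemma keys_Y_mult: "keys (Y k * f) = (\<lambda>(a, b, c). (a, k + b, c)) ` keys f"
proof -
  have "(+) (0, k, 0) = (\<lambda>(a :: nat, b, c :: nat). (a, k + b, c))" by auto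
  then show ?thesis by (simp add: Y_def monS_def keys_single_mult)
qed

lemma in_keys_X_mult [simp]: "(a, b, c) \<in> keys (X * f) \<longleftrightarrow> a > 0 \<and> (a - 1, b, c) \<in> keys f"
  by (cases a) (auto simp: keys_X_mult image_iff split: prod.splits intro!: bexI[of _ "(a - 1, b, c)"])

lemma in_keys_Y_mult [simp]: "(a, b, c) \<in> keys (Y k * f) \<longleftrightarrow> k \<le> b \<and> (a, b - k, c) \<in> keys f"
  by (auto simp: keys_Y_mult image_iff intro!: bexI[of _ "(a, b - k, c)"])

lemma lookup_X_mult: "lookup (X * f) (a, b, c) = (if a > 0 then lookup f (a - 1, b, c) else 0)"
proof (cases a)
  case 0
  then have "(a, b, c) \<notin> keys (X * f)" by simp
  then have "lookup (X * f) (a, b, c) = 0" by (simp only: not_in_keys_iff_lookup_eq_zero)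
  then show ?thesis using 0 by simp
next
  case (Suc a')
  then show ?thesis
    using lookup_single_mult[of "(1, 0, 0)" 1 f "(a', b, c)"] by (simp add: X_def monS_def)
qed

lemma lookup_Y_mult: "lookup (Y k * f) (a, b, c) = (if k \<le> b then lookup f (a, b - k, c) else 0)"
proof (cases "k \<le> b")
  case False
  then have "(a, b, c) \<notin> keys (Y k * f)" by simp
  then have "lookup (Y k * f) (a, b, c) = 0" by (simp only: not_in_keys_iff_lookup_eq_zero)
  then show ?thesis using False by simp
next
  case True
  then show ?thesis
    using lookup_single_mult[of "(0, k, 0)" 1 f "(a, b - k, c)"] by (simp add: Y_def monS_def)
qed

text \<open>The forms of degree \<open>u\<close> in \<open>T = K[y,z]\<close>; the degree is an integer because the entries of the
  relation matrices can have negative degree, in which case they vanish.\<close>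

definition homT :: "int \<Rightarrow> 'k::field polyS \<Rightarrow> bool" where
  "homT u p \<longleftrightarrow> (\<forall>a b c. (a, b, c) \<in> keys p \<longrightarrow> a = 0 \<and> int b + int c = u)"

lemma homT_0 [simp]: "homT u 0"
  by (simp add: homT_def)

lemma homT_D: "homT u p \<Longrightarrow> (a, b, c) \<in> keys p \<Longrightarrow> a = 0 \<and> int b + int c = u"
  by (auto simp: homT_def)

lemma homT_add: "homT u p \<Longrightarrow> homT u q \<Longrightarrow> homT u (p + q)"
  unfolding homT_def by (metis keys_addE)

lemma homT_diff: "homT u p \<Longrightarrow> homT u q \<Longrightarrow> homT u (p - q)"
  unfolding homT_def by (metis keys_minusE)

section \<open>Bases adapted to a staircase\<close>

text \<open>The numerical data of a lex-segment ideal: its monomials are the \<open>x^a y^b\<close> with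
  \<open>m (t - a) \<le> b\<close>, where the truncated difference covers \<open>a \<ge> t\<close>. Strict growth of \<open>m\<close> is what the
  lex-segment property amounts to.\<close>

locale staircase =
  fixes t :: nat and m :: "nat \<Rightarrow> nat"
  assumes m_0 [simp]: "m 0 = 0"
    and m_less: "i < t \<Longrightarrow> m i < m (Suc i)"
begin

lemma m_diff_le:
  assumes "i \<le> j" "j \<le> t"
  shows "m i + (j - i) \<le> m j"
  using assms
proof (induction j rule: dec_induct)
  case (step n)
  then show ?case using m_less[of n] by auto
qed auto

definition d :: "nat \<Rightarrow> nat" where "d i = m (Suc i) - m i"

lemma m_plus_d: "i < t \<Longrightarrow> m i + d i = m (Suc i)"
  using m_less[of i] by (simp add: d_def)

text \<open>The total degree of the corner monomial \<open>x^(t-i) y^(m i)\<close>. It is weakly increasing in \<open>i\<close>.\<close>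

definition gdeg :: "nat \<Rightarrow> nat" where "gdeg i = t - i + m i"

abbreviation corner :: "nat \<Rightarrow> nat \<times> nat \<times> nat" where
  "corner i \<equiv> (t - i, m i, 0)"

definition stairs :: "(nat \<times> nat \<times> nat) set" where
  "stairs = {(a, b, c). m (t - a) \<le> b}"

text \<open>A form that can play the role of the \<open>i\<close>-th signed minor. Since the form is homogeneous, the
  conditions on the terms without \<open>z\<close> say that the monic leading term is the corner monomial. The
  bound on the \<open>x\<close>-degree makes the forms with \<open>i > 0\<close> a \<open>T\<close>-basis of the elements of
  \<open>x\<close>-degree below \<open>t\<close> in the ideal.\<close>

definition shaped :: "nat \<Rightarrow> 'k::field polyS \<Rightarrow> bool" where
  "shaped i p \<longleftrightarrow> (\<forall>e\<in>keys p. tdegS e = gdeg i) \<and> lookup p (corner i) = 1 \<and>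
     (\<forall>a b. (a, b, 0) \<in> keys p \<longrightarrow> m i \<le> b) \<and>
     (\<forall>a b c. (a, b, c) \<in> keys p \<longrightarrow> a < t \<or> i = 0)"

lemma
  assumes "shaped i p" "i \<le> t"
  shows shaped_nonzero: "p \<noteq> 0"
    and shaped_lead: "lead_exp p = corner i"
    and shaped_below: "(a, b, c) \<in> keys p \<Longrightarrow> (a, b, c) = corner i \<or> (a, b, c) \<prec> corner i"
    and shaped_x_le: "(a, b, 0) \<in> keys p \<Longrightarrow> a \<le> t - i"
    and shaped_x_le_t: "(a, b, c) \<in> keys p \<Longrightarrow> a \<le> t"
proof -
  have corner: "corner i \<in> keys p" using assms by (simp add: shaped_def in_keys_iff)
  then show "p \<noteq> 0" by auto
  have below: "(a, b, c) = corner i \<or> (a, b, c) \<prec> corner i" if k: "(a, b, c) \<in> keys p" for a b c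
  proof -
    have "a + b + c = t - i + m i" using assms k by (auto simp: shaped_def gdeg_def)
    moreover have "m i \<le> b" if "c = 0" using assms k that by (auto simp: shaped_def)
    ultimately show ?thesis by (auto simp: degrevlex_less.simps)
  qed
  then show "(a, b, c) \<in> keys p \<Longrightarrow> (a, b, c) = corner i \<or> (a, b, c) \<prec> corner i" .
  show "lead_exp p = corner i" by (rule lead_exp_eqI[OF corner]) (use below in auto)
  show "a \<le> t - i" if k: "(a, b, 0) \<in> keys p"
  proof -
    have "tdegS (a, b, 0) = gdeg i" "m i \<le> b" using assms(1) k unfolding shaped_def by blast+
    then show ?thesis by (simp add: gdeg_def)
  qed
  show "a \<le> t" if k: "(a, b, c) \<in> keys p"
  proof -
    have "tdegS (a, b, c) = gdeg i" "a < t \<or> i = 0" using assms(1) k unfolding shaped_def by blast+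
    then show ?thesis by (auto simp: gdeg_def)
  qed
qed

lemma shaped_degree: "shaped i p \<Longrightarrow> (a, b, c) \<in> keys p \<Longrightarrow> a + b + c = gdeg i"
  by (auto simp: shaped_def)

text \<open>The leading exponent of \<open>q i * f i\<close> has \<open>x\<close>-component \<open>t - i\<close> for \<open>i > 0\<close>, because \<open>q i\<close> does not
  involve \<open>x\<close>, and at least \<open>t\<close> for \<open>i = 0\<close>. So the leading exponents of the summands are distinct.\<close>

lemma module_lead:
  fixes f :: "nat \<Rightarrow> 'k::field polyS"
  assumes f: "\<And>i. i \<le> t \<Longrightarrow> shaped i (f i)"
    and q: "\<And>i a b c. 1 \<le> i \<Longrightarrow> i \<le> t \<Longrightarrow> (a, b, c) \<in> keys (q i) \<Longrightarrow> a = 0"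
    and ex: "\<exists>i\<le>t. q i \<noteq> 0"
  shows "(\<Sum>i\<le>t. q i * f i) \<noteq> 0" "lead_exp (\<Sum>i\<le>t. q i * f i) \<in> stairs"
proof -
  have lead: "lead_exp (q i * f i) = lead_exp (q i) + corner i" and nz: "q i * f i \<noteq> 0"
    if "i \<le> t" "q i \<noteq> 0" for i
    using that f[OF that(1)] by (simp_all add: lead_exp_mult shaped_nonzero shaped_lead polyS_mult_nonzero)
  have fst_lead: "if i = 0 then t \<le> fst (lead_exp (q i * f i)) else fst (lead_exp (q i * f i)) = t - i"
    if i: "i \<le> t" "q i \<noteq> 0" for i
  proof -
    obtain a b c where e: "lead_exp (q i) = (a, b, c)" by (cases "lead_exp (q i)")
    then have "(a, b, c) \<in> keys (q i)" using lead_exp_in_keys[OF i(2)] by simp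
    then have "i \<noteq> 0 \<Longrightarrow> a = 0" using q[of i] i by auto
    then show ?thesis using lead[OF i] e by auto
  qed
  have inj: "inj_on (\<lambda>i. lead_exp (q i * f i)) {i\<in>{..t}. q i * f i \<noteq> 0}"
  proof (rule inj_onI)
    fix i j assume ij: "i \<in> {i\<in>{..t}. q i * f i \<noteq> 0}" "j \<in> {i\<in>{..t}. q i * f i \<noteq> 0}"
      "lead_exp (q i * f i) = lead_exp (q j * f j)"
    then have nzq: "q i \<noteq> 0" "q j \<noteq> 0" "i \<le> t" "j \<le> t" by auto
    show "i = j" using fst_lead[of i] fst_lead[of j] nzq ij(3) by (auto split: if_splits)
  qed
  have "\<exists>i\<in>{..t}. q i * f i \<noteq> 0" using ex nz by blast
  from lead_exp_sum_distinct[OF _ this inj]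
  obtain k where k: "k \<le> t" "q k * f k \<noteq> 0" "(\<Sum>i\<le>t. q i * f i) \<noteq> 0"
      "lead_exp (\<Sum>i\<le>t. q i * f i) = lead_exp (q k * f k)"
    by auto
  show "(\<Sum>i\<le>t. q i * f i) \<noteq> 0" by fact
  have "q k \<noteq> 0" using k by auto
  obtain a b c where e: "lead_exp (q k) = (a, b, c)" by (cases "lead_exp (q k)")
  then have "lead_exp (q k * f k) = (a + (t - k), b + m k, c)"
    using lead[OF k(1) \<open>q k \<noteq> 0\<close>] by simp
  moreover have "m (t - (a + (t - k))) \<le> m k"
  proof -
    have "t - (a + (t - k)) \<le> k" by auto
    then show ?thesis using m_diff_le[of "t - (a + (t - k))" k] k(1) by auto
  qed
  ultimately show "lead_exp (\<Sum>i\<le>t. q i * f i) \<in> stairs"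
    using k(4) by (auto simp: stairs_def)
qed

lemma module_independent:
  fixes f :: "nat \<Rightarrow> 'k::field polyS"
  assumes "\<And>i. i \<le> t \<Longrightarrow> shaped i (f i)"
    and "\<And>i a b c. i \<le> t \<Longrightarrow> (a, b, c) \<in> keys (q i) \<Longrightarrow> a = 0"
    and "(\<Sum>i\<le>t. q i * f i) = 0" "i \<le> t"
  shows "q i = 0"
  using module_lead(1)[of f q] assms by blast

text \<open>Equivalently, the row vector \<open>f\<close> annihilates the columns of the Hilbert-Burch matrix of the
  monomial ideal perturbed by \<open>\<beta>\<close>. On a basis \<open>f\<close>, the relations describe multiplication by \<open>x\<close>.\<close>

definition rel :: "(nat \<Rightarrow> 'k::field polyS) \<Rightarrow> (nat \<Rightarrow> nat \<Rightarrow> 'k polyS) \<Rightarrow> bool" where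
  "rel f \<beta> \<longleftrightarrow> (\<forall>j<t. X * f (Suc j) = Y (d j) * f j + (\<Sum>i\<le>t. \<beta> i j * f i))"

text \<open>The degree of the entry \<open>(i, j)\<close> of a relation matrix, with indices counted from 0.\<close>

definition u :: "nat \<Rightarrow> nat \<Rightarrow> int" where
  "u i j = int (gdeg (Suc j)) + 1 - int (gdeg i)"

definition homTmat :: "(nat \<Rightarrow> nat \<Rightarrow> 'k::field polyS) \<Rightarrow> bool" where
  "homTmat \<beta> \<longleftrightarrow> (\<forall>i\<le>t. \<forall>j<t. homT (u i j) (\<beta> i j))"

text \<open>The relations rewrite \<open>x f (j+1)\<close> as a \<open>T\<close>-combination of the \<open>f i\<close>. Hence
  \<open>S f 0 + T f 1 + ... + T f t\<close> is closed under multiplication by \<open>x\<close> and is the whole ideal.\<close>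

lemma rel_module_ideal:
  fixes f :: "nat \<Rightarrow> 'k::field polyS"
  assumes rel: "rel f \<beta>" and \<beta>: "homTmat \<beta>"
    and g: "g \<in> ideal_gen (f ` {..t})"
  shows "\<exists>q. g = (\<Sum>i\<le>t. q i * f i) \<and> (\<forall>i a b c. 1 \<le> i \<longrightarrow> (a, b, c) \<in> keys (q i) \<longrightarrow> a = 0)"
proof -
  let ?T = "\<lambda>q. \<forall>i a b c. 1 \<le> i \<longrightarrow> (a, b, c) \<in> keys (q i) \<longrightarrow> a = 0"
  let ?M = "{\<Sum>i\<le>t. q i * f i | q. ?T q}"
  have M_add: "g + h \<in> ?M" if gh: "g \<in> ?M" "h \<in> ?M" for g h
  proof -
    obtain p q where pq: "g = (\<Sum>i\<le>t. p i * f i)" "h = (\<Sum>i\<le>t. q i * f i)" "?T p" "?T q"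
      using gh by blast
    have "?T (\<lambda>i. p i + q i)" using pq(3,4) by (metis keys_addE)
    moreover have "g + h = (\<Sum>i\<le>t. (p i + q i) * f i)"
      using pq by (simp add: algebra_simps sum.distrib)
    ultimately show ?thesis by (intro CollectI exI conjI)
  qed
  have M_0: "0 \<in> ?M" by (intro CollectI exI[of _ "\<lambda>_. 0"]) auto
  have M_T: "Poly_Mapping.single (0, b, c) k * g \<in> ?M" if g: "g \<in> ?M" for b c k g
  proof -
    obtain p where p: "g = (\<Sum>i\<le>t. p i * f i)" "?T p" using g by blast
    have "?T (\<lambda>i. Poly_Mapping.single (0, b, c) k * p i)"
      using p(2) by (fastforce elim!: keys_multE split: if_splits)
    moreover have "Poly_Mapping.single (0, b, c) k * g
        = (\<Sum>i\<le>t. (Poly_Mapping.single (0, b, c) k * p i) * f i)"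
      using p by (simp add: sum_distrib_left mult.assoc)
    ultimately show ?thesis by (intro CollectI exI conjI)
  qed
  have M_X: "X * g \<in> ?M" if g: "g \<in> ?M" for g
  proof -
    obtain p where p: "g = (\<Sum>i\<le>t. p i * f i)" "?T p" using g by blast
    define B where "B i j = (if i = j then Y (d j) else 0) + \<beta> i j" for i j
    have B: "X * f (Suc j) = (\<Sum>i\<le>t. B i j * f i)" if "j < t" for j
      using rel that unfolding B_def by (subst sum_delta_mult) (auto simp: rel_def)
    have BT: "a = 0" if "(a, b, c) \<in> keys (B i j)" "i \<le> t" "j < t" for i j a b c
    proof -
      have "homT (u i j) (\<beta> i j)" using \<beta> that(2,3) by (auto simp: homTmat_def)
      then show ?thesis
        using that(1) by (auto simp: B_def Y_def monS_def elim!: keys_addE dest: homT_D split: if_splits)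
    qed
    define q where "q i = (if i \<le> t then (if i = 0 then X * p 0 else 0) + (\<Sum>j<t. p (Suc j) * B i j) else 0)" for i
    have "?T q"
      using p(2) BT by (fastforce simp: q_def elim!: keys_sumE keys_multE split: if_splits)
    have "X * g = X * p 0 * f 0 + (\<Sum>j<t. p (Suc j) * (X * f (Suc j)))"
      using p(1) sum.atMost_shift[of "\<lambda>i. X * (p i * f i)" t]
      by (simp add: sum_distrib_left mult_ac)
    also have "(\<Sum>j<t. p (Suc j) * (X * f (Suc j))) = (\<Sum>j<t. \<Sum>i\<le>t. p (Suc j) * B i j * f i)"
      by (simp add: B sum_distrib_left mult_ac)
    also have "\<dots> = (\<Sum>i\<le>t. (\<Sum>j<t. p (Suc j) * B i j) * f i)"
      by (subst sum.swap) (simp add: sum_distrib_right)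
    also have "X * p 0 * f 0 + \<dots> = (\<Sum>i\<le>t. q i * f i)"
      unfolding q_def by (simp add: sum_delta_mult cong: if_cong)
    finally show ?thesis using \<open>?T q\<close> by (intro CollectI exI conjI)
  qed
  have M_mono: "Poly_Mapping.single (a, b, c) k * g \<in> ?M" if "g \<in> ?M" for a b c k g
    using that
  proof (induction a)
    case (Suc a)
    have "Poly_Mapping.single (Suc a, b, c) k = X * Poly_Mapping.single (a, b, c) k"
      by (simp add: X_def monS_def mult_single)
    then show ?case using M_X[OF Suc.IH[OF Suc.prems]] by (simp only: mult.assoc)
  qed (use M_T in auto)
  have M_mult: "h * g \<in> ?M" if g: "g \<in> ?M" for h g
  proof -
    have "finite S \<Longrightarrow> (\<Sum>e\<in>S. Poly_Mapping.single e (lookup h e) * g) \<in> ?M" for S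
    proof (induction S rule: finite_induct)
      case (insert e S)
      obtain a b c where "e = (a, b, c)" by (cases e)
      then show ?case using insert M_add[OF M_mono[OF g]] by auto
    qed (use M_0 in simp)
    then have "(\<Sum>e\<in>keys h. Poly_Mapping.single e (lookup h e) * g) \<in> ?M" by simp
    then show ?thesis by (simp add: sum_single_keys flip: sum_distrib_right)
  qed
  have "is_ideal ?M" unfolding is_ideal_iff using M_0 M_add M_mult by blast
  moreover have "f ` {..t} \<subseteq> ?M"
  proof
    fix h assume "h \<in> f ` {..t}"
    then obtain k where k: "k \<le> t" "h = f k" by auto
    have "h = (\<Sum>i\<le>t. (if i = k then 1 else 0) * f i)" 
      using k sum_delta_mult[of "{..t}" k 1 "\<lambda>_. 0" f] by simp
    moreover have "?T (\<lambda>i. if i = k then 1 else 0)" by (auto split: if_splits simp: zero_prod_def)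
    ultimately show "h \<in> ?M" by (intro CollectI exI conjI)
  qed
  ultimately have "ideal_gen (f ` {..t}) \<subseteq> ?M" by (rule ideal_gen_minimal[rotated])
  then show ?thesis using g by blast
qed

lemma lead_exps_of_rel:
  fixes f :: "nat \<Rightarrow> 'k::field polyS"
  assumes f: "\<And>i. i \<le> t \<Longrightarrow> shaped i (f i)" and rel: "rel f \<beta>" and \<beta>: "homTmat \<beta>"
  shows "lead_exps (ideal_gen (f ` {..t})) = stairs"
proof (intro equalityI subsetI)
  fix e assume "e \<in> lead_exps (ideal_gen (f ` {..t}))"
  then obtain g where g: "g \<in> ideal_gen (f ` {..t})" "g \<noteq> 0" "e = lead_exp g"
    by (auto simp: lead_exps_def)
  obtain q where q: "g = (\<Sum>i\<le>t. q i * f i)"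
      "\<forall>i a b c. 1 \<le> i \<longrightarrow> (a, b, c) \<in> keys (q i) \<longrightarrow> a = 0"
    using rel_module_ideal[OF rel \<beta> g(1)] by blast
  then have "\<exists>i\<le>t. q i \<noteq> 0" using g(2) by (auto intro!: sum.neutral)
  then show "e \<in> stairs" using module_lead(2)[of f q] f q g(3) by blast
next
  fix e assume "e \<in> stairs"
  then obtain a b c where e: "e = (a, b, c)" "m (t - a) \<le> b" by (auto simp: stairs_def)
  have "f (t - a) \<in> ideal_gen (f ` {..t})" using ideal_gen_superset[of "f ` {..t}"] by auto
  moreover have "shaped (t - a) (f (t - a))" using f by auto
  ultimately have "corner (t - a) \<in> lead_exps (ideal_gen (f ` {..t}))"
    unfolding lead_exps_def using shaped_nonzero[of "t - a" "f (t - a)"] shaped_lead[of "t - a" "f (t - a)"]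
    by (intro CollectI exI[of _ "f (t - a)"]) auto
  moreover have "e = corner (t - a) + (a - (t - (t - a)), b - m (t - a), c)" using e by auto
  ultimately show "e \<in> lead_exps (ideal_gen (f ` {..t}))"
    using lead_exps_add[OF ideal_gen_is_ideal] by metis
qed


section \<open>Expansion in an adapted basis\<close>

text \<open>Division with remainder zero: the leading exponent of an element of \<open>J\<close> of \<open>x\<close>-degree at most
  \<open>t\<close> lies over the corner of exactly one \<open>f i\<close> with the same \<open>x\<close>-exponent. The bound \<open>s\<close> keeps track
  of terms without \<open>z\<close>; it later gives the weight of the coefficients.\<close>

lemma basis_expansion:
  fixes f :: "nat \<Rightarrow> 'k::field polyS"
  assumes J: "is_ideal J" "lead_exps J \<subseteq> stairs"
    and f: "\<And>i. i \<le> t \<Longrightarrow> f i \<in> J \<and> shaped i (f i)"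
    and g: "g \<in> J" "\<And>a b c. (a, b, c) \<in> keys g \<Longrightarrow> a + b + c = n \<and> a \<le> t"
      "\<And>a b. (a, b, 0) \<in> keys g \<Longrightarrow> a < s"
  shows "\<exists>q. g = (\<Sum>i\<le>t. q i * f i) \<and>
    (\<forall>i\<le>t. homT (int n - int (gdeg i)) (q i) \<and> (\<forall>b. (0, b, 0) \<in> keys (q i) \<longrightarrow> t - i < s)) \<and>
    ((\<forall>a b c. (a, b, c) \<in> keys g \<longrightarrow> a < t) \<longrightarrow> q 0 = 0)"
  using g
proof (induction "degrevlex_rank (lead_exp g)" arbitrary: g rule: less_induct)
  case less
  show ?case
  proof (cases "g = 0")
    case True
    then show ?thesis by (intro exI[of _ "\<lambda>_. 0"]) auto
  next
    case False
    obtain a b c where e: "lead_exp g = (a, b, c)" by (cases "lead_exp g")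
    have key: "(a, b, c) \<in> keys g" using lead_exp_in_keys[OF False] e by simp
    have "lead_exp g \<in> lead_exps J" using less.prems(1) False by (auto simp: lead_exps_def)
    with J(2) e have mb: "m (t - a) \<le> b" by (auto simp: stairs_def)
    define i where "i = t - a"
    have "a \<le> t" "a + b + c = n" using less.prems(2)[OF key] by auto
    then have i: "i \<le> t" "a = t - i" "m i \<le> b" using mb by (auto simp: i_def)
    have fi: "f i \<in> J" "shaped i (f i)" using f i(1) by auto
    define k where "k = lookup g (a, b, c)"
    have k: "k \<noteq> 0" using key by (simp add: k_def in_keys_iff)
    \<comment> \<open>the multiple \<open>r * f i\<close> has the leading term of \<open>g\<close>, and \<open>r\<close> is free of \<open>x\<close>\<close>
    define r where "r = Poly_Mapping.single (0 :: nat, b - m i, c) k"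
    define h where "h = g - r * f i"
    have r_keys: "keys r = {(0, b - m i, c)}" using k by (simp add: r_def)
    have rf_keys: "\<exists>b' c'. (a', b', c') \<in> keys (f i) \<and> b1 = b - m i + b' \<and> c1 = c + c'"
      if rk: "(a', b1, c1) \<in> keys (r * f i)" for a' b1 c1
    proof -
      obtain e2 where "e2 \<in> keys (f i)" "(a', b1, c1) = (0, b - m i, c) + e2"
        using rk r_keys by (auto elim!: keys_multE)
      then show ?thesis by (cases e2) auto
    qed
    have corner: "(a, b, c) = (0, b - m i, c) + corner i" using i by simp
    have look: "lookup (r * f i) (a, b, c) = k"
      unfolding corner r_def lookup_single_mult using fi(2) by (simp add: shaped_def)
    have h_lead: "h = 0 \<or> lead_exp h \<prec> lead_exp g"
    proof (cases "h = 0")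
      case False
      have "(x, y, z) = (a, b, c) \<or> (x, y, z) \<prec> (a, b, c)" if xyz: "(x, y, z) \<in> keys (r * f i)" for x y z
      proof -
        obtain y' z' where *: "(x, y', z') \<in> keys (f i)" "y = b - m i + y'" "z = c + z'"
          using rf_keys[OF xyz] by blast
        have "(x, y', z') = corner i \<or> (x, y', z') \<prec> corner i"
          using shaped_below[OF fi(2) i(1) *(1)] .
        then have "(x, y', z') + (0, b - m i, c) = corner i + (0, b - m i, c)
            \<or> (x, y', z') + (0, b - m i, c) \<prec> corner i + (0, b - m i, c)"
          using degrevlex_add by blast
        then show ?thesis using * i by (simp add: add.commute)
      qed
      then show ?thesis
        unfolding h_def using lead_exp_subtract[OF \<open>g \<noteq> 0\<close>, of "r * f i"] False look
        by (simp add: e k_def h_def)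
    qed auto
    have hJ: "h \<in> J"
      unfolding h_def by (intro ideal_minus[OF J(1)] ideal_mult[OF J(1)] less.prems(1) fi)
    have deg_i: "b - m i + c + gdeg i = n"
      using i \<open>a + b + c = n\<close> by (simp add: gdeg_def)
    have h2: "a' + b' + c' = n \<and> a' \<le> t" if hk: "(a', b', c') \<in> keys h" for a' b' c'
      using hk unfolding h_def
    proof (rule keys_minusE)
      assume "(a', b', c') \<in> keys (r * f i)"
      then obtain b1 c1 where *: "(a', b1, c1) \<in> keys (f i)" "b' = b - m i + b1" "c' = c + c1"
        using rf_keys by blast
      have "a' + b1 + c1 = gdeg i" "a' \<le> t"
        using shaped_degree[OF fi(2) *(1)] shaped_x_le_t[OF fi(2) i(1) *(1)] by auto
      then show ?thesis using * deg_i by auto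
    qed (use less.prems(2) in auto)
    have c0: "a < s" if "c = 0" using less.prems(3) key that by auto
    have h3: "a' < s" if hk: "(a', b', 0) \<in> keys h" for a' b'
      using hk unfolding h_def
    proof (rule keys_minusE)
      assume "(a', b', 0) \<in> keys (r * f i)"
      then obtain b1 where *: "(a', b1, 0) \<in> keys (f i)" "c = 0"
        using rf_keys by fastforce
      then show ?thesis using shaped_x_le[OF fi(2) i(1) *(1)] i c0 by auto
    qed (use less.prems(3) in auto)
    have "\<exists>q. h = (\<Sum>i\<le>t. q i * f i) \<and>
      (\<forall>i\<le>t. homT (int n - int (gdeg i)) (q i) \<and> (\<forall>b. (0, b, 0) \<in> keys (q i) \<longrightarrow> t - i < s)) \<and>
      ((\<forall>a b c. (a, b, c) \<in> keys h \<longrightarrow> a < t) \<longrightarrow> q 0 = 0)"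
    proof (cases "h = 0")
      case True
      then show ?thesis by (intro exI[of _ "\<lambda>_. 0"]) auto
    next
      case False
      then have "degrevlex_rank (lead_exp h) < degrevlex_rank (lead_exp g)"
        using h_lead degrevlex_rank_mono by auto
      then show ?thesis by (rule less.hyps) (use hJ h2 h3 in blast)+
    qed
    then obtain q where q: "h = (\<Sum>i\<le>t. q i * f i)"
        "\<And>i. i \<le> t \<Longrightarrow> homT (int n - int (gdeg i)) (q i)"
        "\<And>i b. i \<le> t \<Longrightarrow> (0, b, 0) \<in> keys (q i) \<Longrightarrow> t - i < s"
        "(\<forall>a b c. (a, b, c) \<in> keys h \<longrightarrow> a < t) \<Longrightarrow> q 0 = 0"
      by blast
    define q' where "q' j = q j + (if j = i then r else 0)" for j
    have rT: "homT (int n - int (gdeg i)) r"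
      unfolding homT_def using r_keys deg_i by auto
    have "g = (\<Sum>j\<le>t. q' j * f j)"
    proof -
      have "g = h + r * f i" by (simp add: h_def)
      then show ?thesis
        using i(1) sum_delta_mult[of "{..t}" i r q f] by (simp add: q'_def q(1) add.commute)
    qed
    moreover have "homT (int n - int (gdeg j)) (q' j)" if "j \<le> t" for j
      unfolding q'_def using q(2)[OF that] rT by (auto intro!: homT_add)
    moreover have "t - j < s" if "j \<le> t" "(0, b', 0) \<in> keys (q' j)" for j b'
      using that(2) unfolding q'_def
      by (rule keys_addE) (use q(3) that(1) r_keys c0 i in \<open>auto split: if_splits\<close>)
    moreover have "q' 0 = 0" if lt: "\<forall>a b c. (a, b, c) \<in> keys g \<longrightarrow> a < t"
    proof -
      have "a < t" using lt key by blast
      then have "i \<noteq> 0" using i by auto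
      have "a' < t" if hk: "(a', b', c') \<in> keys h" for a' b' c'
        using hk unfolding h_def
      proof (rule keys_minusE)
        assume "(a', b', c') \<in> keys (r * f i)"
        then obtain b1 c1 where "(a', b1, c1) \<in> keys (f i)" using rf_keys by blast
        then show ?thesis using fi(2) \<open>i \<noteq> 0\<close> unfolding shaped_def by blast
      qed (use lt in auto)
      then show ?thesis using q(4) \<open>i \<noteq> 0\<close> by (auto simp: q'_def)
    qed
    ultimately show ?thesis by blast
  qed
qed

section \<open>Existence of adapted bases\<close>

text \<open>Division by \<open>f0\<close>, which is monic of degree \<open>t\<close> in \<open>x\<close>. The bound \<open>B\<close> ensures that a leading
  term above the divided part survives.\<close>

lemma reduce_x_degree:
  fixes f0 :: "'k::field polyS"
  assumes f0: "shaped 0 f0"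
    and h: "\<And>a b c. (a, b, c) \<in> keys h \<Longrightarrow> a + b + c = n \<and> (a, b, c) \<prec> B"
  shows "\<exists>p. \<forall>a b c. (a, b, c) \<in> keys (h - p * f0) \<longrightarrow> a + b + c = n \<and> (a, b, c) \<prec> B \<and> a < t"
  using h
proof (induction "degrevlex_rank (lead_exp h)" arbitrary: h rule: less_induct)
  case less
  show ?case
  proof (cases "h = 0")
    case True
    then show ?thesis by (intro exI[of _ 0]) auto
  next
    case False
    obtain a b c where e: "lead_exp h = (a, b, c)" by (cases "lead_exp h")
    have key: "(a, b, c) \<in> keys h" using lead_exp_in_keys[OF False] e by simp
    define k where "k = lookup h (a, b, c)"
    have k: "k \<noteq> 0" using key by (simp add: k_def in_keys_iff)
    have abc: "a + b + c = n" "(a, b, c) \<prec> B" using less.prems[OF key] by auto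
    have step: "\<exists>p. \<forall>a b c. (a, b, c) \<in> keys ((h - r) - p * f0) \<longrightarrow> a + b + c = n \<and> (a, b, c) \<prec> B \<and> a < t"
      if r: "\<And>x y z. (x, y, z) \<in> keys r \<Longrightarrow> x + y + z = n \<and> ((x, y, z) = (a, b, c) \<or> (x, y, z) \<prec> (a, b, c))"
        "lookup r (a, b, c) = k" for r
    proof (cases "h - r = 0")
      case True
      then show ?thesis by (intro exI[of _ 0]) auto
    next
      case False
      have "lead_exp (h - r) \<prec> lead_exp h"
        using r by (intro lead_exp_subtract[OF \<open>h \<noteq> 0\<close> _ _ False]) (auto simp: e k_def)
      then have "degrevlex_rank (lead_exp (h - r)) < degrevlex_rank (lead_exp h)"
        by (rule degrevlex_rank_mono)
      moreover have "x + y + z = n \<and> (x, y, z) \<prec> B" if "(x, y, z) \<in> keys (h - r)" for x y z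
        using that by (rule keys_minusE) (use less.prems r(1) abc degrevlex_trans in blast)+
      ultimately show ?thesis by (rule less.hyps)
    qed
    show ?thesis
    proof (cases "a < t")
      case True
      define r where "r = Poly_Mapping.single (a, b, c) k"
      have "\<exists>p. \<forall>a b c. (a, b, c) \<in> keys ((h - r) - p * f0) \<longrightarrow> a + b + c = n \<and> (a, b, c) \<prec> B \<and> a < t"
        using k abc by (intro step) (auto simp: r_def)
      then obtain p where p: "\<And>a b c. (a, b, c) \<in> keys ((h - r) - p * f0) \<Longrightarrow>
          a + b + c = n \<and> (a, b, c) \<prec> B \<and> a < t" by blast
      have "x + y + z = n \<and> (x, y, z) \<prec> B \<and> x < t" if xyz: "(x, y, z) \<in> keys (h - p * f0)" for x y z
      proof -
        have "h - p * f0 = (h - r - p * f0) + r" by simp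
        then have "(x, y, z) \<in> keys ((h - r - p * f0) + r)" using xyz by (simp only:)
        then show ?thesis
        proof (rule keys_addE)
          assume "(x, y, z) \<in> keys r"
          then show ?thesis using abc True by (auto simp: r_def split: if_splits)
        qed (rule p)
      qed
      then show ?thesis by blast
    next
      case False
      define r where "r = Poly_Mapping.single (a - t, b, c) k"
      have corner: "(a, b, c) = (a - t, b, c) + corner 0" using False by simp
      have rf: "x + y + z = n \<and> ((x, y, z) = (a, b, c) \<or> (x, y, z) \<prec> (a, b, c))"
        if xyz: "(x, y, z) \<in> keys (r * f0)" for x y z
      proof -
        obtain e2 where e2: "e2 \<in> keys f0" "(x, y, z) = (a - t, b, c) + e2"
          using xyz k by (auto simp: r_def elim!: keys_multE)
        obtain x' y' z' where e': "e2 = (x', y', z')" by (cases e2)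
        have "x' + y' + z' = t" using shaped_degree[OF f0] e2 e' by (auto simp: gdeg_def)
        moreover have "e2 = corner 0 \<or> e2 \<prec> corner 0" using shaped_below[OF f0] e2 e' by auto
        then have "(x, y, z) = (a, b, c) \<or> (x, y, z) \<prec> (a, b, c)"
          unfolding corner e2(2) using degrevlex_add by (metis add.commute)
        ultimately show ?thesis using e2 e' abc False by auto
      qed
      have look: "lookup (r * f0) (a, b, c) = k"
        unfolding corner r_def lookup_single_mult using f0 by (simp add: shaped_def)
      obtain p where p: "\<forall>a b c. (a, b, c) \<in> keys ((h - r * f0) - p * f0) \<longrightarrow>
          a + b + c = n \<and> (a, b, c) \<prec> B \<and> a < t"
        using step[OF rf look] by blast
      have "h - r * f0 - p * f0 = h - (r + p) * f0" by (simp add: algebra_simps)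
      then show ?thesis using p by metis
    qed
  qed
qed

lemma ex_shaped:
  assumes J: "homogeneous_ideal J" "lead_exps J = stairs"
  shows "\<exists>f. \<forall>i\<le>t. f i \<in> J \<and> shaped i (f i :: 'k::field polyS)"
proof -
  have ideal: "is_ideal J" by (rule homogeneous_ideal_is_ideal[OF J(1)])
  have pre: "\<exists>g\<in>J. lookup g (corner i) = 1 \<and>
      (\<forall>a b c. (a, b, c) \<in> keys g \<longrightarrow> a + b + c = gdeg i \<and> ((a, b, c) = corner i \<or> (a, b, c) \<prec> corner i))"
    if i: "i \<le> t" for i
  proof -
    have "corner i \<in> lead_exps J" using J(2) i by (auto simp: stairs_def)
    then obtain g where g: "g \<in> J" "g \<noteq> 0" "lead_exp g = corner i" by (auto simp: lead_exps_def)
    define k where "k = lookup g (corner i)"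
    have "k \<noteq> 0" using lead_exp_in_keys[OF g(2)] g(3) by (auto simp: k_def in_keys_iff)
    \<comment> \<open>the component of the degree of the leading exponent keeps that exponent\<close>
    define h where "h = Poly_Mapping.single 0 (inverse k) * part (\<lambda>e. tdegS e = gdeg i) g"
    have "h \<in> J" unfolding h_def by (intro ideal_mult[OF ideal] homogeneous_ideal_part[OF J(1)] g)
    moreover have "lookup h (corner i) = 1"
      using lookup_single_mult[of 0 "inverse k" "part (\<lambda>e. tdegS e = gdeg i) g" "corner i"] \<open>k \<noteq> 0\<close>
      by (simp add: h_def lookup_part gdeg_def k_def)
    moreover have "a + b + c = gdeg i \<and> ((a, b, c) = corner i \<or> (a, b, c) \<prec> corner i)"
      if "(a, b, c) \<in> keys h" for a b c
    proof -
      have "(a, b, c) \<in> keys (part (\<lambda>e. tdegS e = gdeg i) g)"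
        using that by (auto simp: h_def zero_prod_def elim!: keys_multE split: if_splits)
      then have "(a, b, c) \<in> keys g" "a + b + c = gdeg i" by (auto simp: keys_part)
      then show ?thesis using lead_exp_max[OF g(2)] g(3) by auto
    qed
    ultimately show ?thesis by blast
  qed
  have z_free: "m i \<le> b" if "i \<le> t" "a + b = gdeg i" "(a, b, 0) = corner i \<or> (a, b, 0) \<prec> corner i" for a b i
    using that by (auto simp: gdeg_def degrevlex_less.simps)
  obtain f0 where f0: "f0 \<in> J" "lookup f0 (corner 0) = 1"
      "\<And>a b c. (a, b, c) \<in> keys f0 \<Longrightarrow> a + b + c = gdeg 0"
    using pre[of 0] by blast
  then have sh0: "shaped 0 f0" by (auto simp: shaped_def)
  have "\<exists>f\<in>J. shaped i f" if i: "i \<le> t" for i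
  proof (cases "i = 0")
    case True
    then show ?thesis using f0 sh0 by auto
  next
    case False
    obtain g where g: "g \<in> J" "lookup g (corner i) = 1"
      "\<And>a b c. (a, b, c) \<in> keys g \<Longrightarrow> a + b + c = gdeg i \<and> ((a, b, c) = corner i \<or> (a, b, c) \<prec> corner i)"
      using pre[OF i] by blast
    define mono where "mono = Poly_Mapping.single (corner i) (1::'k)"
    have "\<exists>p. \<forall>a b c. (a, b, c) \<in> keys ((g - mono) - p * f0) \<longrightarrow>
        a + b + c = gdeg i \<and> (a, b, c) \<prec> corner i \<and> a < t"
    proof (rule reduce_x_degree[OF sh0])
      fix a b c assume k: "(a, b, c) \<in> keys (g - mono)"
      have "lookup (g - mono) (corner i) = 0" using g(2) by (simp add: mono_def lookup_minus)
      then have ne: "(a, b, c) \<noteq> corner i" using k by (metis in_keys_iff)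
      from k have "(a, b, c) \<in> keys g"
        by (rule keys_minusE) (use ne in \<open>auto simp: mono_def\<close>)
      then show "a + b + c = gdeg i \<and> (a, b, c) \<prec> corner i" using g(3) ne by blast
    qed
    then obtain p where p: "\<And>a b c. (a, b, c) \<in> keys ((g - mono) - p * f0) \<Longrightarrow>
        a + b + c = gdeg i \<and> (a, b, c) \<prec> corner i \<and> a < t" by blast
    define f where "f = g - p * f0"
    have f_split: "f = mono + (g - mono - p * f0)" by (simp add: f_def)
    have fJ: "f \<in> J" unfolding f_def by (intro ideal_minus[OF ideal] ideal_mult[OF ideal] g f0)
    have "corner i \<notin> keys (g - mono - p * f0)" using p[of "t - i" "m i" 0] by auto
    then have "lookup (g - mono - p * f0) (corner i) = 0" by (simp only: not_in_keys_iff_lookup_eq_zero)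
    then have "lookup f (corner i) = lookup mono (corner i)"
      by (simp only: f_split lookup_add add_0_right)
    then have "lookup f (corner i) = 1" by (simp add: mono_def)
    moreover have keys_f: "a + b + c = gdeg i \<and> ((a, b, c) = corner i \<or> (a, b, c) \<prec> corner i) \<and> a < t"
      if "(a, b, c) \<in> keys f" for a b c
      using that unfolding f_split
    proof (rule keys_addE)
      assume "(a, b, c) \<in> keys mono"
      then show ?thesis using False i by (auto simp: mono_def gdeg_def)
    qed (use p in blast)
    moreover have "m i \<le> b" if "(a, b, 0) \<in> keys f" for a b
      using z_free[OF i, of a b] keys_f[OF that] by auto
    ultimately have "shaped i f" by (auto simp: shaped_def)
    then show ?thesis using fJ by auto
  qed
  then show ?thesis by metis
qed


section \<open>The relation matrix determines the basis\<close>

lemma rel_D: "rel f \<beta> \<Longrightarrow> j < t \<Longrightarrow> X * f (Suc j) = Y (d j) * f j + (\<Sum>i\<le>t. \<beta> i j * f i)"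
  by (simp add: rel_def)

lemma shaped_x_less: "shaped i p \<Longrightarrow> (a, b, c) \<in> keys p \<Longrightarrow> a < t \<or> i = 0"
  unfolding shaped_def by blast

text \<open>Compare \<open>x\<close>-degrees: the left-hand sides \<open>x h (j+1)\<close> of the relations have larger \<open>x\<close>-degree than
  the right-hand sides if \<open>h (j+1)\<close> has the largest one.\<close>

lemma rel_vanishes:
  fixes h :: "nat \<Rightarrow> 'k::field polyS"
  assumes h0: "h 0 = 0" and rel: "rel h \<beta>" and \<beta>: "homTmat \<beta>" and "i \<le> t"
  shows "h i = 0"
proof (rule ccontr)
  assume ne: "h i \<noteq> 0"
  \<comment> \<open>the \<open>x\<close>-exponents that occur in the family\<close>
  let ?D = "\<Union>i\<le>t. fst ` keys (h i)"
  have fin: "finite ?D" by auto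
  have "keys (h i) \<noteq> {}" using ne by simp
  then have nonempty: "?D \<noteq> {}" using \<open>i \<le> t\<close> by blast
  \<comment> \<open>\<open>h k\<close> attains the largest \<open>x\<close>-exponent; \<open>k > 0\<close> because \<open>h 0 = 0\<close>\<close>
  from Max_in[OF fin nonempty] obtain k a b c where k: "k \<le> t" "(a, b, c) \<in> keys (h k)" "a = Max ?D"
    by auto
  have bound: "a' \<le> a" if "i \<le> t" "(a', b', c') \<in> keys (h i)" for i a' b' c'
    unfolding k(3) using that by (intro Max_ge[OF fin]) force
  obtain j where j: "k = Suc j" "j < t" using k h0 by (cases k) auto
  have "(Suc a, b, c) \<in> keys (X * h (Suc j))" using k j by simp
  then have "(Suc a, b, c) \<in> keys (Y (d j) * h j + (\<Sum>i\<le>t. \<beta> i j * h i))"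
    unfolding rel_D[OF rel j(2)] .
  then show False
  proof (rule keys_addE)
    assume "(Suc a, b, c) \<in> keys (Y (d j) * h j)"
    then show False using bound[of j "Suc a"] j by auto
  next
    assume "(Suc a, b, c) \<in> keys (\<Sum>i\<le>t. \<beta> i j * h i)"
    then obtain i where i: "i \<le> t" "(Suc a, b, c) \<in> keys (\<beta> i j * h i)" by (auto elim: keys_sumE)
    then obtain e1 e2 where e: "e1 \<in> keys (\<beta> i j)" "e2 \<in> keys (h i)" "(Suc a, b, c) = e1 + e2"
      by (elim keys_multE)
    have "fst e1 = 0" using \<beta> i(1) j(2) e(1) by (cases e1) (auto simp: homTmat_def dest: homT_D)
    then have "fst e2 = Suc a" using e(3) by (cases e1; cases e2) auto
    then show False using bound[OF i(1), of "Suc a"] e(2) by (cases e2) force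
  qed
qed

text \<open>Both families annihilate the same \<open>(t+1) \<times> t\<close> matrix of rank \<open>t\<close>, so they are proportional; this is
  the lemma above applied to \<open>f i * g 0 - f 0 * g i\<close>. If \<open>r = g 0 - f 0\<close> were nonzero, then
  \<open>r * f t = f 0 * (g t - f t)\<close> would give a leading exponent of \<open>r\<close> with \<open>x\<close>-component at least
  \<open>t\<close>, since \<open>f t\<close> has leading term \<open>y^(m t)\<close>. But the two monic forms of degree \<open>t\<close> differ by a
  form of smaller \<open>x\<close>-degree.\<close>

lemma rel_unique:
  fixes f g :: "nat \<Rightarrow> 'k::field polyS"
  assumes f: "\<And>i. i \<le> t \<Longrightarrow> shaped i (f i)" and g: "\<And>i. i \<le> t \<Longrightarrow> shaped i (g i)"
    and rel: "rel f \<beta>" "rel g \<beta>" and \<beta>: "homTmat \<beta>" and i: "i \<le> t"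
  shows "f i = g i"
proof -
  define h where "h i = f i * g 0 - f 0 * g i" for i
  have "rel h \<beta>"
    unfolding rel_def
  proof (intro allI impI)
    fix j assume j: "j < t"
    have "X * h (Suc j) = (X * f (Suc j)) * g 0 - f 0 * (X * g (Suc j))"
      by (simp add: h_def algebra_simps)
    also have "\<dots> = (Y (d j) * f j + (\<Sum>i\<le>t. \<beta> i j * f i)) * g 0
        - f 0 * (Y (d j) * g j + (\<Sum>i\<le>t. \<beta> i j * g i))"
      using rel j by (simp add: rel_def)
    also have "\<dots> = Y (d j) * h j + (\<Sum>i\<le>t. \<beta> i j * h i)"
      by (simp add: h_def algebra_simps sum_subtractf sum_distrib_left)
    finally show "X * h (Suc j) = Y (d j) * h j + (\<Sum>i\<le>t. \<beta> i j * h i)" .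
  qed
  then have cross: "f i * g 0 = f 0 * g i" if "i \<le> t" for i
    using rel_vanishes[of h \<beta> i] \<beta> that by (simp add: h_def)
  have f0: "shaped 0 (f 0)" "f 0 \<noteq> 0" "lead_exp (f 0) = (t, 0, 0)"
    and g0: "shaped 0 (g 0)"
    and ft: "shaped t (f t)" "f t \<noteq> 0" "lead_exp (f t) = (0, m t, 0)"
    using f[of 0] f[of t] g[of 0] shaped_nonzero[of 0 "f 0"] shaped_lead[of 0 "f 0"]
      shaped_nonzero[of t "f t"] shaped_lead[of t "f t"] by auto
  \<comment> \<open>it remains to see that the factor of proportionality is 1\<close>
  define r where "r = g 0 - f 0"
  have eq: "r * f t = f 0 * (g t - f t)"
    using cross[of t] by (simp add: r_def algebra_simps)
  have "r = 0"
  proof (rule ccontr)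
    assume r: "r \<noteq> 0"
    obtain a b c where abc: "lead_exp r = (a, b, c)" by (cases "lead_exp r")
    have key: "(a, b, c) \<in> keys r" using lead_exp_in_keys[OF r] abc by simp
    have "g t - f t \<noteq> 0" using eq r ft polyS_mult_nonzero[OF r ft(2)] by auto
    then have "lead_exp (r * f t) = (t, 0, 0) + lead_exp (g t - f t)"
      using eq f0 by (simp add: lead_exp_mult)
    then have "(a, b + m t, c) = (t, 0, 0) + lead_exp (g t - f t)"
      using r ft abc by (simp add: lead_exp_mult)
    then have "t \<le> a" by (cases "lead_exp (g t - f t)") auto
    moreover have "a + b + c = gdeg 0"
      using key unfolding r_def
      by (rule keys_minusE) (use f0(1) g0 shaped_degree in blast)+
    ultimately have "(a, b, c) = corner 0" by (simp add: gdeg_def)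
    moreover have "lookup r (corner 0) = 0" using f0(1) g0 by (simp add: r_def lookup_minus shaped_def)
    ultimately show False using key by (metis in_keys_iff)
  qed
  then have "f 0 * (f i - g i) = 0"
    using cross[OF i] by (simp add: r_def algebra_simps)
  then show ?thesis using polyS_mult_nonzero[of "f 0" "f i - g i"] f0(2) by auto
qed

section \<open>Change of basis\<close>

text \<open>The entry \<open>(i, j)\<close> has weight at least \<open>n\<close>, where \<open>z\<close> has weight \<open>t + 1\<close> and the position \<open>(i, j)\<close>
  contributes \<open>i - j\<close>. The weight measures the distance to the monomial ideal: with \<open>z\<close> heavier than
  all differences of positions, a term has positive weight precisely if it involves \<open>z\<close> or stands
  strictly below the diagonal. It is additive under matrix multiplication.\<close>

definition wt :: "nat \<Rightarrow> nat \<Rightarrow> nat \<Rightarrow> 'k::field polyS \<Rightarrow> bool" where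
  "wt n i j p \<longleftrightarrow> (\<forall>a b c. (a, b, c) \<in> keys p \<longrightarrow> n + j \<le> (t + 1) * c + i)"

lemma wt_0 [simp]: "wt n i j 0"
  by (simp add: wt_def)

lemma wt_add: "wt n i j p \<Longrightarrow> wt n i j q \<Longrightarrow> wt n i j (p + q)"
  unfolding wt_def by (metis keys_addE)

lemma wt_diff: "wt n i j p \<Longrightarrow> wt n i j q \<Longrightarrow> wt n i j (p - q)"
  unfolding wt_def by (metis keys_minusE)

lemma wt_uminus [simp]: "wt n i j (- p) \<longleftrightarrow> wt n i j p"
  by (simp add: wt_def)

lemma wt_sum: "(\<And>k. k \<in> I \<Longrightarrow> wt n i j (f k)) \<Longrightarrow> wt n i j (\<Sum>k\<in>I. f k)"
  unfolding wt_def by (metis keys_sumE)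

lemma wt_shift [simp]: "wt n (Suc i) (Suc j) p \<longleftrightarrow> wt n i j p"
  by (simp add: wt_def)

lemma wt_mono: "wt n i j p \<Longrightarrow> n' \<le> n \<Longrightarrow> wt n' i j p"
  unfolding wt_def by fastforce

lemma wt_Y: "wt n i j p \<Longrightarrow> wt n i j (Y k * p)"
  by (auto simp: wt_def)

lemma wt_mult:
  assumes "wt n1 i k p" "wt n2 k j q"
  shows "wt (n1 + n2) i j (p * q)"
  unfolding wt_def
proof (intro allI impI)
  fix a b c assume "(a, b, c) \<in> keys (p * q)"
  then obtain e1 e2 where e: "e1 \<in> keys p" "e2 \<in> keys q" "(a, b, c) = e1 + e2" by (rule keys_multE)
  obtain a1 b1 c1 a2 b2 c2 where "e1 = (a1, b1, c1)" "e2 = (a2, b2, c2)"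
    by (cases e1; cases e2)
  then have "n1 + k \<le> (t + 1) * c1 + i" "n2 + j \<le> (t + 1) * c2 + k" "c = c1 + c2"
    using assms e by (auto simp: wt_def)
  then show "n1 + n2 + j \<le> (t + 1) * c + i" by (simp add: algebra_simps)
qed

text \<open>The two summands have disjoint supports, which are distinguished by the \<open>y\<close>-exponent.\<close>

lemma wt_separate:
  assumes "wt n i j (p + Y k * q)" "\<And>a b c. (a, b, c) \<in> keys p \<Longrightarrow> b < k"
  shows "wt n i j p" "wt n i j q"
proof -
  have "(a, b, c) \<in> keys (p + Y k * q)" if "(a, b, c) \<in> keys p" for a b c
    using that assms(2)[OF that] by (simp add: in_keys_iff lookup_add lookup_Y_mult)
  then show "wt n i j p" using assms(1) unfolding wt_def by blast
  have "(a, b + k, c) \<in> keys (p + Y k * q)" if "(a, b, c) \<in> keys q" for a b c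
  proof -
    have "(a, b + k, c) \<notin> keys p" using assms(2)[of a "b + k" c] by auto
    then have "lookup p (a, b + k, c) = 0" by (simp only: not_in_keys_iff_lookup_eq_zero)
    then show ?thesis using that by (simp add: in_keys_iff lookup_add lookup_Y_mult)
  qed
  then show "wt n i j q" using assms(1) unfolding wt_def by blast
qed

text \<open>Large weight forces a power of \<open>z\<close> beyond the degree of the form.\<close>

lemma wt_large_zero:
  assumes "homT v p" "wt n i j p" "(t + 1) * nat v + i < n"
  shows "p = 0"
proof (rule ccontr)
  assume "p \<noteq> 0"
  then obtain e where "e \<in> keys p" by (metis all_not_in_conv keys_eq_empty)
  moreover obtain a b c where "e = (a, b, c)" by (cases e)
  ultimately have key: "(a, b, c) \<in> keys p" by simp
  then have "int c \<le> v" using homT_D[OF assms(1) key] by auto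
  then have "c \<le> nat v" by linarith
  then have "(t + 1) * c \<le> (t + 1) * nat v" by (rule mult_le_mono2)
  moreover have "n + j \<le> (t + 1) * c + i" using assms(2) key by (auto simp: wt_def)
  ultimately show False using assms(3) by linarith
qed

lemma gdeg_Suc: "i < t \<Longrightarrow> gdeg (Suc i) + 1 = gdeg i + d i"
  using m_plus_d[of i] by (simp add: gdeg_def)

lemma u_alt: "i \<le> t \<Longrightarrow> j < t \<Longrightarrow> u i j = int i - int j + int (m (Suc j)) - int (m i)"
  by (simp add: u_def gdeg_def)

text \<open>The degree bounds in the definition of the parameter space, for homogenized entries: on and above
  the diagonal \<open>d i\<close> is the smaller of the two numbers \<open>d i\<close> and \<open>u i j\<close>, and below the diagonal the
  bound by \<open>u i j\<close> holds for any form of degree \<open>u i j\<close>.\<close>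

definition ynormal :: "nat \<Rightarrow> nat \<Rightarrow> 'k::field polyS \<Rightarrow> bool" where
  "ynormal i j p \<longleftrightarrow> (\<forall>a b c. (a, b, c) \<in> keys p \<longrightarrow> b < d (min i j))"

lemma ynormal_add: "ynormal i j p \<Longrightarrow> ynormal i j q \<Longrightarrow> ynormal i j (p + q)"
  unfolding ynormal_def by (metis keys_addE)

lemma ynormal_diff: "ynormal i j p \<Longrightarrow> ynormal i j q \<Longrightarrow> ynormal i j (p - q)"
  unfolding ynormal_def by (metis keys_minusE)

text \<open>On and above the diagonal \<open>d i \<le> u i j\<close>, by strict growth of \<open>m\<close>. A form of degree \<open>u i j\<close>
  whose \<open>y\<close>-degree is below \<open>d i\<close> is therefore divisible by \<open>z\<close>.\<close>

lemma ynormal_wt: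
  assumes "homT (u i j) p" "ynormal i j p" "i \<le> t" "j < t"
  shows "wt 1 i j p"
  unfolding wt_def
proof (intro allI impI)
  fix a b c assume key: "(a, b, c) \<in> keys p"
  have b: "b < d (min i j)" "int b + int c = u i j"
    using assms(2) key homT_D[OF assms(1) key] by (auto simp: ynormal_def)
  show "1 + j \<le> (t + 1) * c + i"
  proof (cases "i \<le> j")
    case True
    have "m (Suc i) + (j - i) \<le> m (Suc j)" using m_diff_le[of "Suc i" "Suc j"] True assms(4) by auto
    then have "int (d i) \<le> u i j"
      using True assms m_plus_d[of i] by (simp add: u_alt)
    then have "1 \<le> c" using b True by (simp add: min_def)
    then have "(t + 1) * 1 \<le> (t + 1) * c" by (rule mult_le_mono2)
    then have "t + 1 \<le> (t + 1) * c" by (simp only: mult_1_right)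
    then show ?thesis using assms(4) by linarith
  qed auto
qed

text \<open>With \<open>P = 1 + \<nu>\<close> the base change reads \<open>B P' = P B'\<close>, where \<open>P'\<close> is \<open>P\<close> without its row and
  column 0. The left-hand side below collects the part linear in \<open>\<nu>\<close>, \<open>\<beta>\<close> and \<open>\<beta>'\<close>, the right-hand side
  the products, which have larger weight. The proof writes the difference of the two relations
  in the basis \<open>f\<close> and compares coefficients.\<close>

lemma change_basis:
  fixes f f' :: "nat \<Rightarrow> 'k::field polyS"
  assumes f: "\<And>i. i \<le> t \<Longrightarrow> shaped i (f i)"
    and rel: "rel f \<beta>" "rel f' \<beta>'" and \<beta>: "homTmat \<beta>" "homTmat \<beta>'"
    and \<nu>: "\<And>j. j \<le> t \<Longrightarrow> f' j = f j + (\<Sum>i\<le>t. \<nu> i j * f i)" "\<And>j. j \<le> t \<Longrightarrow> \<nu> 0 j = 0"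
      "\<And>i j. i \<le> t \<Longrightarrow> j \<le> t \<Longrightarrow> homT (int (gdeg j) - int (gdeg i)) (\<nu> i j)"
    and ij: "i \<le> t" "j < t"
  shows "(if i < t then Y (d i) * \<nu> (Suc i) (Suc j) else 0) - Y (d j) * \<nu> i j + (\<beta> i j - \<beta>' i j)
    = (\<Sum>k\<le>t. \<nu> i k * \<beta>' k j) - (\<Sum>k<t. \<beta> i k * \<nu> (Suc k) (Suc j))"
proof -
  define q1 where "q1 i = (if i < t then Y (d i) * \<nu> (Suc i) (Suc j) else 0)" for i
  define q where "q i = q1 i - Y (d j) * \<nu> i j + (\<beta> i j - \<beta>' i j)
      + (\<Sum>k<t. \<beta> i k * \<nu> (Suc k) (Suc j)) - (\<Sum>k\<le>t. \<nu> i k * \<beta>' k j)" for i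
  have relf: "X * f (Suc k) = Y (d k) * f k + (\<Sum>i\<le>t. \<beta> i k * f i)"
    "X * f' (Suc k) = Y (d k) * f' k + (\<Sum>i\<le>t. \<beta>' i k * f' i)" if "k < t" for k
    using rel that by (auto simp: rel_def)
  have S1: "(\<Sum>i\<le>t. q1 i * f i) = (\<Sum>k<t. \<nu> (Suc k) (Suc j) * (Y (d k) * f k))"
  proof -
    have "(\<Sum>i\<le>t. q1 i * f i) = (\<Sum>i<t. q1 i * f i)"
      by (simp add: q1_def sum.lessThan_Suc flip: lessThan_Suc_atMost)
    also have "\<dots> = (\<Sum>k<t. \<nu> (Suc k) (Suc j) * (Y (d k) * f k))"
      by (rule sum.cong) (auto simp: q1_def mult_ac)
    finally show ?thesis .
  qed
  have S2: "(\<Sum>i\<le>t. Y (d j) * \<nu> i j * f i) = Y (d j) * (f' j - f j)"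
    using \<nu>(1)[of j] ij by (simp add: sum_distrib_left mult_ac)
  have S4: "(\<Sum>i\<le>t. (\<Sum>k<t. \<beta> i k * \<nu> (Suc k) (Suc j)) * f i)
      = (\<Sum>k<t. \<nu> (Suc k) (Suc j) * (X * f (Suc k) - Y (d k) * f k))"
  proof -
    have "(\<Sum>i\<le>t. (\<Sum>k<t. \<beta> i k * \<nu> (Suc k) (Suc j)) * f i)
        = (\<Sum>i\<le>t. \<Sum>k<t. \<beta> i k * \<nu> (Suc k) (Suc j) * f i)"
      by (simp add: sum_distrib_right)
    also have "\<dots> = (\<Sum>k<t. \<Sum>i\<le>t. \<beta> i k * \<nu> (Suc k) (Suc j) * f i)" by (rule sum.swap)
    also have "\<dots> = (\<Sum>k<t. \<nu> (Suc k) (Suc j) * (\<Sum>i\<le>t. \<beta> i k * f i))"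
      by (simp add: sum_distrib_left mult_ac)
    finally show ?thesis using relf(1) by simp
  qed
  have S5: "(\<Sum>i\<le>t. (\<Sum>k\<le>t. \<nu> i k * \<beta>' k j) * f i) = (\<Sum>k\<le>t. \<beta>' k j * (f' k - f k))"
  proof -
    have "(\<Sum>i\<le>t. (\<Sum>k\<le>t. \<nu> i k * \<beta>' k j) * f i) = (\<Sum>i\<le>t. \<Sum>k\<le>t. \<nu> i k * \<beta>' k j * f i)"
      by (simp add: sum_distrib_right)
    also have "\<dots> = (\<Sum>k\<le>t. \<Sum>i\<le>t. \<nu> i k * \<beta>' k j * f i)" by (rule sum.swap)
    also have "\<dots> = (\<Sum>k\<le>t. \<beta>' k j * (\<Sum>i\<le>t. \<nu> i k * f i))"
      by (simp add: sum_distrib_left mult_ac)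
    finally show ?thesis using \<nu>(1) by simp
  qed
  have S14: "(\<Sum>k<t. \<nu> (Suc k) (Suc j) * (X * f (Suc k))) = X * (f' (Suc j) - f (Suc j))"
  proof -
    have "f' (Suc j) - f (Suc j) = (\<Sum>k<t. \<nu> (Suc k) (Suc j) * f (Suc k))"
      using \<nu>(1)[of "Suc j"] \<nu>(2)[of "Suc j"] ij by (simp add: sum.atMost_shift)
    then show ?thesis by (simp add: sum_distrib_left mult_ac)
  qed
  have "(\<Sum>i\<le>t. q i * f i) = (\<Sum>i\<le>t. q1 i * f i) - (\<Sum>i\<le>t. Y (d j) * \<nu> i j * f i)
      + ((\<Sum>i\<le>t. \<beta> i j * f i) - (\<Sum>i\<le>t. \<beta>' i j * f i))
      + (\<Sum>i\<le>t. (\<Sum>k<t. \<beta> i k * \<nu> (Suc k) (Suc j)) * f i)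
      - (\<Sum>i\<le>t. (\<Sum>k\<le>t. \<nu> i k * \<beta>' k j) * f i)"
    by (simp add: q_def distrib_right left_diff_distrib sum.distrib sum_subtractf)
  also have "\<dots> = (\<Sum>k<t. \<nu> (Suc k) (Suc j) * (X * f (Suc k)))
      - Y (d j) * (f' j - f j) + ((\<Sum>i\<le>t. \<beta> i j * f i) - (\<Sum>i\<le>t. \<beta>' i j * f i))
      - (\<Sum>k\<le>t. \<beta>' k j * (f' k - f k))"
    unfolding S1 S2 S4 S5 by (simp add: right_diff_distrib sum_subtractf)
  also have "\<dots> = X * f' (Suc j) - X * f (Suc j)
      - Y (d j) * (f' j - f j) + ((\<Sum>i\<le>t. \<beta> i j * f i) - (\<Sum>i\<le>t. \<beta>' i j * f i))
      - (\<Sum>k\<le>t. \<beta>' k j * (f' k - f k))"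
    unfolding S14 by (simp add: right_diff_distrib)
  also have "\<dots> = 0"
    unfolding relf(1)[OF ij(2)] relf(2)[OF ij(2)]
    by (simp add: right_diff_distrib sum_subtractf)
  finally have zero: "(\<Sum>i\<le>t. q i * f i) = 0" .
  have q_T: "a = 0" if "i \<le> t" "(a, b, c) \<in> keys (q i)" for i a b c
  proof -
    have T\<beta>: "\<And>a b c. (a, b, c) \<in> keys (\<beta> i k) \<Longrightarrow> a = 0" "\<And>a b c. (a, b, c) \<in> keys (\<beta>' i k) \<Longrightarrow> a = 0"
      if "i \<le> t" "k < t" for i k
      using \<beta> that unfolding homTmat_def by (blast dest: homT_D)+
    have T\<nu>: "\<And>a b c. (a, b, c) \<in> keys (\<nu> i k) \<Longrightarrow> a = 0" if "i \<le> t" "k \<le> t" for i k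
      using \<nu>(3)[OF that] by (blast dest: homT_D)
    have T_mult: "a = 0" if "(a, b, c) \<in> keys (p * r)"
      "\<And>a b c. (a, b, c) \<in> keys p \<Longrightarrow> a = 0" "\<And>a b c. (a, b, c) \<in> keys r \<Longrightarrow> a = 0"
      for a b c and p r :: "'k polyS"
      using that by (auto elim!: keys_multE)
    show ?thesis
      using that(2) unfolding q_def q1_def
    proof (elim keys_addE keys_minusE keys_sumE)
      assume "(a, b, c) \<in> keys (if i < t then Y (d i) * \<nu> (Suc i) (Suc j) else 0)"
      then show ?thesis using T\<nu>[of "Suc i" "Suc j"] ij by (auto split: if_splits)
    next
      fix k assume "k \<in> {..<t}" "(a, b, c) \<in> keys (\<beta> i k * \<nu> (Suc k) (Suc j))"
      then show ?thesis
        using T_mult[of a b c "\<beta> i k" "\<nu> (Suc k) (Suc j)"] T\<beta>(1)[OF \<open>i \<le> t\<close>, of k]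
          T\<nu>[of "Suc k" "Suc j"] ij by auto
    next
      fix k assume "k \<in> {..t}" "(a, b, c) \<in> keys (\<nu> i k * \<beta>' k j)"
      then show ?thesis
        using T_mult[of a b c "\<nu> i k" "\<beta>' k j"] T\<beta>(2)[of k j] T\<nu>[OF \<open>i \<le> t\<close>, of k] ij by auto
    qed (use T\<beta>[OF \<open>i \<le> t\<close> ij(2)] T\<nu>[OF \<open>i \<le> t\<close>, of j] ij in auto)
  qed
  have "q i = 0" by (rule module_independent[OF _ _ zero ij(1)]) (use f q_T in blast)+
  then show ?thesis by (simp add: q_def q1_def algebra_simps)
qed

text \<open>The difference \<open>f' j - f j\<close> is a form in the ideal with leading term below the corner and
  \<open>x\<close>-degree below \<open>t\<close>. Expanding it in the basis \<open>f\<close> gives column \<open>j\<close>.\<close>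

lemma ex_transition:
  fixes f f' :: "nat \<Rightarrow> 'k::field polyS"
  assumes J: "is_ideal J" "lead_exps J \<subseteq> stairs"
    and f: "\<And>i. i \<le> t \<Longrightarrow> f i \<in> J \<and> shaped i (f i)"
    and f': "\<And>i. i \<le> t \<Longrightarrow> f' i \<in> J \<and> shaped i (f' i)"
  obtains \<nu> where "\<And>j. j \<le> t \<Longrightarrow> f' j = f j + (\<Sum>i\<le>t. \<nu> i j * f i)"
    "\<And>j. j \<le> t \<Longrightarrow> \<nu> 0 j = 0"
    "\<And>i j. i \<le> t \<Longrightarrow> j \<le> t \<Longrightarrow> homT (int (gdeg j) - int (gdeg i)) (\<nu> i j)"
    "\<And>i j. i \<le> t \<Longrightarrow> j \<le> t \<Longrightarrow> wt 1 i j (\<nu> i j)"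
proof -
  have "\<exists>q. f' j - f j = (\<Sum>i\<le>t. q i * f i) \<and>
      (\<forall>i\<le>t. homT (int (gdeg j) - int (gdeg i)) (q i) \<and> (\<forall>b. (0, b, 0) \<in> keys (q i) \<longrightarrow> t - i < t - j)) \<and>
      q 0 = 0" if j: "j \<le> t" for j
  proof -
    have sh: "shaped j (f j)" "shaped j (f' j)" using f f' j by auto
    have zero: "lookup (f' j - f j) (corner j) = 0" using sh by (simp add: shaped_def lookup_minus)
    have key: "a + b + c = gdeg j \<and> a \<le> t \<and> a < t" if "(a, b, c) \<in> keys (f' j - f j)" for a b c
    proof -
      have deg: "a + b + c = gdeg j \<and> a \<le> t \<and> (a < t \<or> j = 0)"
        using that by (rule keys_minusE)
          (use sh j shaped_degree shaped_x_le_t shaped_x_less in blast)+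
      have "a \<noteq> t"
      proof
        assume "a = t"
        then have "(a, b, c) = corner j" using deg by (auto simp: gdeg_def)
        then show False using zero that by (metis in_keys_iff)
      qed
      then show ?thesis using deg by auto
    qed
    have zfree: "a < t - j" if "(a, b, 0) \<in> keys (f' j - f j)" for a b
    proof -
      have "a \<le> t - j"
        using that by (rule keys_minusE) (use sh j shaped_x_le in blast)+
      moreover have "a \<noteq> t - j"
      proof
        assume "a = t - j"
        then have "(a, b, 0) = corner j" using key[OF that] by (auto simp: gdeg_def)
        then show False using zero that by (metis in_keys_iff)
      qed
      ultimately show ?thesis by simp
    qed
    have "f' j - f j \<in> J" using f f' j ideal_minus[OF J(1)] by auto
    from basis_expansion[OF J f this, of "gdeg j" "t - j"] show ?thesis
      using key zfree by blast
  qed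
  then have "\<forall>j\<in>{..t}. \<exists>q. f' j - f j = (\<Sum>i\<le>t. q i * f i) \<and>
      (\<forall>i\<le>t. homT (int (gdeg j) - int (gdeg i)) (q i) \<and> (\<forall>b. (0, b, 0) \<in> keys (q i) \<longrightarrow> t - i < t - j)) \<and>
      q 0 = 0" by blast
  from bchoice[OF this] obtain q where q: "\<And>j. j \<le> t \<Longrightarrow> f' j - f j = (\<Sum>i\<le>t. q j i * f i)"
      "\<And>i j. j \<le> t \<Longrightarrow> i \<le> t \<Longrightarrow> homT (int (gdeg j) - int (gdeg i)) (q j i)"
      "\<And>i j b. j \<le> t \<Longrightarrow> i \<le> t \<Longrightarrow> (0, b, 0) \<in> keys (q j i) \<Longrightarrow> t - i < t - j"
      "\<And>j. j \<le> t \<Longrightarrow> q j 0 = 0"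
    by blast
  show thesis
  proof (rule that[of "\<lambda>i j. q j i"])
    show "f' j = f j + (\<Sum>i\<le>t. q j i * f i)" if "j \<le> t" for j
      using q(1)[OF that] by (simp add: diff_eq_eq add.commute)
    fix i j assume ij: "i \<le> t" "j \<le> t"
    show "wt 1 i j (q j i)"
      unfolding wt_def
    proof (intro allI impI)
      fix a b c assume key: "(a, b, c) \<in> keys (q j i)"
      show "1 + j \<le> (t + 1) * c + i"
      proof (cases c)
        case 0
        then have "(0, b, 0) \<in> keys (q j i)" using key homT_D[OF q(2)[OF ij(2,1)] key] by auto
        then show ?thesis using q(3)[OF ij(2,1)] ij by fastforce
      qed (use ij in auto)
    qed
  qed (use q(2,4) in blast)+
qed

text \<open>The form \<open>x f (j+1) - y^(d j) f j\<close> lies in the ideal and its leading terms cancel. Expanding it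
  gives column \<open>j\<close> of the relation matrix.\<close>

lemma ex_rel:
  fixes f :: "nat \<Rightarrow> 'k::field polyS"
  assumes J: "is_ideal J" "lead_exps J \<subseteq> stairs"
    and f: "\<And>i. i \<le> t \<Longrightarrow> f i \<in> J \<and> shaped i (f i)"
  obtains \<beta> where "rel f \<beta>" "homTmat \<beta>" "\<And>i j. i \<le> t \<Longrightarrow> j < t \<Longrightarrow> wt 1 i j (\<beta> i j)"
proof -
  have "\<exists>q. X * f (Suc j) - Y (d j) * f j = (\<Sum>i\<le>t. q i * f i) \<and>
      (\<forall>i\<le>t. homT (u i j) (q i) \<and> (\<forall>b. (0, b, 0) \<in> keys (q i) \<longrightarrow> t - i < t - j))"
    if j: "j < t" for j
  proof -
    let ?g = "X * f (Suc j) - Y (d j) * f j"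
    have sh: "shaped j (f j)" "shaped (Suc j) (f (Suc j))" using f j by auto
    have zero: "lookup ?g (t - j, m (Suc j), 0) = 0"
    proof -
      have "m (Suc j) - d j = m j" "d j \<le> m (Suc j)" "t - j - 1 = t - Suc j" "0 < t - j"
        using m_plus_d[OF j] j by auto
      then show ?thesis using sh by (simp add: lookup_minus lookup_X_mult lookup_Y_mult shaped_def)
    qed
    have key: "a + b + c = gdeg (Suc j) + 1 \<and> a \<le> t" if "(a, b, c) \<in> keys ?g" for a b c
      using that
    proof (rule keys_minusE)
      assume "(a, b, c) \<in> keys (X * f (Suc j))"
      then have k: "a > 0" "(a - 1, b, c) \<in> keys (f (Suc j))" by auto
      then have "a - 1 + b + c = gdeg (Suc j)" "a - 1 < t"
        using shaped_degree[OF sh(2)] sh(2) unfolding shaped_def by blast+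
      then show ?thesis using k by auto
    next
      assume "(a, b, c) \<in> keys (Y (d j) * f j)"
      then have k: "d j \<le> b" "(a, b - d j, c) \<in> keys (f j)" by auto
      then have "a + (b - d j) + c = gdeg j" "a \<le> t"
        using shaped_degree[OF sh(1)] shaped_x_le_t[OF sh(1), of a "b - d j" c] j by (blast, auto)
      then show ?thesis using k gdeg_Suc[OF j] by auto
    qed
    have zfree: "a < t - j" if "(a, b, 0) \<in> keys ?g" for a b
    proof -
      have "a \<le> t - j"
        using that
      proof (rule keys_minusE)
        assume "(a, b, 0) \<in> keys (X * f (Suc j))"
        then show ?thesis using shaped_x_le[OF sh(2), of "a - 1" b] j by auto
      next
        assume "(a, b, 0) \<in> keys (Y (d j) * f j)"
        then show ?thesis using shaped_x_le[OF sh(1), of a "b - d j"] j by auto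
      qed
      moreover have "a \<noteq> t - j"
      proof
        assume "a = t - j"
        then have "(a, b, 0) = (t - j, m (Suc j), 0)" using key[OF that] j by (auto simp: gdeg_def)
        then show False using zero that by (metis in_keys_iff)
      qed
      ultimately show ?thesis by simp
    qed
    have "?g \<in> J" using f j by (intro ideal_minus[OF J(1)] ideal_mult[OF J(1)]) auto
    from basis_expansion[OF J f this, of "gdeg (Suc j) + 1" "t - j"] key zfree
    have "\<exists>q. ?g = (\<Sum>i\<le>t. q i * f i) \<and>
        (\<forall>i\<le>t. homT (int (gdeg (Suc j) + 1) - int (gdeg i)) (q i) \<and>
           (\<forall>b. (0, b, 0) \<in> keys (q i) \<longrightarrow> t - i < t - j))"
      by blast
    then show ?thesis by (simp add: u_def add.commute)
  qed
  then have "\<forall>j\<in>{..<t}. \<exists>q. X * f (Suc j) - Y (d j) * f j = (\<Sum>i\<le>t. q i * f i) \<and>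
      (\<forall>i\<le>t. homT (u i j) (q i) \<and> (\<forall>b. (0, b, 0) \<in> keys (q i) \<longrightarrow> t - i < t - j))" by blast
  from bchoice[OF this] obtain q where q: "\<And>j. j < t \<Longrightarrow> X * f (Suc j) - Y (d j) * f j = (\<Sum>i\<le>t. q j i * f i)"
      "\<And>i j. j < t \<Longrightarrow> i \<le> t \<Longrightarrow> homT (u i j) (q j i)"
      "\<And>i j b. j < t \<Longrightarrow> i \<le> t \<Longrightarrow> (0, b, 0) \<in> keys (q j i) \<Longrightarrow> t - i < t - j"
    by blast
  show thesis
  proof
    show "rel f (\<lambda>i j. q j i)" unfolding rel_def using q(1) by (simp add: diff_eq_eq add.commute)
    show "homTmat (\<lambda>i j. q j i)" unfolding homTmat_def using q(2) by auto
    fix i j assume ij: "i \<le> t" "j < t"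
    show "wt 1 i j (q j i)"
      unfolding wt_def
    proof (intro allI impI)
      fix a b c assume key: "(a, b, c) \<in> keys (q j i)"
      show "1 + j \<le> (t + 1) * c + i"
      proof (cases c)
        case 0
        then have "(0, b, 0) \<in> keys (q j i)" using key homT_D[OF q(2)[OF ij(2,1)] key] by auto
        then show ?thesis using q(3)[OF ij(2,1)] ij by fastforce
      qed (use ij in auto)
    qed
  qed
qed


section \<open>Uniqueness of the normal relation matrix\<close>

text \<open>The linearized equation couples \<open>\<nu> i j\<close> only with its diagonal neighbour \<open>\<nu> (i+1) (j+1)\<close>. On and above
  the main diagonal one starts from \<open>\<nu> 0 j = 0\<close> and moves down, where the factor \<open>y^(d i)\<close> at the new
  unknown separates it from the normal entry; below the main diagonal one starts in row \<open>t\<close> and moves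
  up, using the factor \<open>y^(d j)\<close>.\<close>

lemma wt_propagate:
  fixes \<nu> \<gamma> :: "nat \<Rightarrow> nat \<Rightarrow> 'k::field polyS"
  assumes \<nu>0: "\<And>j. j \<le> t \<Longrightarrow> \<nu> 0 j = 0"
    and \<gamma>: "\<And>i j. i \<le> t \<Longrightarrow> j < t \<Longrightarrow> ynormal i j (\<gamma> i j)"
    and E: "\<And>i j. i \<le> t \<Longrightarrow> j < t \<Longrightarrow>
      wt n i j ((if i < t then Y (d i) * \<nu> (Suc i) (Suc j) else 0) - Y (d j) * \<nu> i j + \<gamma> i j)"
    and ij: "i \<le> t" "j \<le> t"
  shows "wt n i j (\<nu> i j)" and "j < t \<Longrightarrow> wt n i j (\<gamma> i j)"
proof -
  have upper_step: "wt n i j (\<gamma> i j) \<and> wt n i j (\<nu> (Suc i) (Suc j))"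
    if "i \<le> j" "j < t" "wt n i j (\<nu> i j)" for i j
  proof -
    have "wt n i j (((if i < t then Y (d i) * \<nu> (Suc i) (Suc j) else 0) - Y (d j) * \<nu> i j + \<gamma> i j)
        + Y (d j) * \<nu> i j)"
      by (rule wt_add[OF E wt_Y]) (use that in auto)
    then have "wt n i j (\<gamma> i j + Y (d i) * \<nu> (Suc i) (Suc j))"
      using that by (simp add: add.commute)
    moreover have "b < d i" if "(a, b, c) \<in> keys (\<gamma> i j)" for a b c
      using \<gamma>[of i j] that \<open>i \<le> j\<close> \<open>j < t\<close> by (auto simp: ynormal_def min_def)
    ultimately show ?thesis using wt_separate by blast
  qed
  have upper: "wt n i j (\<nu> i j)" if "i \<le> j" "j \<le> t" for i j
    using that
  proof (induction i arbitrary: j)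
    case (Suc i)
    then obtain j' where j': "j = Suc j'" by (cases j) auto
    have "wt n i j' (\<nu> i j')" using Suc j' by auto
    then show ?case using upper_step[of i j'] Suc.prems j' by auto
  qed (use \<nu>0 in auto)
  have lower_step: "wt n i j (\<gamma> i j) \<and> wt n i j (\<nu> i j)"
    if "j < i" "i \<le> t" "i < t \<Longrightarrow> wt n (Suc i) (Suc j) (\<nu> (Suc i) (Suc j))" for i j
  proof -
    have 1: "wt n i j (if i < t then Y (d i) * \<nu> (Suc i) (Suc j) else 0)"
      using that(3) by (auto intro: wt_Y)
    have 2: "wt n i j ((if i < t then Y (d i) * \<nu> (Suc i) (Suc j) else 0) - Y (d j) * \<nu> i j + \<gamma> i j)"
      using E that by auto
    have "\<gamma> i j + Y (d j) * (- \<nu> i j) = ((if i < t then Y (d i) * \<nu> (Suc i) (Suc j) else 0)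
        - Y (d j) * \<nu> i j + \<gamma> i j) - (if i < t then Y (d i) * \<nu> (Suc i) (Suc j) else 0)"
      by simp
    then have "wt n i j (\<gamma> i j + Y (d j) * (- \<nu> i j))" using wt_diff[OF 2 1] by (simp only:)
    moreover have "b < d j" if "(a, b, c) \<in> keys (\<gamma> i j)" for a b c
      using \<gamma>[of i j] that \<open>j < i\<close> \<open>i \<le> t\<close> by (auto simp: ynormal_def min_def)
    ultimately show ?thesis using wt_separate[of n i j "\<gamma> i j" "d j" "- \<nu> i j"] by simp
  qed
  have lower: "wt n i j (\<nu> i j)" if "j < i" "i \<le> t" for i j
    using that
  proof (induction "t - i" arbitrary: i j)
    case 0
    then show ?case using lower_step[of j i] by auto
  next
    case (Suc s)
    then have "wt n (Suc i) (Suc j) (\<nu> (Suc i) (Suc j))" using Suc.hyps(1)[of "Suc i" "Suc j"] by auto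
    then show ?case using lower_step[of j i] Suc.prems by auto
  qed
  show "wt n i j (\<nu> i j)" using upper lower ij by (cases "i \<le> j") auto
  show "wt n i j (\<gamma> i j)" if "j < t"
  proof (cases "i \<le> j")
    case True
    then show ?thesis using upper_step[of i j] upper[of i j] that by auto
  next
    case False
    then show ?thesis using lower_step[of j i] lower[of "Suc j" "Suc i"] ij by auto
  qed
qed

definition normal :: "(nat \<Rightarrow> nat \<Rightarrow> 'k::field polyS) \<Rightarrow> bool" where
  "normal \<beta> \<longleftrightarrow> (\<forall>i\<le>t. \<forall>j<t. ynormal i j (\<beta> i j))"

lemma normal_D: "normal \<beta> \<Longrightarrow> i \<le> t \<Longrightarrow> j < t \<Longrightarrow> ynormal i j (\<beta> i j)"
  by (simp add: normal_def)

text \<open>By induction on \<open>n\<close>, the transition matrix and the difference of the two normal matrices have weight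
  at least \<open>n\<close>: the products on the right-hand side of the base change equation then have weight at
  least \<open>n + 1\<close>. Forms of arbitrarily large weight vanish.\<close>

lemma normal_rel_unique:
  fixes f f' :: "nat \<Rightarrow> 'k::field polyS"
  assumes J: "is_ideal J" "lead_exps J \<subseteq> stairs"
    and f: "\<And>i. i \<le> t \<Longrightarrow> f i \<in> J \<and> shaped i (f i)"
    and f': "\<And>i. i \<le> t \<Longrightarrow> f' i \<in> J \<and> shaped i (f' i)"
    and rel: "rel f \<beta>" "rel f' \<beta>'" and hom: "homTmat \<beta>" "homTmat \<beta>'"
    and normal: "normal \<beta>" "normal \<beta>'"
    and ij: "i \<le> t" "j < t"
  shows "\<beta> i j = \<beta>' i j"
proof -
  obtain \<nu> where \<nu>: "\<And>j. j \<le> t \<Longrightarrow> f' j = f j + (\<Sum>i\<le>t. \<nu> i j * f i)"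
      "\<And>j. j \<le> t \<Longrightarrow> \<nu> 0 j = 0"
      "\<And>i j. i \<le> t \<Longrightarrow> j \<le> t \<Longrightarrow> homT (int (gdeg j) - int (gdeg i)) (\<nu> i j)"
      "\<And>i j. i \<le> t \<Longrightarrow> j \<le> t \<Longrightarrow> wt 1 i j (\<nu> i j)"
    using ex_transition[OF J f f'] by blast
  define \<gamma> where "\<gamma> i j = \<beta> i j - \<beta>' i j" for i j
  have hom_wt: "homT (u i j) (\<beta> i j)" "homT (u i j) (\<beta>' i j)"
    "ynormal i j (\<beta> i j)" "ynormal i j (\<beta>' i j)" if "i \<le> t" "j < t" for i j
    using hom normal that by (auto simp: homTmat_def normal_def)
  have \<gamma>n: "ynormal i j (\<gamma> i j)" if "i \<le> t" "j < t" for i j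
    unfolding \<gamma>_def using hom_wt[OF that] by (intro ynormal_diff)
  have \<beta>wt: "wt 1 i j (\<beta> i j)" "wt 1 i j (\<beta>' i j)" if "i \<le> t" "j < t" for i j
    by (rule ynormal_wt; use hom_wt[OF that] that in simp)+
  have step: "\<forall>i\<le>t. \<forall>j\<le>t. wt (Suc n) i j (\<nu> i j) \<and> (j < t \<longrightarrow> wt (Suc n) i j (\<gamma> i j))" for n
  proof (induction n)
    case 0
    then show ?case using \<nu>(4) \<beta>wt by (auto simp: \<gamma>_def intro!: wt_diff)
  next
    case (Suc n)
    have E: "wt (Suc (Suc n)) i j
        ((if i < t then Y (d i) * \<nu> (Suc i) (Suc j) else 0) - Y (d j) * \<nu> i j + \<gamma> i j)"
      if ij: "i \<le> t" "j < t" for i j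
    proof -
      have "wt (Suc (Suc n)) i j (\<nu> i k * \<beta>' k j)" if "k \<le> t" for k
        using wt_mult[of "Suc n" i k "\<nu> i k" 1 j "\<beta>' k j"] Suc.IH \<beta>wt(2) ij that by auto
      moreover have "wt (Suc (Suc n)) i j (\<beta> i k * \<nu> (Suc k) (Suc j))" if "k < t" for k
      proof -
        have "wt (Suc n) (Suc k) (Suc j) (\<nu> (Suc k) (Suc j))"
          using Suc.IH[rule_format, of "Suc k" "Suc j"] ij that by auto
        then show ?thesis
          using wt_mult[of 1 i k "\<beta> i k" "Suc n" j "\<nu> (Suc k) (Suc j)"] \<beta>wt(1) ij that by auto
      qed
      ultimately have "wt (Suc (Suc n)) i j
          ((\<Sum>k\<le>t. \<nu> i k * \<beta>' k j) - (\<Sum>k<t. \<beta> i k * \<nu> (Suc k) (Suc j)))"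
        by (intro wt_diff wt_sum) auto
      then show ?thesis
        unfolding \<gamma>_def
        using change_basis[of f \<beta> f' \<beta>' \<nu> i j] f rel hom \<nu>(1,2,3) ij by simp
    qed
    show ?case using wt_propagate[of \<nu> \<gamma> "Suc (Suc n)", OF \<nu>(2) \<gamma>n E] by auto
  qed
  have "wt (Suc ((t + 1) * nat (u i j) + i)) i j (\<gamma> i j)" using step ij by auto
  moreover have "homT (u i j) (\<gamma> i j)" unfolding \<gamma>_def using hom_wt[OF ij] by (intro homT_diff)
  ultimately have "\<gamma> i j = 0" by (intro wt_large_zero) auto
  then show ?thesis by (simp add: \<gamma>_def)
qed

section \<open>Existence of a normal relation matrix\<close>

definition ydiv :: "nat \<Rightarrow> 'k::field polyS \<Rightarrow> 'k polyS" where
  "ydiv k p = Poly_Mapping.map_key (\<lambda>(a, b, c). (a, b + k, c)) p"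

lemma lookup_ydiv: "lookup (ydiv k p) (a, b, c) = lookup p (a, b + k, c)"
proof -
  have "inj (\<lambda>(a :: nat, b, c :: nat). (a, b + k, c))" by (auto simp: inj_def)
  then show ?thesis by (simp add: ydiv_def map_key.rep_eq)
qed

lemma in_keys_ydiv [simp]: "(a, b, c) \<in> keys (ydiv k p) \<longleftrightarrow> (a, b + k, c) \<in> keys p"
  by (simp add: in_keys_iff lookup_ydiv)

lemma keys_ydiv_remainder: "(a, b, c) \<in> keys (p - Y k * ydiv k p) \<Longrightarrow> b < k"
  by (simp add: in_keys_iff lookup_minus lookup_Y_mult lookup_ydiv split: if_splits)

lemma ynormal_remainder: "ynormal i j (p - Y (d (min i j)) * ydiv (d (min i j)) p)"
  unfolding ynormal_def using keys_ydiv_remainder by blast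

lemma homT_ydiv: "homT v p \<Longrightarrow> homT (v - int k) (ydiv k p)"
  by (fastforce simp: homT_def)

lemma wt_ydiv: "wt n i j p \<Longrightarrow> wt n i j (ydiv k p)"
  by (auto simp: wt_def)

lemma homT_Y: "homT v p \<Longrightarrow> homT (v + int k) (Y k * p)"
  by (fastforce simp: homT_def)

lemma homT_uminus: "homT v (- p) \<longleftrightarrow> homT v p"
  by (simp add: homT_def)

lemma
  shows u_shift_row: "i < t \<Longrightarrow> int (gdeg (Suc j)) - int (gdeg (Suc i)) + int (d i) = u i j"
    and u_shift_col: "j < t \<Longrightarrow> int (gdeg j) - int (gdeg i) + int (d j) = u i j"
    and u_minus_row: "i < t \<Longrightarrow> u i j - int (d i) = int (gdeg (Suc j)) - int (gdeg (Suc i))"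
    and u_minus_col: "j < t \<Longrightarrow> u i j - int (d j) = int (gdeg j) - int (gdeg i)"
  using gdeg_Suc[of i] gdeg_Suc[of j] by (simp_all add: u_def)

text \<open>The same walk along the diagonals, now with division by powers of \<open>y\<close>: the quotient is the next
  unknown and the remainder is the normal entry. The index of the second function counts the rows
  from the bottom.\<close>

primrec upper_solution :: "(nat \<Rightarrow> nat \<Rightarrow> 'k::field polyS) \<Rightarrow> nat \<Rightarrow> nat \<Rightarrow> 'k polyS" where
  "upper_solution \<gamma> 0 = (\<lambda>j. 0)"
| "upper_solution \<gamma> (Suc i) =
    (\<lambda>j. - ydiv (d i) (\<gamma> i (j - 1) - Y (d (j - 1)) * upper_solution \<gamma> i (j - 1)))"

primrec lower_solution :: "(nat \<Rightarrow> nat \<Rightarrow> 'k::field polyS) \<Rightarrow> nat \<Rightarrow> nat \<Rightarrow> 'k polyS" where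
  "lower_solution \<gamma> 0 = (\<lambda>j. ydiv (d j) (\<gamma> t j))"
| "lower_solution \<gamma> (Suc s) =
    (\<lambda>j. ydiv (d j) (\<gamma> (t - Suc s) j + Y (d (t - Suc s)) * lower_solution \<gamma> s (Suc j)))"

lemma linear_solution:
  fixes \<gamma> :: "nat \<Rightarrow> nat \<Rightarrow> 'k::field polyS"
  assumes hom: "homTmat \<gamma>" and wt: "\<And>i j. i \<le> t \<Longrightarrow> j < t \<Longrightarrow> wt n i j (\<gamma> i j)"
  obtains \<nu> where "\<And>j. \<nu> 0 j = 0"
    "\<And>i j. i \<le> t \<Longrightarrow> j \<le> t \<Longrightarrow> homT (int (gdeg j) - int (gdeg i)) (\<nu> i j) \<and> wt n i j (\<nu> i j)"
    "\<And>i j. i \<le> t \<Longrightarrow> j < t \<Longrightarrow>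
      ynormal i j ((if i < t then Y (d i) * \<nu> (Suc i) (Suc j) else 0) - Y (d j) * \<nu> i j + \<gamma> i j)"
proof -
  let ?ok = "\<lambda>p i j. homT (int (gdeg j) - int (gdeg i)) p \<and> wt n i j p"
  have \<gamma>: "homT (u i j) (\<gamma> i j)" "wt n i j (\<gamma> i j)" if "i \<le> t" "j < t" for i j
    using that hom wt by (auto simp: homTmat_def)
  have upper: "?ok (upper_solution \<gamma> i j) i j" if "i \<le> j" "j \<le> t" for i j
    using that
  proof (induction i arbitrary: j)
    case (Suc i)
    then obtain j' where j: "j = Suc j'" by (cases j) auto
    then have lt: "i \<le> j'" "j' < t" "i < t" using Suc.prems by auto
    let ?p = "\<gamma> i j' - Y (d j') * upper_solution \<gamma> i j'"
    have IH: "?ok (upper_solution \<gamma> i j') i j'" using Suc.IH[of j'] lt by auto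
    have "homT (u i j') (Y (d j') * upper_solution \<gamma> i j')"
      using homT_Y[OF conjunct1[OF IH], of "d j'"] u_shift_col[of j'] lt by (simp only:)
    then have "homT (u i j') ?p" using \<gamma>(1)[of i j'] lt by (auto intro: homT_diff)
    from homT_ydiv[OF this, of "d i"]
    have "homT (int (gdeg j) - int (gdeg (Suc i))) (ydiv (d i) ?p)"
      using u_minus_row[of i] lt j by (simp only:)
    moreover have "wt n i j' (ydiv (d i) ?p)"
      using IH \<gamma>(2)[of i j'] lt by (intro wt_ydiv wt_diff wt_Y) auto
    ultimately show ?case using j by (simp add: homT_uminus)
  qed simp
  have lower: "?ok (lower_solution \<gamma> s j) (t - s) j" if "j < t - s" "s \<le> t" for s j
    using that
  proof (induction s arbitrary: j)
    case 0
    have "homT (u t j - int (d j)) (ydiv (d j) (\<gamma> t j))" using \<gamma>(1)[of t j] 0 by (intro homT_ydiv) auto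
    then show ?case using u_minus_col[of j] 0 \<gamma>(2)[of t j] by (auto intro: wt_ydiv)
  next
    case (Suc s)
    define i where "i = t - Suc s"
    have i: "i < t" "Suc i = t - s" "j < i" using Suc.prems by (auto simp: i_def)
    have IH: "?ok (lower_solution \<gamma> s (Suc j)) (Suc i) (Suc j)"
      using Suc.IH[of "Suc j"] Suc.prems i by auto
    let ?p = "\<gamma> i j + Y (d i) * lower_solution \<gamma> s (Suc j)"
    have "homT (u i j) (Y (d i) * lower_solution \<gamma> s (Suc j))"
      using homT_Y[OF conjunct1[OF IH], of "d i"] u_shift_row[of i] i by (simp only:)
    then have "homT (u i j) ?p" using \<gamma>(1)[of i j] i by (auto intro: homT_add)
    from homT_ydiv[OF this, of "d j"]
    have "homT (int (gdeg j) - int (gdeg i)) (ydiv (d j) ?p)"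
      using u_minus_col[of j] i by (auto simp only: less_trans)
    moreover have "wt n i j (lower_solution \<gamma> s (Suc j))" using conjunct2[OF IH] by simp
    then have "wt n i j (ydiv (d j) ?p)"
      using \<gamma>(2)[of i j] i by (intro wt_ydiv wt_add wt_Y) auto
    ultimately show ?case by (simp add: i_def)
  qed
  define \<nu> where "\<nu> i j = (if i \<le> j then upper_solution \<gamma> i j else lower_solution \<gamma> (t - i) j)" for i j
  show thesis
  proof (rule that[of \<nu>])
    show "\<nu> 0 j = 0" for j by (simp add: \<nu>_def)
    show "?ok (\<nu> i j) i j" if "i \<le> t" "j \<le> t" for i j
      using upper[of i j] lower[of j "t - i"] that by (auto simp: \<nu>_def)
    show "ynormal i j ((if i < t then Y (d i) * \<nu> (Suc i) (Suc j) else 0) - Y (d j) * \<nu> i j + \<gamma> i j)"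
      if ij: "i \<le> t" "j < t" for i j
    proof (cases "i \<le> j")
      case True
      let ?p = "\<gamma> i j - Y (d j) * upper_solution \<gamma> i j"
      have "(if i < t then Y (d i) * \<nu> (Suc i) (Suc j) else 0) - Y (d j) * \<nu> i j + \<gamma> i j
          = ?p - Y (d i) * ydiv (d i) ?p"
        using True ij by (simp add: \<nu>_def)
      moreover have "ynormal i j (?p - Y (d i) * ydiv (d i) ?p)"
        using ynormal_remainder[of i j ?p] True by (simp only: min_absorb1)
      ultimately show ?thesis by (simp only:)
    next
      case False
      let ?p = "(if i < t then Y (d i) * \<nu> (Suc i) (Suc j) else 0) + \<gamma> i j"
      have "\<nu> i j = ydiv (d j) ?p"
      proof (cases "i < t")
        case True
        then obtain s where s: "t - i = Suc s" "t - Suc s = i" "t - Suc i = s"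
          by (metis Suc_diff_Suc diff_diff_cancel ij(1))
        then show ?thesis using False True by (simp add: \<nu>_def add.commute)
      qed (use False ij in \<open>simp add: \<nu>_def\<close>)
      then have "(if i < t then Y (d i) * \<nu> (Suc i) (Suc j) else 0) - Y (d j) * \<nu> i j + \<gamma> i j
          = ?p - Y (d j) * ydiv (d j) ?p"
        by simp
      moreover have "ynormal i j (?p - Y (d j) * ydiv (d j) ?p)"
        using ynormal_remainder[of i j ?p] False by (simp only: min_absorb2 linorder_not_le less_imp_le)
      ultimately show ?thesis by (simp only:)
    qed
  qed
qed

text \<open>Positive weight means that a coefficient of \<open>f i\<close> in \<open>f' j\<close> involves \<open>z\<close> unless \<open>i > j\<close>, and in the
  latter case the terms of \<open>f i\<close> without \<open>z\<close> have \<open>y\<close>-exponent above \<open>m j\<close>.\<close>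

lemma shaped_transition:
  fixes f :: "nat \<Rightarrow> 'k::field polyS"
  assumes f: "\<And>i. i \<le> t \<Longrightarrow> shaped i (f i)"
    and \<nu>: "\<nu> 0 j = 0"
      "\<And>i. i \<le> t \<Longrightarrow> homT (int (gdeg j) - int (gdeg i)) (\<nu> i j) \<and> wt 1 i j (\<nu> i j)"
    and j: "j \<le> t"
  shows "shaped j (f j + (\<Sum>i\<le>t. \<nu> i j * f i))"
proof -
  let ?s = "\<Sum>i\<le>t. \<nu> i j * f i"
  have s: "a + b + c = gdeg j \<and> a < t \<and> (c = 0 \<longrightarrow> m j < b)" if "(a, b, c) \<in> keys ?s" for a b c
  proof -
    obtain i where i: "i \<le> t" "(a, b, c) \<in> keys (\<nu> i j * f i)" using \<open>(a, b, c) \<in> keys ?s\<close>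
      by (auto elim: keys_sumE)
    then obtain e1 e2 where e: "e1 \<in> keys (\<nu> i j)" "e2 \<in> keys (f i)" "(a, b, c) = e1 + e2"
      by (elim keys_multE)
    obtain a1 b1 c1 a2 b2 c2 where e12: "e1 = (a1, b1, c1)" "e2 = (a2, b2, c2)"
      by (cases e1; cases e2)
    have i0: "0 < i" using e(1) \<nu>(1) by (cases i) auto
    have 1: "a1 = 0" "int b1 + int c1 = int (gdeg j) - int (gdeg i)" "1 + j \<le> (t + 1) * c1 + i"
      using \<nu>(2)[OF i(1)] e(1) e12 by (auto simp: homT_def wt_def)
    have k2: "(a2, b2, c2) \<in> keys (f i)" using e(2) e12 by simp
    have 2: "a2 + b2 + c2 = gdeg i" "a2 < t"
      using shaped_degree[OF f[OF i(1)] k2] shaped_x_less[OF f[OF i(1)] k2] i0 by auto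
    have "m j < b" if c: "c = 0"
    proof -
      have c12: "c1 = 0" "c2 = 0" using c e(3) e12 by auto
      then have "m i \<le> b2" using f[OF i(1)] k2 unfolding shaped_def by blast
      moreover have "j < i" using 1 c12 by simp
      then have "m j < m i" using m_diff_le[of j i] i(1) by auto
      ultimately show ?thesis using e(3) e12 by auto
    qed
    then show ?thesis using 1 2 e(3) e12 by auto
  qed
  have fj: "shaped j (f j)" using f j by auto
  have key: "a + b + c = gdeg j \<and> (a < t \<or> j = 0) \<and> (c = 0 \<longrightarrow> m j \<le> b)"
    if "(a, b, c) \<in> keys (f j + ?s)" for a b c
    using that
  proof (rule keys_addE)
    assume k: "(a, b, c) \<in> keys (f j)"
    have "c = 0 \<longrightarrow> m j \<le> b" using fj k unfolding shaped_def by blast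
    then show ?thesis using shaped_degree[OF fj k] shaped_x_less[OF fj k] by auto
  next
    assume "(a, b, c) \<in> keys ?s"
    from s[OF this] show ?thesis by auto
  qed
  have "corner j \<notin> keys ?s" using s[of "t - j" "m j" 0] by auto
  then have "lookup ?s (corner j) = 0" by (simp only: not_in_keys_iff_lookup_eq_zero)
  then have "lookup (f j + ?s) (corner j) = 1" using fj by (simp add: lookup_add shaped_def)
  moreover have "\<forall>e\<in>keys (f j + ?s). tdegS e = gdeg j"
  proof
    fix e assume "e \<in> keys (f j + ?s)"
    then show "tdegS e = gdeg j" using key by (cases e) auto
  qed
  ultimately show ?thesis unfolding shaped_def using key by blast
qed

text \<open>Successive approximation. Write the relation matrix as a normal matrix plus an error of weight
  \<open>n\<close>; the base change that solves the linearized equation for the error replaces it by one of weight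
  at least \<open>n + 1\<close>. Once \<open>n\<close> exceeds the weights that occur in the degrees \<open>u i j\<close>, the error is zero.\<close>

lemma ex_normal_rel:
  assumes J: "homogeneous_ideal J" "lead_exps J = stairs"
  obtains f and \<beta> :: "nat \<Rightarrow> nat \<Rightarrow> 'k::field polyS"
  where "\<And>i. i \<le> t \<Longrightarrow> f i \<in> J \<and> shaped i (f i)" "rel f \<beta>" "homTmat \<beta>" "normal \<beta>"
proof -
  have ideal: "is_ideal J" "lead_exps J \<subseteq> stairs"
    using homogeneous_ideal_is_ideal J by auto
  have approx: "\<exists>f \<alpha> \<gamma>. (\<forall>i\<le>t. f i \<in> J \<and> shaped i (f i)) \<and> rel f (\<lambda>i j. \<alpha> i j + \<gamma> i j) \<and>
      homTmat \<alpha> \<and> homTmat \<gamma> \<and> normal \<alpha> \<and> (\<forall>i\<le>t. \<forall>j<t. wt (Suc n) i j (\<gamma> i j :: 'k polyS))" for n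
  proof (induction n)
    case 0
    obtain f where f: "\<And>i. i \<le> t \<Longrightarrow> f i \<in> J \<and> shaped i (f i)" using ex_shaped[OF J] by auto
    obtain \<beta> where \<beta>: "rel f \<beta>" "homTmat \<beta>" "\<And>i j. i \<le> t \<Longrightarrow> j < t \<Longrightarrow> wt 1 i j (\<beta> i j)"
      using ex_rel[OF ideal f] by blast
    show ?case
      by (rule exI[of _ f], rule exI[of _ "\<lambda>_ _. 0"], rule exI[of _ \<beta>])
        (use f \<beta> in \<open>auto simp: homTmat_def normal_def ynormal_def\<close>)
  next
    case (Suc n)
    then obtain f \<alpha> \<gamma> where f: "\<And>i. i \<le> t \<Longrightarrow> f i \<in> J \<and> shaped i (f i)"
      and rel: "rel f (\<lambda>i j. \<alpha> i j + \<gamma> i j)" and \<alpha>: "homTmat \<alpha>" "normal \<alpha>"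
      and \<gamma>: "homTmat \<gamma>" "\<And>i j. i \<le> t \<Longrightarrow> j < t \<Longrightarrow> wt (Suc n) i j (\<gamma> i j :: 'k polyS)"
      by blast
    obtain \<nu> where \<nu>: "\<And>j. \<nu> 0 j = 0"
      "\<And>i j. i \<le> t \<Longrightarrow> j \<le> t \<Longrightarrow> homT (int (gdeg j) - int (gdeg i)) (\<nu> i j) \<and> wt (Suc n) i j (\<nu> i j)"
      "\<And>i j. i \<le> t \<Longrightarrow> j < t \<Longrightarrow>
        ynormal i j ((if i < t then Y (d i) * \<nu> (Suc i) (Suc j) else 0) - Y (d j) * \<nu> i j + \<gamma> i j)"
      using linear_solution[OF \<gamma>] by blast
    define f' where "f' j = f j + (\<Sum>i\<le>t. \<nu> i j * f i)" for j
    have f': "f' j \<in> J \<and> shaped j (f' j)" if "j \<le> t" for j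
    proof
      show "f' j \<in> J"
        unfolding f'_def using f that
        by (intro ideal_add[OF ideal(1)] ideal_sum[OF ideal(1)] ideal_mult[OF ideal(1)]) auto
      show "shaped j (f' j)"
        unfolding f'_def using \<nu>(1,2) that f by (intro shaped_transition) (auto intro: wt_mono)
    qed
    obtain \<beta>' where \<beta>': "rel f' \<beta>'" "homTmat \<beta>'" "\<And>i j. i \<le> t \<Longrightarrow> j < t \<Longrightarrow> wt 1 i j (\<beta>' i j)"
      using ex_rel[OF ideal f'] by blast
    define \<beta> where "\<beta> i j = \<alpha> i j + \<gamma> i j" for i j
    have hom\<beta>: "homTmat \<beta>" using \<alpha>(1) \<gamma>(1) by (auto simp: homTmat_def \<beta>_def intro: homT_add)
    have wt\<beta>: "wt 1 i j (\<beta> i j)" if "i \<le> t" "j < t" for i j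
      unfolding \<beta>_def
    proof (rule wt_add)
      show "wt 1 i j (\<alpha> i j)"
        using \<alpha> that by (intro ynormal_wt) (auto simp: homTmat_def normal_def)
      show "wt 1 i j (\<gamma> i j)" using \<gamma>(2)[OF that] by (rule wt_mono) simp
    qed
    define L where "L i j = (if i < t then Y (d i) * \<nu> (Suc i) (Suc j) else 0) - Y (d j) * \<nu> i j" for i j
    \<comment> \<open>\<open>L + \<gamma>\<close> is the normal remainder of the error, so the new error is \<open>\<beta>' - \<alpha>'\<close>\<close>
    define \<alpha>' where "\<alpha>' i j = \<alpha> i j + (L i j + \<gamma> i j)" for i j
    have L: "L i j + (\<beta> i j - \<beta>' i j)
        = (\<Sum>k\<le>t. \<nu> i k * \<beta>' k j) - (\<Sum>k<t. \<beta> i k * \<nu> (Suc k) (Suc j))" if "i \<le> t" "j < t" for i j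
      unfolding L_def
      by (rule change_basis[of f \<beta> f' \<beta>'])
        (use f rel \<beta>' hom\<beta> \<nu>(1,2) that in \<open>auto simp: f'_def \<beta>_def[abs_def]\<close>)
    have "homTmat \<alpha>'"
      unfolding homTmat_def
    proof (intro allI impI)
      fix i j assume ij: "i \<le> t" "j < t"
      have "homT (u i j) (Y (d j) * \<nu> i j)"
        using homT_Y[OF conjunct1[OF \<nu>(2)[of i j]], of "d j"] u_shift_col[of j i] ij by simp
      moreover have "homT (u i j) (Y (d i) * \<nu> (Suc i) (Suc j))" if "i < t"
        using homT_Y[OF conjunct1[OF \<nu>(2)[of "Suc i" "Suc j"]], of "d i"] u_shift_row[of i j] ij that
        by simp
      ultimately show "homT (u i j) (\<alpha>' i j)"
        using \<alpha>(1) \<gamma>(1) ij by (auto simp: \<alpha>'_def L_def homTmat_def intro!: homT_add homT_diff)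
    qed
    moreover have "normal \<alpha>'"
      unfolding normal_def
    proof (intro allI impI)
      fix i j assume ij: "i \<le> t" "j < t"
      show "ynormal i j (\<alpha>' i j)"
        unfolding \<alpha>'_def L_def using normal_D[OF \<alpha>(2) ij] \<nu>(3)[OF ij] by (rule ynormal_add)
    qed
    moreover have "homTmat (\<lambda>i j. \<beta>' i j - \<alpha>' i j)"
      using \<beta>'(2) \<open>homTmat \<alpha>'\<close> by (auto simp: homTmat_def intro: homT_diff)
    moreover have "wt (Suc (Suc n)) i j (\<beta>' i j - \<alpha>' i j)" if ij: "i \<le> t" "j < t" for i j
    proof -
      have "wt (Suc (Suc n)) i j (\<nu> i k * \<beta>' k j)" if "k \<le> t" for k
        using wt_mult[of "Suc n" i k "\<nu> i k" 1 j "\<beta>' k j"] \<nu>(2) \<beta>'(3) ij that by auto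
      moreover have "wt (Suc (Suc n)) i j (\<beta> i k * \<nu> (Suc k) (Suc j))" if "k < t" for k
      proof -
        have "wt (Suc n) (Suc k) (Suc j) (\<nu> (Suc k) (Suc j))"
          using \<nu>(2)[of "Suc k" "Suc j"] ij that by auto
        then show ?thesis
          using wt_mult[of 1 i k "\<beta> i k" "Suc n" j "\<nu> (Suc k) (Suc j)"] wt\<beta> ij that by auto
      qed
      ultimately have "wt (Suc (Suc n)) i j
          ((\<Sum>k<t. \<beta> i k * \<nu> (Suc k) (Suc j)) - (\<Sum>k\<le>t. \<nu> i k * \<beta>' k j))"
        by (intro wt_diff wt_sum) auto
      moreover have "\<beta>' i j - \<alpha>' i j = - (L i j + (\<beta> i j - \<beta>' i j))"
        by (simp add: \<alpha>'_def \<beta>_def)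
      ultimately show ?thesis unfolding L[OF ij] by simp
    qed
    moreover have "rel f' (\<lambda>i j. \<alpha>' i j + (\<beta>' i j - \<alpha>' i j))" using \<beta>'(1) by simp
    ultimately show ?case
      using f' by (intro exI[of _ f'] exI[of _ \<alpha>'] exI[of _ "\<lambda>i j. \<beta>' i j - \<alpha>' i j"] conjI) auto
  qed
  \<comment> \<open>a weight above all weights that occur in the degrees \<open>u i j\<close>\<close>
  define N where "N = (t + 1) * (\<Sum>i\<le>t. \<Sum>j<t. nat (u i j)) + t"
  obtain f \<alpha> \<gamma> where f: "\<And>i. i \<le> t \<Longrightarrow> f i \<in> J \<and> shaped i (f i)"
    and rel: "rel f (\<lambda>i j. \<alpha> i j + \<gamma> i j)" and \<alpha>: "homTmat \<alpha>" "normal \<alpha>"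
    and \<gamma>: "homTmat \<gamma>" "\<And>i j. i \<le> t \<Longrightarrow> j < t \<Longrightarrow> wt (Suc N) i j (\<gamma> i j :: 'k polyS)"
    using approx[of N] by blast
  have "\<gamma> i j = 0" if ij: "i \<le> t" "j < t" for i j
  proof (rule wt_large_zero)
    show "homT (u i j) (\<gamma> i j)" using \<gamma>(1) ij by (auto simp: homTmat_def)
    show "wt (Suc N) i j (\<gamma> i j)" using \<gamma>(2) ij by auto
    have "nat (u i j) \<le> (\<Sum>j<t. nat (u i j))" using ij by (intro member_le_sum) auto
    also have "\<dots> \<le> (\<Sum>i\<le>t. \<Sum>j<t. nat (u i j))"
      using ij by (intro member_le_sum[of i "{..t}" "\<lambda>i. \<Sum>j<t. nat (u i j)"]) auto
    finally have "(t + 1) * nat (u i j) \<le> (t + 1) * (\<Sum>i\<le>t. \<Sum>j<t. nat (u i j))" by (rule mult_le_mono2)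
    then show "(t + 1) * nat (u i j) + i < Suc N" unfolding N_def using ij by linarith
  qed
  then have "rel f \<alpha>" using rel by (simp add: rel_def)
  then show thesis using that f \<alpha> by blast
qed

end

section \<open>Maximal minors\<close>

definition row_minor :: "nat \<Rightarrow> 'a::comm_ring_1 mat \<Rightarrow> nat \<Rightarrow> 'a" where
  "row_minor n M i = det (mat n n (\<lambda>(r, c). M $$ (insert_index i r, c)))"

text \<open>Expand the determinant of the matrix with column \<open>j\<close> repeated in front.\<close>

lemma row_minor_relation:
  fixes M :: "'a::comm_ring_1 mat"
  assumes j: "j < n"
  shows "(\<Sum>i\<le>n. (- 1) ^ i * row_minor n M i * M $$ (i, j)) = 0"
proof -
  define N where "N = mat (Suc n) (Suc n) (\<lambda>(i, c). if c = 0 then M $$ (i, j) else M $$ (i, c - 1))"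
  have N: "N \<in> carrier_mat (Suc n) (Suc n)" by (simp add: N_def)
  have "det (transpose_mat N) = 0"
  proof (rule det_identical_rows[of _ "Suc n" 0 "Suc j"])
    show "row (transpose_mat N) 0 = row (transpose_mat N) (Suc j)"
      by (rule eq_vecI) (use j in \<open>auto simp: N_def\<close>)
  qed (use N j in auto)
  then have "det N = 0" using det_transpose[OF N] by simp
  moreover have "det N = (\<Sum>i<Suc n. N $$ (i, 0) * cofactor N i 0)"
    by (rule laplace_expansion_column[OF N]) simp
  moreover have "N $$ (i, 0) * cofactor N i 0 = (- 1) ^ i * row_minor n M i * M $$ (i, j)"
    if "i < Suc n" for i
  proof -
    have "mat_delete N i 0 = mat n n (\<lambda>(r, c). M $$ (insert_index i r, c))"
      by (rule eq_matI) (auto simp: mat_delete_def N_def insert_index_def)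
    then show ?thesis using that by (simp add: cofactor_def row_minor_def N_def mult_ac)
  qed
  ultimately show ?thesis by (simp add: lessThan_Suc_atMost)
qed

lemma submatrix_delete_row:
  assumes M: "M \<in> carrier_mat (Suc n) n" and i: "i \<le> n"
  shows "submatrix M ({..<Suc n} - {i}) {..<n} = mat n n (\<lambda>(r, c). M $$ (insert_index i r, c))"
proof -
  let ?I = "{..<Suc n} - {i}"
  have rows: "{k. k < dim_row M \<and> k \<in> ?I} = ?I" and cols: "{k. k < dim_col M \<and> k \<in> {..<n}} = {..<n}"
    using M by auto
  have card_I: "card ?I = n" using i by simp
  have pick_I: "pick ?I r = insert_index i r" if "r < n" for r
  proof -
    have "insert_index i r \<in> ?I" using that i by (auto simp: insert_index_def)
    moreover have "card {a\<in>?I. a < insert_index i r} = r"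
    proof (cases "r < i")
      case True
      then have "{a\<in>?I. a < insert_index i r} = {..<r}" using that by auto
      then show ?thesis by simp
    next
      case False
      then have "{a\<in>?I. a < insert_index i r} = {..<Suc r} - {i}" using that by auto
      then show ?thesis using False by simp
    qed
    ultimately show ?thesis using pick_card_in_set by metis
  qed
  have pick_J: "pick {..<n} c = c" if "c < n" for c
  proof -
    have "{a\<in>{..<n}. a < c} = {..<c}" using that by auto
    then show ?thesis using pick_card_in_set[of c "{..<n}"] that by simp
  qed
  show ?thesis
    unfolding submatrix_def rows cols card_I
    by (rule eq_matI) (auto simp: pick_I pick_J)
qed

lemma minors_ideal_row_minors:
  fixes M :: "'a::comm_ring_1 mat"
  assumes M: "M \<in> carrier_mat (Suc n) n"
  shows "minors_ideal n M = ideal_gen (row_minor n M ` {..n})"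
proof -
  have "{det (submatrix M I J) | I J. I \<subseteq> {..<dim_row M} \<and> J \<subseteq> {..<dim_col M} \<and> card I = n \<and> card J = n}
      = row_minor n M ` {..n}" (is "?L = ?R")
  proof (intro equalityI subsetI)
    fix x assume "x \<in> ?L"
    then obtain I J where IJ: "I \<subseteq> {..<Suc n}" "J \<subseteq> {..<n}" "card I = n" "card J = n"
      and x: "x = det (submatrix M I J)"
      using M by auto
    have J: "J = {..<n}" using IJ by (intro card_subset_eq) auto
    have "card ({..<Suc n} - I) = 1" using IJ by (subst card_Diff_subset) (auto intro: finite_subset)
    then obtain i where i: "{..<Suc n} - I = {i}" by (auto simp: card_1_singleton_iff)
    then have "I = {..<Suc n} - {i}" "i \<le> n" using IJ(1) by auto
    then show "x \<in> ?R" using x J submatrix_delete_row[OF M] by (auto simp: row_minor_def)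
  next
    fix x assume "x \<in> ?R"
    then obtain i where i: "i \<le> n" "x = row_minor n M i" by auto
    then have "x = det (submatrix M ({..<Suc n} - {i}) {..<n})"
      using submatrix_delete_row[OF M] by (simp add: row_minor_def)
    moreover have "card ({..<Suc n} - {i}) = n" using i by simp
    ultimately show "x \<in> ?L" using M
      by (intro CollectI exI[of _ "{..<Suc n} - {i}"] exI[of _ "{..<n}"]) auto
  qed
  then show ?thesis by (simp add: minors_ideal_def)
qed

lemma keys_signof_mult [simp]: "keys (of_int (sign p) * (q :: 'k::field polyS)) = keys q"
  by (auto simp: sign_def)

lemma keys_minus_one_power_mult [simp]: "keys ((- 1) ^ n * (q :: 'k::field polyS)) = keys q"
  by (cases "even n") auto

lemma keys_prod_degree:
  fixes g :: "'i \<Rightarrow> 'k::field polyS"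
  assumes "finite S" "\<And>r e. r \<in> S \<Longrightarrow> e \<in> keys (g r) \<Longrightarrow> int (tdegS e) = v r"
    and "e \<in> keys (\<Prod>r\<in>S. g r)"
  shows "int (tdegS e) = (\<Sum>r\<in>S. v r)"
  using assms
proof (induction S arbitrary: e rule: finite_induct)
  case empty
  then show ?case by (auto simp: zero_prod_def)
next
  case (insert r S)
  then have "e \<in> keys (g r * (\<Prod>r\<in>S. g r))" by simp
  then obtain e1 e2 where e: "e1 \<in> keys (g r)" "e2 \<in> keys (\<Prod>r\<in>S. g r)" "e = e1 + e2"
    by (rule keys_multE)
  have "int (tdegS e1) = v r" using insert.prems(1) e(1) by auto
  moreover have "int (tdegS e2) = (\<Sum>r\<in>S. v r)" using insert.IH[OF _ e(2)] insert.prems(1) by auto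
  ultimately show ?case using insert.hyps e(3) by simp
qed

lemma keys_prod_x:
  fixes g :: "'i \<Rightarrow> 'k::field polyS"
  assumes "finite S" "\<And>r e. r \<in> S \<Longrightarrow> e \<in> keys (g r) \<Longrightarrow> fst e \<le> v r"
    and "e \<in> keys (\<Prod>r\<in>S. g r)"
  shows "fst e \<le> (\<Sum>r\<in>S. v r)"
  using assms
proof (induction S arbitrary: e rule: finite_induct)
  case empty
  then show ?case by (auto simp: zero_prod_def)
next
  case (insert r S)
  then have "e \<in> keys (g r * (\<Prod>r\<in>S. g r))" by simp
  then obtain e1 e2 where e: "e1 \<in> keys (g r)" "e2 \<in> keys (\<Prod>r\<in>S. g r)" "e = e1 + e2"
    by (rule keys_multE)
  have "fst e1 \<le> v r" using insert.prems(1) e(1) by auto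
  moreover have "fst e2 \<le> (\<Sum>r\<in>S. v r)" using insert.IH[OF _ e(2)] insert.prems(1) by auto
  ultimately show ?case using insert.hyps e(3) by simp
qed

definition z_cong :: "'k::field polyS \<Rightarrow> 'k polyS \<Rightarrow> bool" where
  "z_cong p q \<longleftrightarrow> (\<forall>a b. (a, b, 0) \<notin> keys (p - q))"

lemma z_cong_refl [simp]: "z_cong p p"
  by (simp add: z_cong_def)

lemma z_cong_add: "z_cong p p' \<Longrightarrow> z_cong q q' \<Longrightarrow> z_cong (p + q) (p' + q')"
  unfolding z_cong_def by (metis add_diff_add keys_addE)

lemma z_cong_mult:
  assumes "z_cong p p'" "z_cong q q'"
  shows "z_cong (p * q) (p' * q')"
proof -
  have "p * q - p' * q' = p * (q - q') + (p - p') * q'" by (simp add: algebra_simps)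
  moreover have "(a, b, 0) \<notin> keys (p * (q - q'))" "(a, b, 0) \<notin> keys ((p - p') * q')" for a b
    using assms by (auto simp: z_cong_def elim!: keys_multE)
  ultimately show ?thesis unfolding z_cong_def by (metis keys_addE)
qed

lemma z_cong_prod: "(\<And>r. r \<in> S \<Longrightarrow> z_cong (g r) (h r)) \<Longrightarrow> z_cong (\<Prod>r\<in>S. g r) (\<Prod>r\<in>S. h r)"
  by (induction S rule: infinite_finite_induct) (auto intro: z_cong_mult)

lemma z_cong_sum: "(\<And>r. r \<in> S \<Longrightarrow> z_cong (g r) (h r)) \<Longrightarrow> z_cong (\<Sum>r\<in>S. g r) (\<Sum>r\<in>S. h r)"
  by (induction S rule: infinite_finite_induct) (auto intro: z_cong_add)

text \<open>A matrix that is lower triangular modulo \<open>z\<close> has the product of its diagonal as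
  determinant modulo \<open>z\<close>: every other permutation moves some row to the right of the diagonal.\<close>

lemma z_cong_det:
  fixes A :: "'k::field polyS mat"
  assumes A: "A \<in> carrier_mat n n"
    and above: "\<And>r c. r < c \<Longrightarrow> c < n \<Longrightarrow> z_cong (A $$ (r, c)) 0"
    and diag: "\<And>r. r < n \<Longrightarrow> z_cong (A $$ (r, r)) (g r)"
  shows "z_cong (det A) (\<Prod>r<n. g r)"
proof -
  let ?P = "{p. p permutes {0..<n}}"
  have fin: "finite ?P" by (simp add: finite_permutations)
  have "z_cong (of_int (sign p) * (\<Prod>r = 0..<n. A $$ (r, p r))) (if p = id then \<Prod>r<n. g r else 0)"
    if p: "p \<in> ?P" for p
  proof (cases "p = id")
    case True
    have "z_cong (\<Prod>r = 0..<n. A $$ (r, r)) (\<Prod>r = 0..<n. g r)" using diag by (intro z_cong_prod) auto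
    then show ?thesis using True by (simp add: sign_id lessThan_atLeast0)
  next
    case False
    then have "\<not> (\<forall>r\<in>{0..<n}. p r \<le> r)"
      using permutes_natset_le[of p "{0..<n}"] p by blast
    then obtain r where r: "r < n" "r < p r" by (auto simp: not_le)
    have "p r < n" using p r(1) permutes_in_image[of p "{0..<n}" r] by auto
    then have z: "z_cong (A $$ (r, p r)) 0" using above r by auto
    have "(\<Prod>r = 0..<n. A $$ (r, p r)) = A $$ (r, p r) * (\<Prod>k\<in>{0..<n} - {r}. A $$ (k, p k))"
      using r(1) by (intro prod.remove) auto
    then have "z_cong (\<Prod>r = 0..<n. A $$ (r, p r)) 0"
      using z_cong_mult[OF z, of "\<Prod>k\<in>{0..<n} - {r}. A $$ (k, p k)"] z_cong_refl by fastforce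
    from z_cong_mult[OF z_cong_refl this, of "of_int (sign p)"] show ?thesis using False by simp
  qed
  then have "z_cong (det A) (\<Sum>p\<in>?P. if p = id then \<Prod>r<n. g r else 0)"
    unfolding det_def'[OF A] by (intro z_cong_sum) auto
  moreover have "id \<in> ?P" by (simp add: permutes_id)
  ultimately show ?thesis using fin by simp
qed

lemma prod_Y: "(\<Prod>r<n. Y (k r)) = (Y (\<Sum>r<n. k r) :: 'k::field polyS)" for n :: nat
proof (induction n)
  case 0
  have "(0, 0, 0) = (0 :: nat \<times> nat \<times> nat)" by (simp add: zero_prod_def)
  then show ?case by (simp add: Y_def monS_def)
qed (simp add: Y_def monS_def mult_single add.commute)

context staircase
begin

text \<open>The Hilbert-Burch matrix of the monomial ideal, perturbed by \<open>\<beta>\<close>.\<close>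

definition hb_matrix :: "(nat \<Rightarrow> nat \<Rightarrow> 'k::field polyS) \<Rightarrow> 'k polyS mat" where
  "hb_matrix \<beta> = mat (Suc t) t
     (\<lambda>(i, j). (if i = j then Y (d j) else 0) - (if i = Suc j then X else 0) + \<beta> i j)"

text \<open>The sign makes the leading coefficients 1: the \<open>i\<close>-th minor contains \<open>- x\<close> to the power \<open>t - i\<close>.\<close>

definition hb_basis :: "(nat \<Rightarrow> nat \<Rightarrow> 'k::field polyS) \<Rightarrow> nat \<Rightarrow> 'k polyS" where
  "hb_basis \<beta> i = (- 1) ^ (t + i) * row_minor t (hb_matrix \<beta>) i"

lemma rel_hb_basis: "rel (hb_basis \<beta>) (\<beta> :: nat \<Rightarrow> nat \<Rightarrow> 'k::field polyS)"
  unfolding rel_def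
proof (intro allI impI)
  fix j assume j: "j < t"
  let ?f = "hb_basis \<beta>"
  define q where "q i = (if i = Suc j then - X else 0) + \<beta> i j" for i
  have "0 = (- 1) ^ t * (\<Sum>i\<le>t. (- 1) ^ i * row_minor t (hb_matrix \<beta>) i * hb_matrix \<beta> $$ (i, j))"
    using row_minor_relation[OF j, of "hb_matrix \<beta>"] by simp
  also have "\<dots> = (\<Sum>i\<le>t. hb_matrix \<beta> $$ (i, j) * ?f i)"
    unfolding sum_distrib_left hb_basis_def by (rule sum.cong) (auto simp: power_add mult_ac)
  also have "\<dots> = (\<Sum>i\<le>t. ((if i = j then Y (d j) else 0) + q i) * ?f i)"
    by (rule sum.cong) (use j in \<open>auto simp: hb_matrix_def q_def\<close>)
  also have "\<dots> = Y (d j) * ?f j + (\<Sum>i\<le>t. q i * ?f i)" using j by (subst sum_delta_mult) auto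
  also have "(\<Sum>i\<le>t. q i * ?f i) = - X * ?f (Suc j) + (\<Sum>i\<le>t. \<beta> i j * ?f i)"
    unfolding q_def using j by (subst sum_delta_mult) auto
  finally show "X * ?f (Suc j) = Y (d j) * ?f j + (\<Sum>i\<le>t. \<beta> i j * ?f i)"
    by (simp add: algebra_simps)
qed

text \<open>Both facts follow from the Leibniz formula. The degrees \<open>u r c\<close> are differences of a column and a
  row contribution, so all permutations give the same degree. Row 0 does not involve \<open>x\<close>, and the
  other entries have \<open>x\<close>-degree at most 1.\<close>

lemma
  assumes \<beta>: "homTmat \<beta>" and i: "i \<le> t" and key: "(a, b, c) \<in> keys (hb_basis \<beta> i)"
  shows hb_basis_degree: "a + b + c = gdeg i"
    and hb_basis_x_less: "0 < i \<Longrightarrow> a < t"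
proof -
  let ?A = "mat t t (\<lambda>(r, c). hb_matrix \<beta> $$ (insert_index i r, c))"
  have A: "?A \<in> carrier_mat t t" by simp
  have "(a, b, c) \<in> keys (det ?A)" using key by (simp add: hb_basis_def row_minor_def)
  then obtain p where p: "p permutes {0..<t}" "(a, b, c) \<in> keys (\<Prod>r = 0..<t. ?A $$ (r, p r))"
    unfolding det_def'[OF A] by (auto elim!: keys_sumE simp del: index_mat)
  have gdeg_0: "gdeg 0 = t" by (simp add: gdeg_def)
  have p_less: "p r < t" if "r < t" for r
    using p(1) that permutes_in_image[of p "{0..<t}" r] by auto
  have ins: "insert_index i r \<le> t" if "r < t" for r
    using that i by (auto simp: insert_index_def)
  have entry: "int (tdegS e) = u r c \<and> (fst e \<le> (if r = 0 then 0 else 1))"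
    if "r \<le> t" "c < t" "e \<in> keys (hb_matrix \<beta> $$ (r, c))" for r c e
  proof -
    obtain x y z where e: "e = (x, y, z)" by (cases e)
    have hom: "homT (u r c) (\<beta> r c)" using \<beta> that by (auto simp: homTmat_def)
    have diag: "u c c = int (d c)" using gdeg_Suc[OF that(2)] by (simp add: u_def)
    have sub: "u (Suc c) c = 1" by (simp add: u_def)
    have "e \<in> keys ((if r = c then Y (d c) else 0) - (if r = Suc c then X else 0) + \<beta> r c)"
      using that by (simp add: hb_matrix_def)
    then show ?thesis
    proof (elim keys_addE keys_minusE)
      assume "e \<in> keys (if r = c then Y (d c) else 0)"
      then show ?thesis using diag by (auto simp: Y_def monS_def split: if_splits)
    next
      assume "e \<in> keys (if r = Suc c then X else 0)"
      then show ?thesis using sub by (auto simp: X_def monS_def split: if_splits)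
    next
      assume "e \<in> keys (\<beta> r c)"
      then show ?thesis using homT_D[OF hom, of x y z] e by auto
    qed
  qed
  have "int (tdegS (a, b, c)) = (\<Sum>r = 0..<t. u (insert_index i r) (p r))"
  proof (rule keys_prod_degree[OF _ _ p(2)])
    fix r e assume "r \<in> {0..<t}" "e \<in> keys (?A $$ (r, p r))"
    then show "int (tdegS e) = u (insert_index i r) (p r)"
      using entry[of "insert_index i r" "p r" e] ins p_less by simp
  qed simp
  also have "\<dots> = (\<Sum>r = 0..<t. int (gdeg (Suc (p r))) + 1) - (\<Sum>r = 0..<t. int (gdeg (insert_index i r)))"
    by (simp add: u_def sum_subtractf)
  also have "(\<Sum>r = 0..<t. int (gdeg (Suc (p r))) + 1) = (\<Sum>r = 0..<t. int (gdeg (Suc r)) + 1)"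
    using sum.permute[OF p(1), of "\<lambda>r. int (gdeg (Suc r)) + 1"] by (simp add: o_def)
  also have "\<dots> = (\<Sum>k\<le>t. int (gdeg k))"
    using sum.atMost_shift[of "\<lambda>k. int (gdeg k)" t] gdeg_0 by (simp add: sum.distrib atLeast0LessThan)
  also have "(\<Sum>r = 0..<t. int (gdeg (insert_index i r))) = (\<Sum>k\<in>{0..<Suc t} - {i}. int (gdeg k))"
    using insert_index_image[of i t] i insert_index_inj_on[of i "{0..<t}"]
      sum.reindex[of "insert_index i" "{0..<t}" "\<lambda>k. int (gdeg k)"]
    by (simp add: o_def)
  also have "\<dots> = (\<Sum>k\<le>t. int (gdeg k)) - int (gdeg i)"
    using i by (simp add: sum_diff1 atLeast0LessThan lessThan_Suc_atMost)
  finally show "a + b + c = gdeg i" by simp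
  show "a < t" if "0 < i"
  proof -
    have "fst (a, b, c) \<le> (\<Sum>r = 0..<t. if r = 0 then 0 else 1 :: nat)"
    proof (rule keys_prod_x[OF _ _ p(2)])
      fix r e assume r: "r \<in> {0..<t}" and "e \<in> keys (?A $$ (r, p r))"
      then have "fst e \<le> (if insert_index i r = 0 then 0 else 1)"
        using entry[of "insert_index i r" "p r" e] ins p_less by simp
      then show "fst e \<le> (if r = 0 then 0 else 1)"
        using \<open>0 < i\<close> by (auto simp: insert_index_def split: if_splits)
    qed simp
    also have "\<dots> = (\<Sum>r\<in>{0..<t} - {0}. 1)"
      by (rule sum.mono_neutral_cong_right) auto
    also have "\<dots> < t" using \<open>0 < i\<close> i by simp
    finally show ?thesis by simp
  qed
qed

lemma sum_d: "n \<le> t \<Longrightarrow> (\<Sum>r<n. d r) = m n"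
  by (induction n) (auto simp: m_plus_d)

lemma hb_basis_top:
  assumes wt: "\<And>i j. i \<le> t \<Longrightarrow> j < t \<Longrightarrow> wt 1 i j (\<beta> i j)"
  shows "z_cong (hb_basis \<beta> t) (Y (m t))"
proof -
  let ?A = "mat t t (\<lambda>(r, c). hb_matrix \<beta> $$ (insert_index t r, c))"
  have \<beta>z: "z_cong (\<beta> r c) 0" if "r \<le> c" "c < t" for r c
  proof -
    have "1 + c \<le> (t + 1) * 0 + r" if "(a, b, 0) \<in> keys (\<beta> r c)" for a b
      using wt[of r c] that \<open>r \<le> c\<close> \<open>c < t\<close> unfolding wt_def by fastforce
    then show ?thesis using that by (auto simp: z_cong_def)
  qed
  have "z_cong (det ?A) (\<Prod>r<t. Y (d r))"
  proof (rule z_cong_det)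
    fix r c assume "r < c" "c < t"
    then show "z_cong (?A $$ (r, c)) 0" using \<beta>z[of r c] by (simp add: hb_matrix_def)
  next
    fix r assume r: "r < t"
    then have "?A $$ (r, r) = Y (d r) + \<beta> r r" by (simp add: hb_matrix_def)
    then show "z_cong (?A $$ (r, r)) (Y (d r))"
      using z_cong_add[OF z_cong_refl \<beta>z[of r r], of "Y (d r)"] r by simp
  qed simp
  then show ?thesis by (simp add: hb_basis_def row_minor_def prod_Y sum_d flip: power_add mult_2)
qed

text \<open>Descending induction on \<open>i\<close>. Modulo \<open>z\<close> the last minor is the product \<open>y^(m t)\<close> of the diagonal, and
  the relation \<open>y^(d i) f i = x f (i+1) - ...\<close> carries the terms without \<open>z\<close> from \<open>i + 1\<close> to \<open>i\<close>:
  entries of positive weight contribute only through \<open>f k\<close> with \<open>k > i\<close>, whose terms have large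
  \<open>y\<close>-exponents.\<close>

lemma shaped_hb_basis:
  assumes \<beta>: "homTmat \<beta>" and wt: "\<And>i j. i \<le> t \<Longrightarrow> j < t \<Longrightarrow> wt 1 i j (\<beta> i j)" and i: "i \<le> t"
  shows "shaped i (hb_basis \<beta> i :: 'k::field polyS)"
proof -
  let ?f = "hb_basis \<beta>"
  have "(\<forall>a b. (a, b, 0) \<in> keys (?f i) \<longrightarrow> m i \<le> b) \<and> lookup (?f i) (corner i) = 1"
    using i
  proof (induction "t - i" arbitrary: i rule: less_induct)
    case less
    show ?case
    proof (cases "i = t")
      case True
      have cong: "z_cong (?f t) (Y (m t))" by (rule hb_basis_top[OF wt])
      have look: "lookup (?f t) (a, b, 0) = lookup (Y (m t)) (a, b, 0)" for a b
      proof -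
        have "(a, b, 0) \<notin> keys (?f t - Y (m t))" using cong by (simp add: z_cong_def)
        then have "lookup (?f t - Y (m t)) (a, b, 0) = 0" by (simp only: not_in_keys_iff_lookup_eq_zero)
        then show ?thesis by (simp add: lookup_minus)
      qed
      then have "(a, b, 0) \<in> keys (?f t) \<longleftrightarrow> (a, b, 0) \<in> keys (Y (m t) :: 'k polyS)" for a b
        by (simp only: in_keys_iff)
      then show ?thesis using True look[of 0 "m t"] by (auto simp: Y_def monS_def)
    next
      case False
      then have lt: "i < t" using less.prems by simp
      have IH: "(a, b, 0) \<in> keys (?f k) \<Longrightarrow> m k \<le> b" "lookup (?f k) (corner k) = 1"
        if "i < k" "k \<le> t" for a b k
        using less.hyps[of k] that by auto
      have eq: "Y (d i) * ?f i = X * ?f (Suc i) - (\<Sum>k\<le>t. \<beta> k i * ?f k)"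
        using rel_D[OF rel_hb_basis lt, of \<beta>] by simp
      have tail: "m (Suc i) \<le> b \<and> a \<noteq> t - i"
        if "k \<le> t" "(a, b, 0) \<in> keys (\<beta> k i * ?f k)" for a b k
      proof -
        obtain e1 e2 where e: "e1 \<in> keys (\<beta> k i)" "e2 \<in> keys (?f k)" "(a, b, 0) = e1 + e2"
          using \<open>(a, b, 0) \<in> keys (\<beta> k i * ?f k)\<close> by (elim keys_multE)
        obtain a1 b1 c1 a2 b2 c2 where e12: "e1 = (a1, b1, c1)" "e2 = (a2, b2, c2)"
          by (cases e1; cases e2)
        have c: "c1 = 0" "c2 = 0" and ab: "a = a1 + a2" "b = b1 + b2" using e(3) e12 by auto
        have hom: "homT (u k i) (\<beta> k i)" using \<beta> \<open>k \<le> t\<close> lt by (auto simp: homTmat_def)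
        have "a1 = 0" using homT_D[OF hom, of a1 b1 c1] e(1) e12 by auto
        have "1 + i \<le> (t + 1) * c1 + k" using wt[OF \<open>k \<le> t\<close> lt] e(1) e12 unfolding wt_def by blast
        then have ik: "i < k" using c by simp
        have k2: "(a2, b2, 0) \<in> keys (?f k)" using e(2) e12 c by simp
        have b2: "m k \<le> b2" by (rule IH(1)[OF ik \<open>k \<le> t\<close> k2])
        moreover have "m (Suc i) \<le> m k" using m_diff_le[of "Suc i" k] ik \<open>k \<le> t\<close> by auto
        moreover have "a2 \<noteq> t - i"
          using hb_basis_degree[OF \<beta> \<open>k \<le> t\<close> k2] b2 ik \<open>k \<le> t\<close> by (simp add: gdeg_def)
        ultimately show ?thesis using ab \<open>a1 = 0\<close> by auto
      qed
      have "m i \<le> b" if k: "(a, b, 0) \<in> keys (?f i)" for a b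
      proof -
        have "(a, b + d i, 0) \<in> keys (Y (d i) * ?f i)" using k by simp
        then have "(a, b + d i, 0) \<in> keys (X * ?f (Suc i) - (\<Sum>k\<le>t. \<beta> k i * ?f k))" unfolding eq .
        then have "m (Suc i) \<le> b + d i"
        proof (rule keys_minusE)
          assume "(a, b + d i, 0) \<in> keys (X * ?f (Suc i))"
          then show ?thesis using IH(1)[of "Suc i" "a - 1"] lt by auto
        next
          assume "(a, b + d i, 0) \<in> keys (\<Sum>k\<le>t. \<beta> k i * ?f k)"
          then show ?thesis using tail by (blast elim: keys_sumE)
        qed
        then show ?thesis using m_plus_d[OF lt] by simp
      qed
      moreover have "lookup (?f i) (corner i) = 1"
      proof -
        have "lookup (?f i) (corner i) = lookup (Y (d i) * ?f i) (t - i, m (Suc i), 0)"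
        proof -
          have "m (Suc i) - d i = m i" "d i \<le> m (Suc i)" using m_plus_d[OF lt] by auto
          then show ?thesis by (simp add: lookup_Y_mult)
        qed
        also have "\<dots> = lookup (X * ?f (Suc i)) (t - i, m (Suc i), 0)
            - lookup (\<Sum>k\<le>t. \<beta> k i * ?f k) (t - i, m (Suc i), 0)"
          unfolding eq by (simp add: lookup_minus)
        also have "lookup (\<Sum>k\<le>t. \<beta> k i * ?f k) (t - i, m (Suc i), 0) = 0"
        proof -
          have "(t - i, m (Suc i), 0) \<notin> keys (\<Sum>k\<le>t. \<beta> k i * ?f k)"
            using tail by (blast elim: keys_sumE)
          then show ?thesis by (simp only: not_in_keys_iff_lookup_eq_zero)
        qed
        also have "lookup (X * ?f (Suc i)) (t - i, m (Suc i), 0) = 1"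
          using IH(2)[of "Suc i"] lt by (simp add: lookup_X_mult)
        finally show ?thesis by simp
      qed
      ultimately show ?thesis by blast
    qed
  qed
  moreover have "\<forall>e\<in>keys (?f i). tdegS e = gdeg i" using hb_basis_degree[OF \<beta> i] by auto
  ultimately show ?thesis
    unfolding shaped_def using hb_basis_x_less[OF \<beta> i] by blast
qed

lemma minors_ideal_hb:
  "minors_ideal t (hb_matrix \<beta>) = ideal_gen (hb_basis \<beta> ` {..t})" (is "?L = ?R")
proof -
  have mem: "(- 1) ^ k * g \<in> ideal_gen B" if "g \<in> B" for k and g :: "'k::field polyS" and B
    using ideal_mult[OF ideal_gen_is_ideal] ideal_gen_superset that by blast
  have L: "?L = ideal_gen (row_minor t (hb_matrix \<beta>) ` {..t})"
    by (rule minors_ideal_row_minors) (simp add: hb_matrix_def)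
  have minor_eq: "row_minor t (hb_matrix \<beta>) i = (- 1) ^ (t + i) * hb_basis \<beta> i" for i
    by (simp add: hb_basis_def flip: mult.assoc power_add mult_2)
  show ?thesis
    unfolding L
  proof
    show "ideal_gen (row_minor t (hb_matrix \<beta>) ` {..t}) \<subseteq> ?R"
      by (rule ideal_gen_minimal[OF _ ideal_gen_is_ideal]) (auto simp: minor_eq intro!: mem)
    show "?R \<subseteq> ideal_gen (row_minor t (hb_matrix \<beta>) ` {..t})"
      by (rule ideal_gen_minimal[OF _ ideal_gen_is_ideal]) (auto simp: hb_basis_def intro!: mem)
  qed
qed

end

section \<open>The staircase of a lex-segment ideal\<close>

lemma monomial_ideal_eq:
  assumes "monomial_ideal I"
  shows "I = {f :: 'k::field polyR. \<forall>v\<in>keys f. monR v \<in> I}"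
    and "monR v \<in> I \<Longrightarrow> monR (v + w) \<in> I"
proof -
  obtain E where "I = ideal_gen ((\<lambda>e. Poly_Mapping.single e (1::'k)) ` E)"
    using assms by (auto simp: monomial_ideal_def monR_def)
  then have I: "I = {f. \<forall>e\<in>keys f. \<exists>e1\<in>E. \<exists>e2. e = e1 + e2}" by (simp add: ideal_gen_monomials)
  then have mem: "monR v \<in> I \<longleftrightarrow> (\<exists>e1\<in>E. \<exists>e2. v = e1 + e2)" for v by (simp add: monR_def)
  show "I = {f. \<forall>v\<in>keys f. monR v \<in> I}" unfolding mem by (rule I)
  show "monR v \<in> I \<Longrightarrow> monR (v + w) \<in> I" unfolding mem by (metis add.assoc)
qed

text \<open>
  Applied to the powers of one variable. Monomials outside the ideal are linearly independent modulo
  the ideal, whereas the elements of the span of a finite set have their exponents in a fixed finite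
  set.
\<close>

lemma finite_dim_quotient_monomial:
  fixes I :: "'k::field polyR set"
  assumes I: "monomial_ideal I" "finite_dim_quotient I" and V: "infinite V"
  shows "\<exists>v\<in>V. monR v \<in> I"
proof (rule ccontr)
  assume none: "\<not> ?thesis"
  obtain B where B: "finite B" "\<And>f. \<exists>g\<in>Modules.module.span scaleR_K B. f - g \<in> I"
    using I(2) by (auto simp: finite_dim_quotient_def)
  define K where "K = \<Union>(keys ` B)"
  have "finite K" using B(1) by (simp add: K_def)
  have module: "Modules.module (scaleR_K :: 'k \<Rightarrow> _)"
    using vector_space_scaleR_K by (simp add: module_iff_vector_space)
  have "Modules.module.subspace scaleR_K {g :: 'k polyR. keys g \<subseteq> K}"
    unfolding module.subspace_def[OF module] scaleR_K_def
    by (auto simp: zero_prod_def elim!: keys_addE keys_multE split: if_splits)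
  then have span: "Modules.module.span scaleR_K B \<subseteq> {g. keys g \<subseteq> K}"
    by (rule module.span_minimal[OF module, rotated]) (auto simp: K_def)
  obtain v where v: "v \<in> V" "v \<notin> K" using V \<open>finite K\<close> by (meson finite_subset subsetI)
  obtain g where g: "g \<in> Modules.module.span scaleR_K B" "monR v - g \<in> I" using B(2) by blast
  have "v \<notin> keys g" using span g(1) v(2) by blast
  then have "v \<in> keys (monR v - g)" by (simp add: in_keys_iff lookup_minus monR_def)
  then have "monR v \<in> I" using monomial_ideal_eq(1)[OF I(1)] g(2) by blast
  then show False using none v(1) by blast
qed

text \<open>Strict growth of \<open>m\<close>: since the corner \<open>x^(t-i-1) y^(m (i+1))\<close> lies in the ideal, so does the next
  larger monomial \<open>x^(t-i) y^(m (i+1) - 1)\<close> of the same degree.\<close>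

lemma
  fixes I0 :: "'k::field polyR set"
  assumes lex: "lex_segment_ideal I0" and fin: "finite_dim_quotient I0"
  shows staircase_lex_segment: "staircase (t_of I0) (m_of I0)"
    and monR_mem_iff: "monR (a, b) \<in> I0 \<longleftrightarrow> m_of I0 (t_of I0 - a) \<le> b"
proof -
  let ?t = "t_of I0" and ?m = "m_of I0"
  have mono: "monomial_ideal I0" using lex by (simp add: lex_segment_ideal_def)
  have up: "monR (a', b') \<in> I0" if "monR (a, b) \<in> I0" "a \<le> a'" "b \<le> b'" for a b a' b'
    using monomial_ideal_eq(2)[OF mono that(1), of "(a' - a, b' - b)"] that(2,3) by simp
  have "inj (\<lambda>j :: nat. (j, 0 :: nat))" "inj (\<lambda>j :: nat. (0 :: nat, j))" by (auto simp: inj_def)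
  then have inf: "infinite (range (\<lambda>j :: nat. (j, 0 :: nat)))" "infinite (range (\<lambda>j :: nat. (0 :: nat, j)))"
    by (simp_all add: finite_image_iff)
  obtain k where "monR (k, 0) \<in> I0" using finite_dim_quotient_monomial[OF mono fin inf(1)] by auto
  then have t: "monR (?t, 0) \<in> I0" unfolding t_of_def by (rule LeastI)
  have below_t: "monR (a, 0) \<notin> I0" if "a < ?t" for a
    using that unfolding t_of_def by (rule not_less_Least)
  obtain l where "monR (0, l) \<in> I0" using finite_dim_quotient_monomial[OF mono fin inf(2)] by auto
  then have ex: "monR (a, l) \<in> I0" for a by (rule up) auto
  have iff: "monR (a, b) \<in> I0 \<longleftrightarrow> ?m (?t - a) \<le> b" for a b
  proof (cases "a < ?t")
    case True
    then have m: "?m (?t - a) = (LEAST j. monR (a, j) \<in> I0)" by (simp add: m_of_def)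
    have "monR (a, ?m (?t - a)) \<in> I0" unfolding m by (rule LeastI[of _ l]) (rule ex)
    then have "?m (?t - a) \<le> b \<Longrightarrow> monR (a, b) \<in> I0" by (rule up) auto
    moreover have "monR (a, b) \<in> I0 \<Longrightarrow> ?m (?t - a) \<le> b" unfolding m by (rule Least_le)
    ultimately show ?thesis by blast
  next
    case False
    then have "monR (a, b) \<in> I0" using up[OF t] by simp
    then show ?thesis using False by (simp add: m_of_def)
  qed
  then show "monR (a, b) \<in> I0 \<longleftrightarrow> ?m (?t - a) \<le> b" .
  show "staircase ?t ?m"
  proof
    show "?m 0 = 0" by (simp add: m_of_def)
    fix i assume i: "i < ?t"
    let ?b = "?m (Suc i)"
    have u: "monR (?t - Suc i, ?b) \<in> I0" using iff[of "?t - Suc i" ?b] i by simp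
    have "?b \<noteq> 0" using below_t[of "?t - Suc i"] u i by (cases "?b = 0") auto
    then have "monR (?t - i, ?b - 1) \<in> I0"
    proof -
      have "tdegR (?t - i, ?b - 1) = tdegR (?t - Suc i, ?b)" "lex_less (?t - Suc i, ?b) (?t - i, ?b - 1)"
        using i \<open>?b \<noteq> 0\<close> by auto
      then show ?thesis using lex u unfolding lex_segment_ideal_def by blast
    qed
    then show "?m i < ?b" using iff[of "?t - i" "?b - 1"] i \<open>?b \<noteq> 0\<close> by simp
  qed
qed

lemma lookup_embS: "lookup (embS f) (a, b, c) = (if c = 0 then lookup f (a, b) else 0)"
proof -
  have "lookup (embS f) (a, b, c) = (\<Sum>v\<in>keys f. if v = (a, b) \<and> c = 0 then lookup f (a, b) else 0)"
    unfolding embS_def lookup_sum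
    by (rule sum.cong) (auto simp: lookup_single when_def split: prod.splits)
  also have "\<dots> = (if c = 0 then lookup f (a, b) else 0)"
    by (auto simp: not_in_keys_iff_lookup_eq_zero)
  finally show ?thesis .
qed

lemma keys_embS: "(a, b, c) \<in> keys (embS f) \<longleftrightarrow> c = 0 \<and> (a, b) \<in> keys f"
  by (simp add: in_keys_iff lookup_embS)

lemma embS_monR: "embS (monR (a, b)) = monS (a, b, 0)"
proof (rule poly_mapping_eqI)
  fix e :: "nat \<times> nat \<times> nat"
  show "lookup (embS (monR (a, b))) e = lookup (monS (a, b, 0)) e"
    by (cases e) (simp add: lookup_embS monR_def monS_def lookup_single when_def)
qed

lemma embS_uminus: "embS (- f) = - embS f"
proof (rule poly_mapping_eqI)
  fix e :: "nat \<times> nat \<times> nat"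
  show "lookup (embS (- f)) e = lookup (- embS f) e" by (cases e) (simp add: lookup_embS)
qed

lemma embS_0: "embS 0 = 0"
  by (simp add: embS_def)

lemma (in staircase) stairs_add: "e \<in> stairs \<Longrightarrow> e + e' \<in> stairs"
proof -
  assume "e \<in> stairs"
  then obtain a b c where e: "e = (a, b, c)" "m (t - a) \<le> b" by (auto simp: stairs_def)
  obtain a' b' c' where e': "e' = (a', b', c')" by (cases e')
  have "t - (a + a') \<le> t - a" "t - a \<le> t" by auto
  then have "m (t - (a + a')) \<le> m (t - a)" using m_diff_le add_leD1 by blast
  then show ?thesis using e e' by (auto simp: stairs_def)
qed

lemma (in staircase) extS_eq:
  assumes I: "monomial_ideal I" "\<And>a b. monR (a, b) \<in> I \<longleftrightarrow> m (t - a) \<le> b"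
  shows "extS I = {f :: 'k::field polyS. keys f \<subseteq> stairs}" (is "_ = ?M")
proof
  have "is_ideal ?M"
    unfolding is_ideal_iff
  proof (intro conjI ballI allI)
    fix f g :: "'k polyS" assume "f \<in> ?M" "g \<in> ?M"
    then show "f + g \<in> ?M" by (blast elim: keys_addE)
  next
    fix c f :: "'k polyS" assume f: "f \<in> ?M"
    have "e \<in> stairs" if e: "e \<in> keys (c * f)" for e
    proof -
      obtain e1 e2 where "e2 \<in> keys f" "e = e1 + e2" using e by (elim keys_multE)
      then show ?thesis using stairs_add[of e2 e1] f by (auto simp: add.commute)
    qed
    then show "c * f \<in> ?M" by blast
  qed simp
  moreover have "embS ` I \<subseteq> ?M"
    using monomial_ideal_eq(1)[OF I(1)] I(2) by (fastforce simp: keys_embS stairs_def)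
  ultimately show "extS I \<subseteq> ?M" unfolding extS_def by (intro ideal_gen_minimal)
  show "?M \<subseteq> extS I"
  proof
    fix f :: "'k polyS" assume f: "f \<in> ?M"
    have "Poly_Mapping.single e (lookup f e) \<in> extS I" if e: "e \<in> keys f" for e
    proof -
      obtain a b c where abc: "e = (a, b, c)" by (cases e)
      then have "monR (a, b) \<in> I" using f e I(2) by (auto simp: stairs_def)
      then have "embS (monR (a, b)) \<in> extS I" unfolding extS_def using ideal_gen_superset by blast
      then have "Poly_Mapping.single (0, 0, c) (lookup f e) * embS (monR (a, b)) \<in> extS I"
        unfolding extS_def by (rule ideal_mult[OF ideal_gen_is_ideal])
      then show ?thesis by (simp add: embS_monR monS_def mult_single abc)
    qed
    then have "(\<Sum>e\<in>keys f. Poly_Mapping.single e (lookup f e)) \<in> extS I"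
      unfolding extS_def by (intro ideal_sum ideal_gen_is_ideal)
    then show "f \<in> extS I" by (simp add: sum_single_keys)
  qed
qed

lemma (in staircase) V_hom_eq:
  "V_hom {f :: 'k::field polyS. keys f \<subseteq> stairs} = {J. homogeneous_ideal J \<and> lead_exps J = stairs}"
proof -
  have "initial_ideal J = {f. keys f \<subseteq> stairs} \<longleftrightarrow> lead_exps J = stairs"
    if "homogeneous_ideal J" for J :: "'k polyS set"
    using initial_ideal_eq[OF homogeneous_ideal_is_ideal[OF that]]
      support_set_inject[of "lead_exps J" stairs] by auto
  then show ?thesis unfolding V_hom_def by blast
qed

section \<open>Homogenizing the entries\<close>

text \<open>The homogenization of an entry to degree \<open>U\<close>. For \<open>g\<close> of degree above \<open>U\<close> the truncation to natural
  numbers makes the result meaningless, so the lemmas below bound the degree.\<close>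

definition hom_entry :: "int \<Rightarrow> 'k::field polyR \<Rightarrow> 'k polyS" where
  "hom_entry U g = (if g = 0 then 0 else monS (0, 0, nat (U - int (degR g))) * std_hom g)"

lemma degR_ge: "(a, b) \<in> keys g \<Longrightarrow> a + b \<le> degR g"
  unfolding degR_def by (rule Max_ge) force+

lemma lookup_std_hom: "lookup (std_hom g) (a, b, c) = (if a + b + c = degR g then lookup g (a, b) else 0)"
proof -
  have "lookup (std_hom g) (a, b, c)
      = (\<Sum>v\<in>keys g. if v = (a, b) \<and> a + b + c = degR g then lookup g (a, b) else 0)"
    unfolding std_hom_def lookup_sum
  proof (rule sum.cong)
    fix v assume v: "v \<in> keys g"
    obtain a' b' where "v = (a', b')" by (cases v)
    then show "lookup (case v of (a, b) \<Rightarrow> Poly_Mapping.single (a, b, degR g - tdegR (a, b)) (lookup g (a, b))) (a, b, c)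
        = (if v = (a, b) \<and> a + b + c = degR g then lookup g (a, b) else 0)"
      using degR_ge[of a' b' g] v by (auto simp: lookup_single when_def)
  qed simp
  also have "\<dots> = (if a + b + c = degR g then lookup g (a, b) else 0)"
    by (auto simp: not_in_keys_iff_lookup_eq_zero)
  finally show ?thesis .
qed

lemma Ky_D: "g \<in> Ky \<Longrightarrow> (a, b) \<in> keys g \<Longrightarrow> a = 0"
  by (auto simp: Ky_def)

lemma lookup_hom_entry:
  assumes g: "g \<in> Ky" "g = 0 \<or> int (degR g) \<le> U"
  shows "lookup (hom_entry U g) (a, b, c) = (if a = 0 \<and> int b + int c = U then lookup g (0, b) else 0)"
proof (cases "g = 0")
  case False
  define n where "n = nat (U - int (degR g))"
  have n: "int n + int (degR g) = U" using g False by (simp add: n_def)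
  have Ky: "lookup g (a, b) = 0" if "a \<noteq> 0" for a b
    using Ky_D[OF g(1), of a b] that by (auto simp: in_keys_iff)
  have "lookup (monS (0, 0, n) * std_hom g) (a, b, c) = (if n \<le> c then lookup (std_hom g) (a, b, c - n) else 0)"
  proof (cases "n \<le> c")
    case True
    then show ?thesis
      using lookup_single_mult[of "(0, 0, n)" 1 "std_hom g" "(a, b, c - n)"] by (simp add: monS_def)
  next
    case False
    then have "(a, b, c) \<notin> keys (monS (0, 0, n) * std_hom g)"
      by (auto simp: monS_def elim!: keys_multE split: if_splits)
    then have "lookup (monS (0, 0, n) * std_hom g) (a, b, c) = 0" by (simp only: not_in_keys_iff_lookup_eq_zero)
    then show ?thesis using False by simp
  qed
  moreover have "lookup g (0, b) = 0" if "int b + int c = U" "\<not> n \<le> c"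
  proof -
    have "(0, b) \<notin> keys g" using degR_ge[of 0 b g] that n by auto
    then show ?thesis by (simp only: not_in_keys_iff_lookup_eq_zero)
  qed
  ultimately show ?thesis
    using False n Ky[of a b] by (auto simp: hom_entry_def lookup_std_hom n_def[symmetric])
qed (simp add: hom_entry_def)

lemma hom_entry_inject:
  assumes "g \<in> Ky" "g = 0 \<or> int (degR g) \<le> U" "g' \<in> Ky" "g' = 0 \<or> int (degR g') \<le> U"
    and "hom_entry U g = hom_entry U g'"
  shows "g = g'"
proof (rule poly_mapping_eqI)
  have zero: "lookup h (a, b) = 0" if h: "h \<in> Ky" "h = 0 \<or> int (degR h) \<le> U" "a \<noteq> 0 \<or> U < int b"
    for h a b
  proof -
    have "(a, b) \<notin> keys h"
    proof
      assume k: "(a, b) \<in> keys h"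
      then have "a = 0" "a + b \<le> degR h" "h \<noteq> 0" using Ky_D[OF h(1)] degR_ge by auto
      then show False using h(2,3) by auto
    qed
    then show ?thesis by (simp only: not_in_keys_iff_lookup_eq_zero)
  qed
  fix v :: "nat \<times> nat"
  obtain a b where v: "v = (a, b)" by (cases v)
  show "lookup g v = lookup g' v"
  proof (cases "a \<noteq> 0 \<or> U < int b")
    case True
    then show ?thesis using zero[of g a b] zero[of g' a b] assms v by simp
  next
    case False
    then show ?thesis
      using arg_cong[OF assms(5), of "\<lambda>p. lookup p (0, b, nat (U - int b))"] v assms(1-4)
      by (simp add: lookup_hom_entry)
  qed
qed

text \<open>The preimage is the dehomogenization, written as a pullback along \<open>b \<mapsto> (b, U - b)\<close>, which recovers
  the exponent of \<open>z\<close> from the degree.\<close>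

lemma hom_entry_surj:
  assumes p: "homT U p"
  obtains g where "g \<in> Ky" "\<And>b. (0, b) \<in> keys g \<Longrightarrow> \<exists>c. (0, b, c) \<in> keys p"
    "g = 0 \<or> int (degR g) \<le> U \<Longrightarrow> hom_entry U g = p"
proof -
  define g where "g = Poly_Mapping.map_key (\<lambda>(a, b). (a, b, nat (U - int b))) p"
  have "inj (\<lambda>(a :: nat, b). (a, b, nat (U - int b)))" by (auto simp: inj_def)
  then have look: "lookup g (a, b) = lookup p (a, b, nat (U - int b))" for a b
    by (simp add: g_def map_key.rep_eq)
  have Ky: "g \<in> Ky" using homT_D[OF p] by (auto simp: Ky_def in_keys_iff look)
  moreover have "\<exists>c. (0, b, c) \<in> keys p" if "(0, b) \<in> keys g" for b
    using that by (auto simp: in_keys_iff look)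
  moreover have "hom_entry U g = p" if g: "g = 0 \<or> int (degR g) \<le> U"
  proof (rule poly_mapping_eqI)
    fix e :: "nat \<times> nat \<times> nat"
    obtain a b c where e: "e = (a, b, c)" by (cases e)
    show "lookup (hom_entry U g) e = lookup p e"
    proof (cases "a = 0 \<and> int b + int c = U")
      case True
      then have "nat (U - int b) = c" by auto
      then show ?thesis using True e by (simp add: lookup_hom_entry[OF Ky g] look)
    next
      case False
      then have "(a, b, c) \<notin> keys p" using homT_D[OF p] by blast
      then have "lookup p (a, b, c) = 0" by (simp only: not_in_keys_iff_lookup_eq_zero)
      then show ?thesis using False e by (auto simp: lookup_hom_entry[OF Ky g])
    qed
  qed
  ultimately show thesis by (rule that)
qed

section \<open>The parametrization\<close>

theorem theorem6p8:
  fixes I0 :: "'k::field polyR set" and J0 :: "'k polyS set"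
  assumes "lex_segment_ideal I0"
    and "finite_dim_quotient I0"
    and "J0 = extS I0"
  shows "(\<forall>A\<in>A_set I0. psi_bar I0 A \<in> V_hom J0) \<and> bij_betw (psi_bar I0) (A_set I0) (V_hom J0)"
proof -
  interpret staircase "t_of I0" "m_of I0" by (rule staircase_lex_segment[OF assms(1,2)])
  let ?t = "t_of I0"
  have mono: "monomial_ideal I0" using assms(1) by (simp add: lex_segment_ideal_def)
  have V: "V_hom J0 = {J. homogeneous_ideal J \<and> lead_exps J = stairs}"
    unfolding assms(3) extS_eq[OF mono monR_mem_iff[OF assms(1,2)]] by (rule V_hom_eq)
  have d_of: "d_of I0 (Suc i) = int (d i)" if "i < ?t" for i
    using m_less[OF that] by (simp add: d_of_def d_def)
  have u_of: "u_of I0 (Suc i) (Suc j) = u i j" if "i \<le> ?t" "j < ?t" for i j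
    using that by (simp add: u_of_def u_alt)
  have u_ge: "int (d i) \<le> u i j" if "i \<le> j" "j < ?t" for i j
    using that m_diff_le[of "Suc i" "Suc j"] m_plus_d[of i] by (simp add: u_alt)
  have bound: "int b \<le> deg_bound I0 (Suc i) (Suc j) \<longleftrightarrow> b < d (min i j) \<and> int b \<le> u i j"
    if "i \<le> ?t" "j < ?t" for i j b
    using that u_of[OF that] u_ge[of i j] d_of[of i] d_of[of j]
    by (auto simp: deg_bound_def min_def)
  define \<beta> where "\<beta> A i j = hom_mat I0 A $$ (i, j)" for A :: "'k polyR mat" and i j
  have \<beta>_eq: "\<beta> A i j = hom_entry (u i j) (A $$ (i, j))" if "i \<le> ?t" "j < ?t" for A i j
    using that by (simp add: \<beta>_def hom_mat_def hom_entry_def u_of)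
  have A_entry: "A $$ (i, j) \<in> Ky"
      "A $$ (i, j) = 0 \<or> int (degR (A $$ (i, j))) \<le> deg_bound I0 (Suc i) (Suc j)"
    if "A \<in> A_set I0" "i \<le> ?t" "j < ?t" for A i j
    using that by (auto simp: A_set_def)
  have A_entry_u: "A $$ (i, j) = 0 \<or> int (degR (A $$ (i, j))) \<le> u i j"
    if "A \<in> A_set I0" "i \<le> ?t" "j < ?t" for A i j
    using A_entry(2)[OF that] bound[OF that(2,3)] by auto
  have entry_keys: "a = 0 \<and> int b + int c = u i j \<and> b < d (min i j)"
    if A: "A \<in> A_set I0" and ij: "i \<le> ?t" "j < ?t" and k: "(a, b, c) \<in> keys (\<beta> A i j)"
    for A i j a b c
  proof -
    have "lookup (\<beta> A i j) (a, b, c) \<noteq> 0" using k by (simp add: in_keys_iff)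
    then have *: "a = 0" "int b + int c = u i j" "lookup (A $$ (i, j)) (0, b) \<noteq> 0"
      unfolding \<beta>_eq[OF ij] lookup_hom_entry[OF A_entry(1)[OF A ij] A_entry_u[OF A ij]]
      by (auto split: if_splits)
    then have "b \<le> degR (A $$ (i, j))" "A $$ (i, j) \<noteq> 0"
      using degR_ge[of 0 b "A $$ (i, j)"] by (auto simp: in_keys_iff)
    then have "int b \<le> deg_bound I0 (Suc i) (Suc j)" using A_entry(2)[OF A ij] by auto
    then show ?thesis using bound[OF ij] * by auto
  qed
  have \<beta>: "homTmat (\<beta> A)" "normal (\<beta> A)" if "A \<in> A_set I0" for A
    using entry_keys[OF that] unfolding homTmat_def homT_def normal_def ynormal_def by blast+
  have \<beta>_wt: "wt 1 i j (\<beta> A i j)" if "A \<in> A_set I0" "i \<le> ?t" "j < ?t" for A i j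
    using \<beta>[OF that(1)] that by (intro ynormal_wt) (auto simp: homTmat_def normal_def)
  have psi: "psi_bar I0 A = ideal_gen (hb_basis (\<beta> A) ` {..?t})" for A
  proof -
    have "map_mat embS (X_mat I0) + hom_mat I0 A = hb_matrix (\<beta> A)"
    proof (rule eq_matI)
      fix i j assume "i < dim_row (hb_matrix (\<beta> A))" "j < dim_col (hb_matrix (\<beta> A))"
      then have ij: "i \<le> ?t" "j < ?t" by (auto simp: hb_matrix_def)
      then show "(map_mat embS (X_mat I0) + hom_mat I0 A) $$ (i, j) = hb_matrix (\<beta> A) $$ (i, j)"
        by (auto simp: hb_matrix_def X_mat_def hom_mat_def \<beta>_def d_of embS_monR embS_uminus embS_0
            X_def Y_def)
    qed (auto simp: hb_matrix_def hom_mat_def)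
    then show ?thesis by (simp add: psi_bar_def minors_ideal_hb)
  qed
  have shaped: "shaped i (hb_basis (\<beta> A) i)" if "A \<in> A_set I0" "i \<le> ?t" for A i
    using \<beta>[OF that(1)] \<beta>_wt[OF that(1)] that(2) by (intro shaped_hb_basis) auto
  have well_defined: "psi_bar I0 A \<in> V_hom J0" if A: "A \<in> A_set I0" for A
  proof -
    have "homogeneous f" if "f \<in> hb_basis (\<beta> A) ` {..?t}" for f
      using that shaped[OF A] unfolding homogeneous_def shaped_def by blast
    then have "homogeneous_ideal (psi_bar I0 A)" unfolding homogeneous_ideal_def psi by blast
    moreover have "lead_exps (psi_bar I0 A) = stairs"
      unfolding psi by (rule lead_exps_of_rel[OF shaped[OF A] rel_hb_basis \<beta>(1)[OF A]])
    ultimately show ?thesis unfolding V by blast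
  qed
  have mem: "hb_basis (\<beta> A) i \<in> psi_bar I0 A" if "i \<le> ?t" for A i
    unfolding psi using that by (intro subsetD[OF ideal_gen_superset]) simp
  have "inj_on (psi_bar I0) (A_set I0)"
  proof (rule inj_onI)
    fix A A' assume A: "A \<in> A_set I0" "A' \<in> A_set I0" and eq: "psi_bar I0 A = psi_bar I0 A'"
    let ?J = "psi_bar I0 A"
    have J: "is_ideal ?J" "lead_exps ?J \<subseteq> stairs"
      using well_defined[OF A(1)] homogeneous_ideal_is_ideal unfolding V by auto
    have "A $$ (i, j) = A' $$ (i, j)" if ij: "i \<le> ?t" "j < ?t" for i j
    proof -
      have "\<beta> A i j = \<beta> A' i j"
        by (rule normal_rel_unique[OF J, of "hb_basis (\<beta> A)" "hb_basis (\<beta> A')"])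
          (use mem eq shaped A \<beta> rel_hb_basis ij in auto)
      then show ?thesis
        unfolding \<beta>_eq[OF ij]
        by (rule hom_entry_inject[OF A_entry(1)[OF A(1) ij] A_entry_u[OF A(1) ij]
              A_entry(1)[OF A(2) ij] A_entry_u[OF A(2) ij]])
    qed
    then show "A = A'" using A by (intro eq_matI) (auto simp: A_set_def)
  qed
  moreover have "J \<in> psi_bar I0 ` A_set I0" if "J \<in> V_hom J0" for J
  proof -
    have J: "homogeneous_ideal J" "lead_exps J = stairs" using that unfolding V by auto
    obtain f \<alpha> where f: "\<And>i. i \<le> ?t \<Longrightarrow> f i \<in> J \<and> shaped i (f i)"
      and \<alpha>: "rel f \<alpha>" "homTmat \<alpha>" "normal (\<alpha> :: nat \<Rightarrow> nat \<Rightarrow> 'k polyS)"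
      using ex_normal_rel[OF J] by blast
    have "\<exists>g. g \<in> Ky \<and> (g = 0 \<or> int (degR g) \<le> deg_bound I0 (Suc i) (Suc j)) \<and>
        hom_entry (u i j) g = \<alpha> i j" if ij: "i \<le> ?t" "j < ?t" for i j
    proof -
      have hom: "homT (u i j) (\<alpha> i j)" and yn: "ynormal i j (\<alpha> i j)"
        using \<alpha> ij by (auto simp: homTmat_def normal_def)
      obtain g where g: "g \<in> Ky" "\<And>b. (0, b) \<in> keys g \<Longrightarrow> \<exists>c. (0, b, c) \<in> keys (\<alpha> i j)"
        "g = 0 \<or> int (degR g) \<le> u i j \<Longrightarrow> hom_entry (u i j) g = \<alpha> i j"
        using hom_entry_surj[OF hom] by blast
      have deg: "int (degR g) \<le> deg_bound I0 (Suc i) (Suc j)" if "g \<noteq> 0"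
      proof -
        have "degR g \<in> tdegR ` keys g" unfolding degR_def using that by (intro Max_in) auto
        then obtain a b where ab: "(a, b) \<in> keys g" "degR g = a + b" by auto
        then have "a = 0" using g(1) by (auto simp: Ky_def)
        then obtain c where c: "(0, b, c) \<in> keys (\<alpha> i j)" using g(2) ab by blast
        then have "b < d (min i j)" "int b \<le> u i j"
          using yn homT_D[OF hom c] by (auto simp: ynormal_def)
        then show ?thesis using bound[OF ij, of b] ab \<open>a = 0\<close> by simp
      qed
      then have "g = 0 \<or> int (degR g) \<le> u i j" using bound[OF ij] by auto
      then show ?thesis using g(1,3) deg by blast
    qed
    then obtain G where G: "\<And>i j. i \<le> ?t \<Longrightarrow> j < ?t \<Longrightarrow> G i j \<in> Ky \<and>
        (G i j = 0 \<or> int (degR (G i j)) \<le> deg_bound I0 (Suc i) (Suc j)) \<and>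
        hom_entry (u i j) (G i j) = \<alpha> i j"
      by metis
    define A where "A = mat (?t + 1) ?t (\<lambda>(i, j). G i j)"
    have A: "A \<in> A_set I0" using G by (auto simp: A_set_def A_def)
    have eq: "\<beta> A i j = \<alpha> i j" if "i \<le> ?t" "j < ?t" for i j
      using \<beta>_eq[OF that] G[OF that] that by (simp add: A_def)
    have "rel f (\<beta> A)" using \<alpha>(1) eq by (simp add: rel_def)
    then have "f i = hb_basis (\<beta> A) i" if "i \<le> ?t" for i
      using rel_unique[of f "hb_basis (\<beta> A)" "\<beta> A" i] f shaped[OF A] rel_hb_basis \<beta>(1)[OF A] that by blast
    then have "hb_basis (\<beta> A) i \<in> J" if "i \<le> ?t" for i using f[OF that] that by simp
    then have "hb_basis (\<beta> A) ` {..?t} \<subseteq> J" by blast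
    then have "psi_bar I0 A \<subseteq> J"
      unfolding psi by (rule ideal_gen_minimal[OF _ homogeneous_ideal_is_ideal[OF J(1)]])
    moreover have "lead_exps J \<subseteq> lead_exps (psi_bar I0 A)"
      using well_defined[OF A] J(2) unfolding V by auto
    moreover have "is_ideal (psi_bar I0 A)" unfolding psi by (rule ideal_gen_is_ideal)
    ultimately have "psi_bar I0 A = J"
      using ideal_eq_of_lead_exps homogeneous_ideal_is_ideal[OF J(1)] by blast
    then show ?thesis using A by blast
  qed
  ultimately have "bij_betw (psi_bar I0) (A_set I0) (V_hom J0)"
    unfolding bij_betw_def using well_defined by blast
  then show ?thesis using well_defined by blast
qed

end
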